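(* Let $M$ be a connected smooth manifold of dimension $2$ and let $S$ be a spray on $M$ of non-vanishing Ricci curvature (i.e. $\operatorname{Tr}\Phi$ vanishes nowhere on $T_0M$), with Jacobi endomorphism $\Phi=R^i_j\frac{\partial}{\partial y^i}\otimes dx^j$, such that $\operatorname{rank}\,dd_J(\operatorname{Tr}\Phi)=4$ on $T_0M$. \begin{itemize} \item[(i)] The spray $S$ is isotropic, i.e. $\Phi=RJ-\alpha\otimes\mathbb{C}$ where $R$ is the Ricci scalar and the semi-basic $1$-form $\alpha=\alpha_i\,dx^i$ has the components $$\alpha_1=\frac{R^2_2}{y^1}=\frac{-R^2_1}{y^2},\qquad \alpha_2=\frac{-R^1_2}{y^1}=\frac{R^1_1}{y^2}$$ (each quotient being understood where its denominator is non-zero). \item[(ii)] The spray $S$ is metrizable by a Finsler function of non-zero constant flag curvature if and only if it satisfies the two conditions $$d_J\alpha=0,\qquad d_hR=0.$$ \end{itemize}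
   Context: $M$ is a $C^\infty$ real connected manifold of dimension $n=2$; $T_0M=TM\setminus\{0\}$ is the tangent bundle with the zero section removed, with induced coordinates $(x^i,y^i)$. Summation over repeated indices is understood. The tangent structure and the Liouville vector field are $J=\frac{\partial}{\partial y^i}\otimes dx^i$ and $\mathbb{C}=y^i\frac{\partial}{\partial y^i}$. A spray is a smooth vector field $S$ on $T_0M$ with $JS=\mathbb{C}$ and $[\mathbb{C},S]=S$; locally $S=y^i\frac{\partial}{\partial x^i}-2G^i(x,y)\frac{\partial}{\partial y^i}$ with $G^i$ smooth and (positively) $2$-homogeneous in $y$. The horizontal and vertical projectors of $S$ are $h=\frac12(\operatorname{Id}-\mathcal{L}_SJ)$, $v=\frac12(\operatorname{Id}+\mathcal{L}_SJ)$; locally $h(\partial/\partial x^i)=\frac{\delta}{\delta x^i}=\frac{\partial}{\partial x^i}-\frac{\partial G^j}{\partial y^i}\frac{\partial}{\partial y^j}$ and $h(\partial/\partial y^i)=0$. The Jacobi endomorphism of $S$ is the vector-valued semi-basic $1$-form $\Phi=v\circ\mathcal{L}_Sh=R^i_j\frac{\partial}{\partial y^i}\otimes dx^j$, with $$R^i_j=2\frac{\partial G^i}{\partial x^j}-S\!\left(\frac{\partial G^i}{\partial y^j}\right)-\frac{\partial G^i}{\partial y^r}\frac{\partial G^r}{\partial y^j}.$$ The Ricci curvature is $\operatorname{Ric}=\operatorname{Tr}(\Phi)=R^i_i$; the Ricci scalar $R$ is defined by $\operatorname{Ric}=(n-1)R$, so for $n=2$ one has $R=R^1_1+R^2_2$.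 A semi-basic $1$-form is one locally of the form $\alpha=\alpha_i(x,y)dx^i$. For a vector-valued $1$-form $L$, $d_L=i_L\circ d-d\circ i_L$ (Frölicher–Nijenhuis derivation). On functions, $d_Lf=df\circ L$; thus $d_Jf=\frac{\partial f}{\partial y^i}dx^i$ and $d_hf=\frac{\delta f}{\delta x^i}dx^i$; for semi-basic $\alpha$, $d_J\alpha=\frac{\partial\alpha_j}{\partial y^i}dx^i\wedge dx^j$. The rank of $dd_J(\operatorname{Tr}\Phi)$ is its rank as a $2$-form at each point of the $4$-dimensional manifold $T_0M$. A Finsler function is a continuous function $F:TM\to\mathbb{R}$ such that: (1) $F$ is smooth and strictly positive on $T_0M$; (2) $F(x,\lambda y)=\lambda F(x,y)$ for all $\lambda\ge0$, $(x,y)\in TM$; (3) the matrix $g_{ij}=\frac12\frac{\partial^2F^2}{\partial y^i\partial y^j}$ has rank $n$ on $T_0M$. Its geodesic spray is the unique vector field $S$ on $T_0M$ with $i_Sdd_JF^2=-dF^2$ (equivalently $\mathcal{L}_Sd_JF^2=dF^2$). A spray $S$ is metrizable by $F$ if it satisfies this equation. A Finsler function $F$ with geodesic spray $S$ has constant flag curvature $\kappa$ if $\kappa$ is a constant and the Jacobi endomorphism of $S$ is $\Phi=\kappa\left(F^2J-F\,d_JF\otimes\mathbb{C}\right)$. *)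

theory Defs
  imports "HOL-Analysis.Analysis"
begin

section \<open>Smooth manifolds given by an atlas\<close>

text \<open>\<open>smooth_on U f\<close> is meant for open sets \<open>U\<close>: all iterated directional derivatives of \<open>f\<close> exist
  and are differentiable on \<open>U\<close>.\<close>

primrec Ck_on :: "nat \<Rightarrow> 'e::euclidean_space set \<Rightarrow> ('e \<Rightarrow> 'f::real_normed_vector) \<Rightarrow> bool" where
  "Ck_on 0 U f = continuous_on U f"
| "Ck_on (Suc k) U f =
     ((\<forall>x\<in>U. f differentiable (at x)) \<and> (\<forall>v. Ck_on k U (\<lambda>x. frechet_derivative f (at x) v)))"

definition smooth_on :: "'e::euclidean_space set \<Rightarrow> ('e \<Rightarrow> 'f::real_normed_vector) \<Rightarrow> bool" where
  "smooth_on U f \<longleftrightarrow> (\<forall>k. Ck_on k U f)"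

text \<open>A chart is a pair of a domain and a coordinate map; the map is only relevant on the domain.\<close>

type_synonym ('a, 'e) chart = "'a set \<times> ('a \<Rightarrow> 'e)"

definition chart_image :: "('a, 'e) chart \<Rightarrow> 'e set" where
  "chart_image c = snd c ` fst c"

definition chart_inv :: "('a, 'e) chart \<Rightarrow> 'e \<Rightarrow> 'a" where
  "chart_inv c = inv_into (fst c) (snd c)"

definition transition :: "('a, 'e) chart \<Rightarrow> ('a, 'e) chart \<Rightarrow> 'e \<Rightarrow> 'e" where
  "transition c c' = snd c' \<circ> chart_inv c"

definition smooth_atlas :: "('a, 'e::euclidean_space) chart set \<Rightarrow> bool" where
  "smooth_atlas A \<longleftrightarrow>
     (\<forall>c\<in>A. inj_on (snd c) (fst c) \<and> open (chart_image c)) \<and>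
     (\<forall>c\<in>A. \<forall>c'\<in>A. open (snd c ` (fst c \<inter> fst c')) \<and>
        smooth_on (snd c ` (fst c \<inter> fst c')) (transition c c'))"

definition carrier_of :: "('a, 'e) chart set \<Rightarrow> 'a set" where
  "carrier_of A = (\<Union>c\<in>A. fst c)"

definition manifold_topology :: "('a, 'e::euclidean_space) chart set \<Rightarrow> 'a topology" where
  "manifold_topology A =
     topology (\<lambda>W. W \<subseteq> carrier_of A \<and> (\<forall>c\<in>A. open (snd c ` (W \<inter> fst c))))"

lemma openin_manifold_topology:
  assumes "smooth_atlas A"
  shows "openin (manifold_topology A) W \<longleftrightarrow>
           W \<subseteq> carrier_of A \<and> (\<forall>c\<in>A. open (snd c ` (W \<inter> fst c)))"
proof -
  have "istopology (\<lambda>W. W \<subseteq> carrier_of A \<and> (\<forall>c\<in>A. open (snd c ` (W \<inter> fst c))))"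
    unfolding istopology_def
  proof (intro conjI allI impI ballI)
    fix S T c
    assume S: "S \<subseteq> carrier_of A \<and> (\<forall>c\<in>A. open (snd c ` (S \<inter> fst c)))"
      and T: "T \<subseteq> carrier_of A \<and> (\<forall>c\<in>A. open (snd c ` (T \<inter> fst c)))"
    show "S \<inter> T \<subseteq> carrier_of A" using S by blast
    assume c: "c \<in> A"
    have "inj_on (snd c) (fst c)" using assms c by (simp add: smooth_atlas_def)
    then have "snd c ` (S \<inter> T \<inter> fst c) = snd c ` (S \<inter> fst c) \<inter> snd c ` (T \<inter> fst c)"
      by (auto simp: inj_on_def)
    then show "open (snd c ` (S \<inter> T \<inter> fst c))" using S T c by auto
  next
    fix K c
    assume K: "\<forall>k\<in>K. k \<subseteq> carrier_of A \<and> (\<forall>c\<in>A. open (snd c ` (k \<inter> fst c)))"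
    then show "\<Union>K \<subseteq> carrier_of A" by blast
    assume c: "c \<in> A"
    have "snd c ` (\<Union>K \<inter> fst c) = (\<Union>k\<in>K. snd c ` (k \<inter> fst c))" by auto
    then show "open (snd c ` (\<Union>K \<inter> fst c))" using K c by auto
  qed
  then show ?thesis by (simp add: manifold_topology_def)
qed

definition smooth_manifold :: "('a, 'e::euclidean_space) chart set \<Rightarrow> bool" where
  "smooth_manifold A \<longleftrightarrow> smooth_atlas A \<and>
     Hausdorff_space (manifold_topology A) \<and> second_countable (manifold_topology A)"

definition smooth_fun :: "('a, 'e::euclidean_space) chart set \<Rightarrow> ('a \<Rightarrow> real) \<Rightarrow> bool" where
  "smooth_fun A f \<longleftrightarrow> (\<forall>c\<in>A. smooth_on (chart_image c) (f \<circ> chart_inv c))"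

text \<open>A tangent vector at \<open>p\<close> is the family of its component vectors in the charts around \<open>p\<close>, related
  by the Jacobians of the transition maps. The components in all other charts are fixed to be \<open>0\<close>,
  so that equal tangent vectors are equal as functions.\<close>

type_synonym ('a, 'e) tvec = "('a, 'e) chart \<Rightarrow> 'e"

definition tangent_vector ::
    "('a, 'e::euclidean_space) chart set \<Rightarrow> 'a \<Rightarrow> ('a, 'e) tvec \<Rightarrow> bool" where
  "tangent_vector A p v \<longleftrightarrow> p \<in> carrier_of A \<and>
     (\<forall>c. c \<notin> A \<or> p \<notin> fst c \<longrightarrow> v c = 0) \<and>
     (\<forall>c\<in>A. \<forall>c'\<in>A. p \<in> fst c \<inter> fst c' \<longrightarrow>
        v c' = frechet_derivative (transition c c') (at (snd c p)) (v c))"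

definition smooth_vector_field ::
    "('a, 'e::euclidean_space) chart set \<Rightarrow> ('a \<Rightarrow> ('a, 'e) tvec) \<Rightarrow> bool" where
  "smooth_vector_field A X \<longleftrightarrow> (\<forall>p\<in>carrier_of A. tangent_vector A p (X p)) \<and>
     (\<forall>c\<in>A. smooth_on (chart_image c) (\<lambda>z. X (chart_inv c z) c))"

text \<open>A \<open>1\<close>-form likewise assigns to a point and a chart around it a linear functional on component
  vectors, compatibly with the transformation of tangent vectors.\<close>

definition smooth_one_form ::
    "('a, 'e::euclidean_space) chart set \<Rightarrow> ('a \<Rightarrow> ('a, 'e) chart \<Rightarrow> 'e \<Rightarrow> real) \<Rightarrow> bool" where
  "smooth_one_form A \<omega> \<longleftrightarrow>
     (\<forall>c\<in>A. \<forall>p\<in>fst c. linear (\<omega> p c)) \<and>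
     (\<forall>c\<in>A. \<forall>c'\<in>A. \<forall>p\<in>fst c \<inter> fst c'. \<forall>u.
        \<omega> p c u = \<omega> p c' (frechet_derivative (transition c c') (at (snd c p)) u)) \<and>
     (\<forall>c\<in>A. \<forall>u. smooth_on (chart_image c) (\<lambda>z. \<omega> (chart_inv c z) c u))"

definition fun_coords :: "('a, 'e) chart \<Rightarrow> ('a \<Rightarrow> real) \<Rightarrow> 'e \<Rightarrow> real" where
  "fun_coords c f z = f (chart_inv c z)"

definition vf_coords :: "('a, 'e) chart \<Rightarrow> ('a \<Rightarrow> ('a, 'e) tvec) \<Rightarrow> 'e \<Rightarrow> 'e" where
  "vf_coords c X z = X (chart_inv c z) c"

definition form_coords ::
    "('a, 'e) chart \<Rightarrow> ('a \<Rightarrow> ('a, 'e) chart \<Rightarrow> 'e \<Rightarrow> real) \<Rightarrow> 'e \<Rightarrow> 'e \<Rightarrow> real" where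
  "form_coords c \<omega> z = \<omega> (chart_inv c z) c"


section \<open>The tangent bundle and the slit tangent bundle\<close>

text \<open>Both carry the induced coordinates \<open>(x, y)\<close>, with values in \<open>'e \<times> 'e\<close>.\<close>

type_synonym ('a, 'e) tpoint = "'a \<times> ('a, 'e) tvec"

definition tangent_chart ::
    "('a, 'e::euclidean_space) chart set \<Rightarrow> ('a, 'e) chart \<Rightarrow> (('a, 'e) tpoint, 'e \<times> 'e) chart" where
  "tangent_chart A c = ({(p, v). p \<in> fst c \<and> tangent_vector A p v}, (\<lambda>(p, v). (snd c p, v c)))"

definition tangent_atlas ::
    "('a, 'e::euclidean_space) chart set \<Rightarrow> (('a, 'e) tpoint, 'e \<times> 'e) chart set" where
  "tangent_atlas A = tangent_chart A ` A"

definition slit_chart ::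
    "('a, 'e::euclidean_space) chart set \<Rightarrow> ('a, 'e) chart \<Rightarrow> (('a, 'e) tpoint, 'e \<times> 'e) chart" where
  "slit_chart A c =
     ({(p, v). p \<in> fst c \<and> tangent_vector A p v \<and> v \<noteq> (\<lambda>_. 0)}, (\<lambda>(p, v). (snd c p, v c)))"

definition slit_atlas ::
    "('a, 'e::euclidean_space) chart set \<Rightarrow> (('a, 'e) tpoint, 'e \<times> 'e) chart set" where
  "slit_atlas A = slit_chart A ` A"


section \<open>Tensor calculus in a chart\<close>

text \<open>In a chart, vector fields, functions, \<open>1\<close>-forms, \<open>2\<close>-forms and vector-valued \<open>1\<close>-forms have types
  \<open>'z \<Rightarrow> 'z\<close>, \<open>'z \<Rightarrow> real\<close>, \<open>'z \<Rightarrow> 'z \<Rightarrow> real\<close>, \<open>'z \<Rightarrow> 'z \<Rightarrow> 'z \<Rightarrow> real\<close> and \<open>'z \<Rightarrow> 'z \<Rightarrow> 'z\<close>, the first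
  argument being the point. Tensorial expressions are evaluated on vectors by extending these to
  constant-coefficient vector fields.\<close>

definition lie_bracket ::
    "('z::euclidean_space \<Rightarrow> 'z) \<Rightarrow> ('z \<Rightarrow> 'z) \<Rightarrow> 'z \<Rightarrow> 'z" where
  "lie_bracket X Y z = frechet_derivative Y (at z) (X z) - frechet_derivative X (at z) (Y z)"

text \<open>\<open>(\<L>\<^sub>S K)(U) = [S, K U] - K [S, U]\<close>\<close>

definition lie_deriv ::
    "('z::euclidean_space \<Rightarrow> 'z) \<Rightarrow> ('z \<Rightarrow> 'z \<Rightarrow> 'z) \<Rightarrow> 'z \<Rightarrow> 'z \<Rightarrow> 'z" where
  "lie_deriv S K z u = lie_bracket S (\<lambda>w. K w u) z - K z (lie_bracket S (\<lambda>_. u) z)"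

definition ext_d0 :: "('z::euclidean_space \<Rightarrow> real) \<Rightarrow> 'z \<Rightarrow> 'z \<Rightarrow> real" where
  "ext_d0 f z u = frechet_derivative f (at z) u"

text \<open>\<open>d\<omega>(U, V) = U(\<omega>(V)) - V(\<omega>(U)) - \<omega>([U, V])\<close>, where \<open>[U, V] = 0\<close> for constant coefficients\<close>

definition ext_d1 :: "('z::euclidean_space \<Rightarrow> 'z \<Rightarrow> real) \<Rightarrow> 'z \<Rightarrow> 'z \<Rightarrow> 'z \<Rightarrow> real" where
  "ext_d1 \<omega> z u v =
     frechet_derivative (\<lambda>w. \<omega> w v) (at z) u - frechet_derivative (\<lambda>w. \<omega> w u) (at z) v"

definition contract1 :: "('z \<Rightarrow> 'z \<Rightarrow> 'z) \<Rightarrow> ('z \<Rightarrow> 'z \<Rightarrow> real) \<Rightarrow> 'z \<Rightarrow> 'z \<Rightarrow> real" where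
  "contract1 L \<omega> z u = \<omega> z (L z u)"

definition contract2 ::
    "('z \<Rightarrow> 'z \<Rightarrow> 'z) \<Rightarrow> ('z \<Rightarrow> 'z \<Rightarrow> 'z \<Rightarrow> real) \<Rightarrow> 'z \<Rightarrow> 'z \<Rightarrow> 'z \<Rightarrow> real" where
  "contract2 L \<Omega> z u v = \<Omega> z (L z u) v + \<Omega> z u (L z v)"

text \<open>\<open>d\<^sub>L = i\<^sub>L \<circ> d - d \<circ> i\<^sub>L\<close> on functions (where \<open>i\<^sub>L f = 0\<close>) and on \<open>1\<close>-forms\<close>

definition fn_d0 ::
    "('z::euclidean_space \<Rightarrow> 'z \<Rightarrow> 'z) \<Rightarrow> ('z \<Rightarrow> real) \<Rightarrow> 'z \<Rightarrow> 'z \<Rightarrow> real" where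
  "fn_d0 L f = contract1 L (ext_d0 f)"

definition fn_d1 ::
    "('z::euclidean_space \<Rightarrow> 'z \<Rightarrow> 'z) \<Rightarrow> ('z \<Rightarrow> 'z \<Rightarrow> real) \<Rightarrow> 'z \<Rightarrow> 'z \<Rightarrow> 'z \<Rightarrow> real" where
  "fn_d1 L \<omega> z u v = contract2 L (ext_d1 \<omega>) z u v - ext_d1 (contract1 L \<omega>) z u v"

text \<open>The rank of a bilinear form \<open>B\<close> is the rank of the map \<open>u \<mapsto> B u\<close> into the dual space, the latter
  being identified with \<open>'z\<close> through the standard basis.\<close>

definition form_rank :: "('z::euclidean_space \<Rightarrow> 'z \<Rightarrow> real) \<Rightarrow> nat" where
  "form_rank B = dim (range (\<lambda>u. \<Sum>b\<in>Basis. B u b *\<^sub>R b))"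


section \<open>Sprays\<close>

text \<open>The tangent structure \<open>J = \<partial>/\<partial>y\<^sup>i \<otimes> dx\<^sup>i\<close> and the Liouville field \<open>\<C> = y\<^sup>i \<partial>/\<partial>y\<^sup>i\<close> have the same
  expression in all induced charts. \<open>h_proj\<close>, \<open>v_proj\<close> and \<open>jacobi\<close> are
  \<open>h = 1/2 (Id - \<L>\<^sub>S J)\<close>, \<open>v = 1/2 (Id + \<L>\<^sub>S J)\<close> and \<open>\<Phi> = v \<circ> \<L>\<^sub>S h\<close>.\<close>

definition tangent_J :: "'e::euclidean_space \<times> 'e \<Rightarrow> 'e \<times> 'e \<Rightarrow> 'e \<times> 'e" where
  "tangent_J z u = (0, fst u)"

definition liouville :: "'e::euclidean_space \<times> 'e \<Rightarrow> 'e \<times> 'e" where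
  "liouville z = (0, snd z)"

definition spray ::
    "('a, 'e::euclidean_space) chart set \<Rightarrow>
     (('a, 'e) tpoint \<Rightarrow> (('a, 'e) tpoint, 'e \<times> 'e) tvec) \<Rightarrow> bool" where
  "spray A S \<longleftrightarrow> smooth_vector_field (slit_atlas A) S \<and>
     (\<forall>c\<in>slit_atlas A. \<forall>z\<in>chart_image c.
        tangent_J z (vf_coords c S z) = liouville z \<and>
        lie_bracket liouville (vf_coords c S) z = vf_coords c S z)"

definition h_proj ::
    "('e::euclidean_space \<times> 'e \<Rightarrow> 'e \<times> 'e) \<Rightarrow> 'e \<times> 'e \<Rightarrow> 'e \<times> 'e \<Rightarrow> 'e \<times> 'e" where
  "h_proj S z u = (1/2) *\<^sub>R (u - lie_deriv S tangent_J z u)"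

definition v_proj ::
    "('e::euclidean_space \<times> 'e \<Rightarrow> 'e \<times> 'e) \<Rightarrow> 'e \<times> 'e \<Rightarrow> 'e \<times> 'e \<Rightarrow> 'e \<times> 'e" where
  "v_proj S z u = (1/2) *\<^sub>R (u + lie_deriv S tangent_J z u)"

definition jacobi ::
    "('e::euclidean_space \<times> 'e \<Rightarrow> 'e \<times> 'e) \<Rightarrow> 'e \<times> 'e \<Rightarrow> 'e \<times> 'e \<Rightarrow> 'e \<times> 'e" where
  "jacobi S z u = v_proj S z (lie_deriv S (h_proj S) z u)"

text \<open>\<open>jacobi_comp S i j\<close> is \<open>R\<^sup>i\<^sub>j\<close>, the coefficient of \<open>\<partial>/\<partial>y\<^sup>i \<otimes> dx\<^sup>j\<close>.\<close>

definition jacobi_comp ::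
    "((real^'n) \<times> (real^'n) \<Rightarrow> (real^'n) \<times> (real^'n)) \<Rightarrow> 'n::finite \<Rightarrow> 'n \<Rightarrow>
     (real^'n) \<times> (real^'n) \<Rightarrow> real" where
  "jacobi_comp S i j z = snd (jacobi S z (axis j 1, 0)) $ i"

definition ricci ::
    "((real^'n::finite) \<times> (real^'n) \<Rightarrow> (real^'n) \<times> (real^'n)) \<Rightarrow>
     (real^'n) \<times> (real^'n) \<Rightarrow> real" where
  "ricci S z = (\<Sum>i\<in>UNIV. jacobi_comp S i i z)"

definition ricci_scalar ::
    "((real^'n::finite) \<times> (real^'n) \<Rightarrow> (real^'n) \<times> (real^'n)) \<Rightarrow>
     (real^'n) \<times> (real^'n) \<Rightarrow> real" where
  "ricci_scalar S z = ricci S z / (real CARD('n) - 1)"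

definition semi_basic ::
    "('a, 'e::euclidean_space) chart set \<Rightarrow>
     (('a, 'e) tpoint \<Rightarrow> (('a, 'e) tpoint, 'e \<times> 'e) chart \<Rightarrow> 'e \<times> 'e \<Rightarrow> real) \<Rightarrow> bool" where
  "semi_basic A \<alpha> \<longleftrightarrow> smooth_one_form (slit_atlas A) \<alpha> \<and>
     (\<forall>c\<in>slit_atlas A. \<forall>z\<in>chart_image c. \<forall>b. form_coords c \<alpha> z (0, b) = 0)"

text \<open>\<open>\<Phi> = R J - \<alpha> \<otimes> \<C>\<close>\<close>

definition isotropic_with ::
    "('a, real^'n::finite) chart set \<Rightarrow>
     (('a, real^'n) tpoint \<Rightarrow> (('a, real^'n) tpoint, (real^'n) \<times> (real^'n)) tvec) \<Rightarrow>
     (('a, real^'n) tpoint \<Rightarrow> (('a, real^'n) tpoint, (real^'n) \<times> (real^'n)) chart \<Rightarrow>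
        (real^'n) \<times> (real^'n) \<Rightarrow> real) \<Rightarrow> bool" where
  "isotropic_with A S \<alpha> \<longleftrightarrow>
     (\<forall>c\<in>slit_atlas A. \<forall>z\<in>chart_image c. \<forall>u.
        jacobi (vf_coords c S) z u =
          ricci_scalar (vf_coords c S) z *\<^sub>R tangent_J z u - form_coords c \<alpha> z u *\<^sub>R liouville z)"


section \<open>Finsler functions\<close>

text \<open>\<open>g\<^sub>i\<^sub>j = 1/2 \<partial>\<^sup>2F\<^sup>2/\<partial>y\<^sup>i\<partial>y\<^sup>j\<close>, for \<open>F\<close> in induced coordinates\<close>

definition metric_matrix ::
    "((real^'n::finite) \<times> (real^'n) \<Rightarrow> real) \<Rightarrow> (real^'n) \<times> (real^'n) \<Rightarrow> real^'n^'n" where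
  "metric_matrix F z = (\<chi> i j. (1/2) *
     frechet_derivative (\<lambda>w. frechet_derivative (\<lambda>w. (F w)\<^sup>2) (at w) (0, axis j 1)) (at z) (0, axis i 1))"

definition finsler_function ::
    "('a, real^'n::finite) chart set \<Rightarrow> (('a, real^'n) tpoint \<Rightarrow> real) \<Rightarrow> bool" where
  "finsler_function A F \<longleftrightarrow>
     continuous_map (manifold_topology (tangent_atlas A)) euclideanreal F \<and>
     smooth_fun (slit_atlas A) F \<and>
     (\<forall>q\<in>carrier_of (slit_atlas A). F q > 0) \<and>
     (\<forall>(p, v)\<in>carrier_of (tangent_atlas A). \<forall>r\<ge>0. F (p, \<lambda>c. r *\<^sub>R v c) = r * F (p, v)) \<and>
     (\<forall>c\<in>slit_atlas A. \<forall>z\<in>chart_image c. rank (metric_matrix (fun_coords c F) z) = CARD('n))"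

text \<open>\<open>i\<^sub>S dd\<^sub>J F\<^sup>2 = -dF\<^sup>2\<close>\<close>

definition metrizable_by ::
    "('a, real^'n::finite) chart set \<Rightarrow>
     (('a, real^'n) tpoint \<Rightarrow> (('a, real^'n) tpoint, (real^'n) \<times> (real^'n)) tvec) \<Rightarrow>
     (('a, real^'n) tpoint \<Rightarrow> real) \<Rightarrow> bool" where
  "metrizable_by A S F \<longleftrightarrow>
     (\<forall>c\<in>slit_atlas A. \<forall>z\<in>chart_image c. \<forall>u.
        ext_d1 (fn_d0 tangent_J (\<lambda>w. (fun_coords c F w)\<^sup>2)) z (vf_coords c S z) u =
          - ext_d0 (\<lambda>w. (fun_coords c F w)\<^sup>2) z u)"

text \<open>\<open>\<Phi> = \<kappa> (F\<^sup>2 J - F d\<^sub>J F \<otimes> \<C>)\<close>, where \<open>S\<close> is meant to be the geodesic spray of \<open>F\<close>\<close>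

definition constant_flag_curvature ::
    "('a, real^'n::finite) chart set \<Rightarrow>
     (('a, real^'n) tpoint \<Rightarrow> (('a, real^'n) tpoint, (real^'n) \<times> (real^'n)) tvec) \<Rightarrow>
     (('a, real^'n) tpoint \<Rightarrow> real) \<Rightarrow> real \<Rightarrow> bool" where
  "constant_flag_curvature A S F \<kappa> \<longleftrightarrow>
     (\<forall>c\<in>slit_atlas A. \<forall>z\<in>chart_image c. \<forall>u.
        jacobi (vf_coords c S) z u =
          \<kappa> *\<^sub>R ((fun_coords c F z)\<^sup>2 *\<^sub>R tangent_J z u
                 - (fun_coords c F z * fn_d0 tangent_J (fun_coords c F) z u) *\<^sub>R liouville z))"

end

theory Submission
  imports Defs
begin

text \<open>In induced coordinates a spray is \<open>S = (y, s)\<close> with \<open>s = - 2 G\<close> homogeneous of degree \<open>2\<close> in \<open>y\<close>, and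
\<open>\<Phi> (a, b) = (0, P a)\<close> where the linear map \<open>P = (R\<^sup>i\<^sub>j)\<close> is a differential expression in \<open>s\<close>. Euler's
identity gives \<open>P y = 0\<close>. In the plane \<open>tr P \<cdot> Id - P\<close> is the adjugate of \<open>P\<close>; as \<open>P\<close> kills
\<open>y \<noteq> 0\<close>, the image of the adjugate lies in the line of \<open>y\<close>, so that \<open>R a - P a = \<alpha>(a) y\<close>
(\<open>curv_map_isotropic\<close>). This is isotropy, and pairing with \<open>y\<close> recovers a smooth \<open>\<alpha>\<close>.

For the metrizability criterion, three local facts are combined.
First, the relation \<open>\<alpha>(S) = R\<close> holds because \<open>P y = 0\<close>. If \<open>d\<^sub>J \<alpha> = 0\<close>, differentiating this relation along
the fibre and using that \<open>\<alpha>\<close> is homogeneous of degree \<open>1\<close> gives \<open>d\<^sub>J R = 2 \<alpha>\<close>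
(\<open>closed_imp_ricci_potential\<close>), and then \<open>\<Phi> = R J - 1/2 d\<^sub>J R \<otimes> \<C>\<close> is the curvature formula for
\<open>F\<^sup>2 = \<kappa> R\<close> with \<open>\<kappa> = \<plusminus>1\<close>. Conversely the curvature formula forces \<open>R = \<kappa> F\<^sup>2\<close> and
\<open>\<alpha> = \<kappa> F d\<^sub>J F\<close>, hence \<open>d\<^sub>J \<alpha> = 0\<close>.
Second, for \<open>E\<close> homogeneous of degree \<open>2\<close> the equation \<open>i\<^sub>S dd\<^sub>J E = - dE\<close> is equivalent to \<open>d\<^sub>h E = 0\<close>:
each of the two implies \<open>S E = 0\<close>, and the fibre derivative of \<open>S E = 0\<close> converts one into the other
(\<open>horizontal_imp_euler_lagrange\<close>, \<open>euler_lagrange_imp_horizontal\<close>).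
Third, a vertical vector in the kernel of the fibre Hessian of \<open>R\<close> lies in the kernel of \<open>dd\<^sub>J R\<close>, so
rank \<open>4\<close> makes the metric of \<open>F\<close> nondegenerate (\<open>nondegenerate_metric\<close>).

To globalize, one needs that \<open>\<Phi>\<close> is natural under coordinate changes (\<open>jacobi_natural\<close>); isotropy
then makes \<open>R\<close> a function and \<open>\<alpha>\<close> a form on \<open>T\<^sub>0M\<close> (\<open>planar_invariance\<close>). Naturality follows by
differentiating the transformation law of \<open>S\<close>: the second derivatives of the coordinate change cancel
by their symmetry (\<open>mixed_derivatives_commute\<close>). The sign of \<open>R\<close> is constant since the fibres of \<open>T\<^sub>0M\<close>
and \<open>M\<close> are connected (\<open>constant_sign\<close>), which fixes \<open>\<kappa>\<close>, and \<open>F\<close> extends continuously by \<open>0\<close> to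
the zero section by homogeneity and compactness of the unit sphere
(\<open>continuous_homogeneous_extension\<close>).\<close>

section \<open>Smooth maps and symmetry of second derivatives\<close>

abbreviation fderiv :: "('z::euclidean_space \<Rightarrow> 'f::real_normed_vector) \<Rightarrow> 'z \<Rightarrow> 'z \<Rightarrow> 'f" ("\<D>") where
  "\<D> f z u \<equiv> frechet_derivative f (at z) u"

lemma fderiv_works: "f differentiable at z \<Longrightarrow> (f has_derivative \<D> f z) (at z)"
  by (simp add: frechet_derivative_works)

lemma fderiv_eqI: "(f has_derivative f') (at z) \<Longrightarrow> \<D> f z u = f' u"
  by (metis frechet_derivative_at)

lemma linear_fderiv: "f differentiable at z \<Longrightarrow> linear (\<D> f z)"
  using fderiv_works has_derivative_linear by blast

lemma fderiv_cong:
  assumes "open D" "z \<in> D" "\<And>w. w \<in> D \<Longrightarrow> f w = g w"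
  shows "\<D> f z u = \<D> g z u"
proof -
  have "(f has_derivative f') (at z) \<longleftrightarrow> (g has_derivative f') (at z)" for f'
    using has_derivative_transform_within_open[OF _ assms(1,2), of f f' UNIV g]
      has_derivative_transform_within_open[OF _ assms(1,2), of g f' UNIV f] assms(3) by auto
  then show ?thesis by (simp add: frechet_derivative_def)
qed

lemma differentiable_cong_open:
  assumes "open D" "z \<in> D" "\<And>w. w \<in> D \<Longrightarrow> f w = g w" "f differentiable at z"
  shows "g differentiable at z"
  using assms(4) has_derivative_transform_within_open[OF _ assms(1,2), of f _ UNIV g] assms(3)
  unfolding differentiable_def by metis

text \<open>Openness of the domain matters: the derivatives that define \<open>Ck_on\<close> are taken in the whole space, so
they are determined by the values on \<open>D\<close> only when \<open>D\<close> is a neighbourhood of each of its points.\<close>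

lemma Ck_on_cong:
  assumes "open D" "\<And>w. w \<in> D \<Longrightarrow> f w = g w" "Ck_on k D f"
  shows "Ck_on k D g"
  using assms(2,3)
proof (induction k arbitrary: f g)
  case 0
  then show ?case using continuous_on_cong[of D D f g] by simp
next
  case (Suc k)
  show ?case
    unfolding Ck_on.simps
  proof (intro conjI ballI allI)
    show "g differentiable at x" if "x \<in> D" for x
      using differentiable_cong_open[OF assms(1) that Suc.prems(1)] Suc.prems(2) that by simp
    show "Ck_on k D (\<lambda>x. \<D> g x v)" for v
    proof (rule Suc.IH)
      show "\<D> f w v = \<D> g w v" if "w \<in> D" for w
        by (rule fderiv_cong[OF assms(1) that Suc.prems(1)])
      show "Ck_on k D (\<lambda>x. \<D> f x v)" using Suc.prems(2) by simp
    qed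
  qed
qed

lemma Ck_on_Suc_imp: "Ck_on (Suc k) D f \<Longrightarrow> Ck_on k D f"
proof (induction k arbitrary: f)
  case 0
  then have "f differentiable_on D"
    unfolding differentiable_on_def by (simp add: differentiable_at_withinI)
  then show ?case by (simp add: differentiable_imp_continuous_on)
next
  case (Suc k)
  have "Ck_on k D (\<lambda>x. \<D> f x v)" for v
    using Suc.prems Suc.IH[of "\<lambda>x. \<D> f x v"] unfolding Ck_on.simps(2)[of "Suc k"] by blast
  then show ?case using Suc.prems by simp
qed

lemma smooth_on_cong:
  assumes "open D" "\<And>w. w \<in> D \<Longrightarrow> f w = g w"
  shows "smooth_on D f \<longleftrightarrow> smooth_on D g"
proof
  show "smooth_on D g" if "smooth_on D f"
    unfolding smooth_on_def
  proof
    show "Ck_on k D g" for k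
      by (rule Ck_on_cong[OF assms]) (use that in \<open>auto simp: smooth_on_def\<close>)
  qed
  show "smooth_on D f" if "smooth_on D g"
    unfolding smooth_on_def
  proof
    show "Ck_on k D f" for k
      by (rule Ck_on_cong[OF assms(1) assms(2)[symmetric]]) (use that in \<open>auto simp: smooth_on_def\<close>)
  qed
qed

lemma smooth_on_differentiable: "smooth_on D f \<Longrightarrow> z \<in> D \<Longrightarrow> f differentiable at z"
  unfolding smooth_on_def by (drule spec[of _ "Suc 0"]) simp

lemma smooth_on_fderiv:
  assumes "smooth_on D f" shows "smooth_on D (\<lambda>w. \<D> f w v)"
  unfolding smooth_on_def
proof
  fix k show "Ck_on k D (\<lambda>w. \<D> f w v)"
    using assms[unfolded smooth_on_def, rule_format, of "Suc k"] by simp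
qed

lemma smooth_on_continuous: "smooth_on D f \<Longrightarrow> continuous_on D f"
  unfolding smooth_on_def by (drule spec[of _ 0]) simp

lemma Ck_on_subset: "Ck_on k D f \<Longrightarrow> D' \<subseteq> D \<Longrightarrow> Ck_on k D' f"
proof (induction k arbitrary: f)
  case 0
  then show ?case using continuous_on_subset by auto
next
  case (Suc k)
  then show ?case by (auto)
qed

lemma smooth_on_subset: "smooth_on D f \<Longrightarrow> D' \<subseteq> D \<Longrightarrow> smooth_on D' f"
  unfolding smooth_on_def using Ck_on_subset[of _ D f D'] by simp

lemma Ck_on_const: "Ck_on k D (\<lambda>_. c)"
  by (induction k arbitrary: c) auto

lemma smooth_on_const: "smooth_on D (\<lambda>_. c)"
  by (simp add: smooth_on_def Ck_on_const)

lemma Ck_on_bounded_linear: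
  assumes "open D" "bounded_linear L" "Ck_on k D f"
  shows "Ck_on k D (\<lambda>x. L (f x))"
  using assms(3)
proof (induction k arbitrary: f)
  case 0
  then show ?case using bounded_linear.continuous_on[OF assms(2)] by simp
next
  case (Suc k)
  have d: "((\<lambda>x. L (f x)) has_derivative (\<lambda>u. L (\<D> f x u))) (at x)" if "x \<in> D" for x
    using Suc.prems that by (intro bounded_linear.has_derivative[OF assms(2)] fderiv_works) simp
  have "Ck_on k D (\<lambda>x. \<D> (\<lambda>x. L (f x)) x v)" for v
    by (rule Ck_on_cong[OF assms(1) _ Suc.IH[of "\<lambda>x. \<D> f x v"]])
      (simp_all add: fderiv_eqI[OF d] Suc.prems[unfolded Ck_on.simps])
  then show ?case using d by (auto simp: differentiable_def)
qed

lemma smooth_on_bounded_linear: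
  "open D \<Longrightarrow> bounded_linear L \<Longrightarrow> smooth_on D f \<Longrightarrow> smooth_on D (\<lambda>x. L (f x))"
  by (simp add: smooth_on_def Ck_on_bounded_linear)

lemma Ck_on_add:
  assumes "open D" "Ck_on k D f" "Ck_on k D g"
  shows "Ck_on k D (\<lambda>x. f x + g x)"
  using assms(2,3)
proof (induction k arbitrary: f g)
  case 0
  then show ?case by (auto intro: continuous_on_add)
next
  case (Suc k)
  have d: "((\<lambda>x. f x + g x) has_derivative (\<lambda>u. \<D> f x u + \<D> g x u)) (at x)" if "x \<in> D" for x
    using Suc.prems that by (auto intro!: has_derivative_add fderiv_works)
  have "Ck_on k D (\<lambda>x. \<D> (\<lambda>x. f x + g x) x v)" for v
    by (rule Ck_on_cong[OF assms(1) _ Suc.IH[of "\<lambda>x. \<D> f x v" "\<lambda>x. \<D> g x v"]])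
      (simp_all add: fderiv_eqI[OF d] Suc.prems[unfolded Ck_on.simps])
  then show ?case using d by (auto simp: differentiable_def)
qed

lemma smooth_on_add:
  "open D \<Longrightarrow> smooth_on D f \<Longrightarrow> smooth_on D g \<Longrightarrow> smooth_on D (\<lambda>x. f x + g x)"
  by (simp add: smooth_on_def Ck_on_add)

lemma smooth_on_diff:
  assumes "open D" "smooth_on D f" "smooth_on D g"
  shows "smooth_on D (\<lambda>x. f x - g x)"
  using smooth_on_add[OF assms(1,2), of "\<lambda>x. - g x"]
    smooth_on_bounded_linear[OF assms(1) bounded_linear_minus[OF bounded_linear_ident] assms(3)]
  by simp

lemma smooth_on_sum:
  assumes "open D" "\<And>i. i \<in> I \<Longrightarrow> smooth_on D (f i)"
  shows "smooth_on D (\<lambda>x. \<Sum>i\<in>I. f i x)"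
  using assms(2) by (induction I rule: infinite_finite_induct) (auto intro: smooth_on_const smooth_on_add assms(1))

lemma Ck_on_bilinear:
  assumes "open D" "bounded_bilinear pr" "Ck_on k D f" "Ck_on k D g"
  shows "Ck_on k D (\<lambda>x. pr (f x) (g x))"
  using assms(3,4)
proof (induction k arbitrary: f g)
  case 0
  then show ?case using bounded_bilinear.continuous_on[OF assms(2)] by simp
next
  case (Suc k)
  have d: "((\<lambda>x. pr (f x) (g x)) has_derivative (\<lambda>u. pr (f x) (\<D> g x u) + pr (\<D> f x u) (g x))) (at x)"
    if "x \<in> D" for x
    using Suc.prems that by (auto intro!: bounded_bilinear.FDERIV[OF assms(2)] fderiv_works)
  have fg: "Ck_on k D f" "Ck_on k D g" using Suc.prems Ck_on_Suc_imp by blast+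
  have "Ck_on k D (\<lambda>x. \<D> (\<lambda>x. pr (f x) (g x)) x v)" for v
    by (rule Ck_on_cong[OF assms(1) _ Ck_on_add[OF assms(1)
            Suc.IH[of f "\<lambda>x. \<D> g x v"] Suc.IH[of "\<lambda>x. \<D> f x v" g]]])
      (simp_all add: fderiv_eqI[OF d] fg Suc.prems[unfolded Ck_on.simps])
  then show ?case using d by (auto simp: differentiable_def)
qed

lemma smooth_on_bilinear:
  "open D \<Longrightarrow> bounded_bilinear pr \<Longrightarrow> smooth_on D f \<Longrightarrow> smooth_on D g \<Longrightarrow>
     smooth_on D (\<lambda>x. pr (f x) (g x))"
  by (simp add: smooth_on_def Ck_on_bilinear)

lemmas smooth_on_mult = smooth_on_bilinear[OF _ bounded_bilinear_mult]
lemmas smooth_on_scaleR = smooth_on_bilinear[OF _ bounded_bilinear_scaleR]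
lemmas smooth_on_inner = smooth_on_bilinear[OF _ bounded_bilinear_inner]

lemma Ck_on_powr:
  fixes f :: "'e::euclidean_space \<Rightarrow> real"
  assumes "open D" "Ck_on k D f" "\<And>x. x \<in> D \<Longrightarrow> f x > 0"
  shows "Ck_on k D (\<lambda>x. f x powr a)"
  using assms(2)
proof (induction k arbitrary: a)
  case 0
  then have "continuous_on D f" by simp
  then have "continuous_on D (\<lambda>x. f x powr a)"
    by (rule continuous_on_powr[OF _ continuous_on_const]) (use assms(3) in force)
  then show ?case by simp
next
  case (Suc k)
  have d: "((\<lambda>x. f x powr a) has_derivative (\<lambda>u. (a * f x powr (a - 1)) * \<D> f x u)) (at x)"
    if "x \<in> D" for x
  proof -
    have p: "((\<lambda>t. t powr a) has_derivative (\<lambda>u. (a * f x powr (a - 1)) * u)) (at (f x))"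
      using has_real_derivative_powr[OF assms(3)[OF that], of a] unfolding has_field_derivative_def .
    have "f differentiable at x" using Suc.prems that by auto
    from has_derivative_compose[OF fderiv_works[OF this] p] show ?thesis by simp
  qed
  have f: "Ck_on k D f" using Suc.prems Ck_on_Suc_imp by blast
  have "Ck_on k D (\<lambda>x. \<D> (\<lambda>x. f x powr a) x v)" for v
  proof (rule Ck_on_cong[OF assms(1)])
    show "Ck_on k D (\<lambda>x. (a * f x powr (a - 1)) * \<D> f x v)"
      using Suc.prems
      by (intro Ck_on_bilinear[OF assms(1) bounded_bilinear_mult] Suc.IH[OF f] Ck_on_const) simp
  qed (simp add: fderiv_eqI[OF d])
  then show ?case using d by (auto simp: differentiable_def)
qed

text \<open>Real powers provide both the inverse (exponent \<open>- 1\<close>) and the square root (exponent \<open>1/2\<close>) of a positive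
function; exponents stay general because each derivative lowers them by \<open>1\<close>.\<close>

lemma smooth_on_powr:
  fixes f :: "'e::euclidean_space \<Rightarrow> real"
  shows "open D \<Longrightarrow> smooth_on D f \<Longrightarrow> (\<And>x. x \<in> D \<Longrightarrow> f x > 0) \<Longrightarrow> smooth_on D (\<lambda>x. f x powr a)"
  by (simp add: smooth_on_def Ck_on_powr)

lemma Ck_on_linear_precompose:
  fixes L :: "'e::euclidean_space \<Rightarrow> 'd::euclidean_space"
  assumes L: "bounded_linear L" and "open D" "Ck_on k D f"
  shows "Ck_on k (L -` D) (\<lambda>x. f (L x))"
  using assms(3)
proof (induction k arbitrary: f)
  case 0
  have "continuous_on (L -` D) L" by (rule linear_continuous_on[OF L])
  then show ?case using 0 continuous_on_compose2[of D f "L -` D" L] by auto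
next
  case (Suc k)
  have d: "((\<lambda>x. f (L x)) has_derivative (\<lambda>u. \<D> f (L x) (L u))) (at x)" if "L x \<in> D" for x
    by (rule has_derivative_compose[OF bounded_linear_imp_has_derivative[OF L] fderiv_works])
      (use Suc.prems that in simp)
  have o: "open (L -` D)"
    using \<open>open D\<close> L by (intro open_vimage linear_continuous_on)
  have "Ck_on k (L -` D) (\<lambda>x. \<D> (\<lambda>x. f (L x)) x v)" for v
    by (rule Ck_on_cong[OF o _ Suc.IH[of "\<lambda>x. \<D> f x (L v)"]])
      (simp_all add: fderiv_eqI[OF d] Suc.prems[unfolded Ck_on.simps])
  then show ?case using d by (auto simp: differentiable_def)
qed

lemma smooth_on_linear_precompose:
  fixes L :: "'e::euclidean_space \<Rightarrow> 'd::euclidean_space"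
  shows "bounded_linear L \<Longrightarrow> open D \<Longrightarrow> smooth_on D f \<Longrightarrow> smooth_on (L -` D) (\<lambda>x. f (L x))"
  by (simp add: smooth_on_def Ck_on_linear_precompose)

lemma Ck_on_id: "Ck_on k D (\<lambda>x::'e::euclidean_space. x)"
  by (cases k) (auto intro: Ck_on_const)

lemma smooth_on_id: "smooth_on D (\<lambda>x::'e::euclidean_space. x)"
  by (simp add: smooth_on_def Ck_on_id)

lemma smooth_on_Pair:
  assumes "open D" "smooth_on D f" "smooth_on D g"
  shows "smooth_on D (\<lambda>x. (f x, g x))"
proof -
  have "bounded_linear (\<lambda>a::'b. (a, 0::'c))" "bounded_linear (\<lambda>b::'c. (0::'b, b))"
    by (auto intro!: bounded_linear_Pair bounded_linear_ident bounded_linear_zero)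
  note smooth_on_add[OF assms(1) smooth_on_bounded_linear[OF assms(1) this(1) assms(2)]
      smooth_on_bounded_linear[OF assms(1) this(2) assms(3)]]
  then show ?thesis by simp
qed

text \<open>Only constant directions are differentiated in \<open>smooth_on\<close>; a varying direction is
  expanded in the standard basis.\<close>

lemma fderiv_basis:
  assumes "f differentiable at z"
  shows "\<D> f z v = (\<Sum>b\<in>Basis. (v \<bullet> b) *\<^sub>R \<D> f z b)"
proof -
  have "\<D> f z v = \<D> f z (\<Sum>b\<in>Basis. (v \<bullet> b) *\<^sub>R b)" by (simp add: euclidean_representation)
  also have "\<dots> = (\<Sum>b\<in>Basis. (v \<bullet> b) *\<^sub>R \<D> f z b)"
    using linear_fderiv[OF assms] by (simp add: linear_sum linear_scale)
  finally show ?thesis .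
qed

lemma smooth_on_fderiv_field:
  assumes "open D" "smooth_on D f" "smooth_on D X"
  shows "smooth_on D (\<lambda>w. \<D> f w (X w))"
proof -
  have "smooth_on D (\<lambda>w. \<Sum>b\<in>Basis. (X w \<bullet> b) *\<^sub>R \<D> f w b)"
    using assms by (intro smooth_on_sum smooth_on_scaleR smooth_on_inner smooth_on_const smooth_on_fderiv)
  moreover have "(\<Sum>b\<in>Basis. (X w \<bullet> b) *\<^sub>R \<D> f w b) = \<D> f w (X w)" if "w \<in> D" for w
    using fderiv_basis[OF smooth_on_differentiable[OF assms(2) that], of "X w"] by simp
  ultimately show ?thesis
    by (rule iffD1[OF smooth_on_cong[OF assms(1)], rotated])
qed

text \<open>The product rule for \<open>w \<mapsto> K w (X w)\<close> when \<open>K w\<close> is linear. It needs differentiability of \<open>K\<close> only along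
fixed vectors, because \<open>X w\<close> can be expanded in the standard basis. Every derivative of a tensor
evaluated on a varying field is computed with it below.\<close>

lemma has_derivative_linear_family:
  fixes K :: "'z::euclidean_space \<Rightarrow> 'e::euclidean_space \<Rightarrow> 'f::real_normed_vector"
  assumes "open D" "z \<in> D" "\<And>w. w \<in> D \<Longrightarrow> linear (K w)"
    and K: "\<And>v. (\<lambda>w. K w v) differentiable at z" and X: "X differentiable at z"
  shows "((\<lambda>w. K w (X w)) has_derivative (\<lambda>u. \<D> (\<lambda>w. K w (X z)) z u + K z (\<D> X z u))) (at z)"
proof -
  have exp: "K w v = (\<Sum>b\<in>Basis. (v \<bullet> b) *\<^sub>R K w b)" if "w \<in> D" for w v
  proof -
    have "K w v = K w (\<Sum>b\<in>Basis. (v \<bullet> b) *\<^sub>R b)" by (simp add: euclidean_representation)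
    then show ?thesis using assms(3)[OF that] by (simp add: linear_sum linear_scale)
  qed
  have "((\<lambda>w. \<Sum>b\<in>Basis. (X w \<bullet> b) *\<^sub>R K w b) has_derivative
      (\<lambda>u. \<Sum>b\<in>Basis. (X z \<bullet> b) *\<^sub>R \<D> (\<lambda>w. K w b) z u + (\<D> X z u \<bullet> b) *\<^sub>R K z b)) (at z)"
    by (intro has_derivative_sum has_derivative_scaleR has_derivative_inner_left fderiv_works K X)
  moreover have "\<D> (\<lambda>w. K w (X z)) z u = (\<Sum>b\<in>Basis. (X z \<bullet> b) *\<^sub>R \<D> (\<lambda>w. K w b) z u)" for u
  proof -
    have "((\<lambda>w. \<Sum>b\<in>Basis. (X z \<bullet> b) *\<^sub>R K w b) has_derivative
        (\<lambda>u. \<Sum>b\<in>Basis. (X z \<bullet> b) *\<^sub>R \<D> (\<lambda>w. K w b) z u)) (at z)"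
      by (intro has_derivative_sum has_derivative_scaleR_right fderiv_works K)
    then have "((\<lambda>w. K w (X z)) has_derivative
        (\<lambda>u. \<Sum>b\<in>Basis. (X z \<bullet> b) *\<^sub>R \<D> (\<lambda>w. K w b) z u)) (at z)"
      by (rule has_derivative_transform_within_open[OF _ assms(1,2)]) (rule exp[symmetric])
    then show ?thesis by (rule fderiv_eqI)
  qed
  ultimately have "((\<lambda>w. \<Sum>b\<in>Basis. (X w \<bullet> b) *\<^sub>R K w b) has_derivative
      (\<lambda>u. \<D> (\<lambda>w. K w (X z)) z u + K z (\<D> X z u))) (at z)"
    by (simp add: exp[OF assms(2), of "\<D> X z _"] sum.distrib)
  then show ?thesis
    by (rule has_derivative_transform_within_open[OF _ assms(1,2)]) (rule exp[symmetric])
qed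

lemma has_derivative_fderiv_field:
  assumes "open D" "z \<in> D" "smooth_on D f" "X differentiable at z"
  shows "((\<lambda>w. \<D> f w (X w)) has_derivative
      (\<lambda>u. \<D> (\<lambda>w. \<D> f w (X z)) z u + \<D> f z (\<D> X z u))) (at z)"
  by (rule has_derivative_linear_family[OF assms(1,2)])
    (simp_all add: assms(4) linear_fderiv smooth_on_differentiable[OF assms(3)]
      smooth_on_differentiable[OF smooth_on_fderiv[OF assms(3)] assms(2)])

lemma has_real_derivative_along_line:
  fixes f :: "'e::euclidean_space \<Rightarrow> real"
  assumes "f differentiable at (p + t *\<^sub>R u)"
  shows "((\<lambda>s. f (p + s *\<^sub>R u)) has_real_derivative \<D> f (p + t *\<^sub>R u) u) (at t)"
proof -
  have "((\<lambda>s. p + s *\<^sub>R u) has_derivative (\<lambda>s. s *\<^sub>R u)) (at t)"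
    by (auto intro!: derivative_eq_intros)
  from has_derivative_compose[OF this fderiv_works[OF assms]]
  have "((\<lambda>s. f (p + s *\<^sub>R u)) has_derivative (\<lambda>s. \<D> f (p + t *\<^sub>R u) (s *\<^sub>R u))) (at t)" .
  then show ?thesis
    by (rule has_derivative_imp_has_field_derivative)
      (simp add: linear_scale[OF linear_fderiv[OF assms]])
qed

text \<open>Two applications of the mean value theorem to the second difference, the first in direction \<open>u\<close>, the
second in direction \<open>v\<close>. The left-hand side is symmetric in \<open>u\<close> and \<open>v\<close>, which is what makes the mixed
derivatives agree in the limit.\<close>

lemma second_difference_mvt:
  fixes f :: "'e::euclidean_space \<Rightarrow> real"
  assumes t: "0 < t" "t * (norm u + norm v) < r"
    and f: "\<And>x. x \<in> ball z r \<Longrightarrow> f differentiable at x"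
    and fu: "\<And>x. x \<in> ball z r \<Longrightarrow> (\<lambda>w. \<D> f w u) differentiable at x"
  shows "\<exists>p\<in>ball z r. f (z + t *\<^sub>R u + t *\<^sub>R v) - f (z + t *\<^sub>R u) - f (z + t *\<^sub>R v) + f z
           = t\<^sup>2 * \<D> (\<lambda>w. \<D> f w u) p v"
proof -
  have in_ball: "z + a *\<^sub>R u + b *\<^sub>R v \<in> ball z r" if "0 \<le> a" "a \<le> t" "0 \<le> b" "b \<le> t" for a b
  proof -
    have "norm (a *\<^sub>R u + b *\<^sub>R v) \<le> a * norm u + b * norm v"
      using norm_triangle_ineq[of "a *\<^sub>R u" "b *\<^sub>R v"] that by simp
    also have "\<dots> \<le> t * (norm u + norm v)"
      using that by (simp add: distrib_left add_mono mult_right_mono)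
    finally have "norm (a *\<^sub>R u + b *\<^sub>R v) < r" using t by simp
    moreover have "dist z (z + a *\<^sub>R u + b *\<^sub>R v) = norm (a *\<^sub>R u + b *\<^sub>R v)"
      by (metis add.assoc add_diff_cancel_left' dist_commute dist_norm)
    ultimately show ?thesis by simp
  qed
  define g where "g s = f ((z + t *\<^sub>R v) + s *\<^sub>R u) - f (z + s *\<^sub>R u)" for s
  have "\<exists>\<xi>>0. \<xi> < t \<and> g t - g 0 = (t - 0) * (\<D> f ((z + t *\<^sub>R v) + \<xi> *\<^sub>R u) u - \<D> f (z + \<xi> *\<^sub>R u) u)"
  proof (rule MVT2[OF t(1)])
    fix s assume s: "0 \<le> s" "s \<le> t"
    show "(g has_real_derivative \<D> f ((z + t *\<^sub>R v) + s *\<^sub>R u) u - \<D> f (z + s *\<^sub>R u) u) (at s)"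
      unfolding g_def using in_ball[of s t] in_ball[of s 0] s t(1)
      by (intro DERIV_diff has_real_derivative_along_line f) (auto simp: algebra_simps)
  qed
  then obtain \<xi> where xi: "0 < \<xi>" "\<xi> < t"
    and g: "g t - g 0 = t * (\<D> f ((z + t *\<^sub>R v) + \<xi> *\<^sub>R u) u - \<D> f (z + \<xi> *\<^sub>R u) u)" by auto
  have "\<exists>\<eta>>0. \<eta> < t \<and> \<D> f ((z + \<xi> *\<^sub>R u) + t *\<^sub>R v) u - \<D> f ((z + \<xi> *\<^sub>R u) + 0 *\<^sub>R v) u
      = (t - 0) * \<D> (\<lambda>w. \<D> f w u) ((z + \<xi> *\<^sub>R u) + \<eta> *\<^sub>R v) v"
  proof (rule MVT2[OF t(1)])
    fix s assume s: "0 \<le> s" "s \<le> t"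
    show "((\<lambda>s. \<D> f ((z + \<xi> *\<^sub>R u) + s *\<^sub>R v) u) has_real_derivative
        \<D> (\<lambda>w. \<D> f w u) ((z + \<xi> *\<^sub>R u) + s *\<^sub>R v) v) (at s)"
      using has_real_derivative_along_line[OF fu] in_ball[of \<xi> s] s xi by simp
  qed
  then obtain \<eta> where eta: "0 < \<eta>" "\<eta> < t"
    and h: "\<D> f ((z + \<xi> *\<^sub>R u) + t *\<^sub>R v) u - \<D> f (z + \<xi> *\<^sub>R u) u
      = t * \<D> (\<lambda>w. \<D> f w u) ((z + \<xi> *\<^sub>R u) + \<eta> *\<^sub>R v) v" by auto
  have "g t - g 0 = t\<^sup>2 * \<D> (\<lambda>w. \<D> f w u) (z + \<xi> *\<^sub>R u + \<eta> *\<^sub>R v) v"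
    using g h by (simp add: power2_eq_square algebra_simps)
  moreover have "g t - g 0 = f (z + t *\<^sub>R u + t *\<^sub>R v) - f (z + t *\<^sub>R u) - f (z + t *\<^sub>R v) + f z"
    by (simp add: g_def algebra_simps)
  ultimately show ?thesis using in_ball[of \<xi> \<eta>] xi eta by fastforce
qed

text \<open>If the two mixed derivatives differed at \<open>z\<close>, then by continuity they would take separated values on
a ball around \<open>z\<close>, while the symmetric second difference equates a value of one with a value of the
other on that ball.\<close>

lemma mixed_derivatives_commute_real:
  fixes f :: "'e::euclidean_space \<Rightarrow> real"
  assumes "open D" "z \<in> D" "smooth_on D f"
  shows "\<D> (\<lambda>w. \<D> f w u) z v = \<D> (\<lambda>w. \<D> f w v) z u"
proof (rule ccontr)
  let ?A = "\<lambda>p. \<D> (\<lambda>w. \<D> f w u) p v" and ?B = "\<lambda>p. \<D> (\<lambda>w. \<D> f w v) p u"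
  assume ne: "?A z \<noteq> ?B z"
  define e where "e = \<bar>?A z - ?B z\<bar> / 2"
  have e: "e > 0" using ne by (simp add: e_def)
  have "continuous_on D ?A" "continuous_on D ?B"
    by (intro smooth_on_continuous smooth_on_fderiv assms(3))+
  then have "isCont ?A z" "isCont ?B z"
    using assms(2) continuous_on_eq_continuous_at[OF assms(1)] by auto
  then have cont: "\<exists>r>0. \<forall>p. dist p z < r \<longrightarrow> dist (?A p) (?A z) < e"
    "\<exists>r>0. \<forall>p. dist p z < r \<longrightarrow> dist (?B p) (?B z) < e"
    using e unfolding continuous_at_eps_delta by simp_all
  obtain r1 where r1: "r1 > 0" "\<And>p. dist p z < r1 \<Longrightarrow> dist (?A p) (?A z) < e"
    using cont(1) by auto
  obtain r2 where r2: "r2 > 0" "\<And>p. dist p z < r2 \<Longrightarrow> dist (?B p) (?B z) < e"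
    using cont(2) by auto
  obtain r3 where r3: "r3 > 0" "ball z r3 \<subseteq> D" using assms open_contains_ball by blast
  define r where "r = Min {r1, r2, r3}"
  have rr: "r > 0" "r \<le> r1" "r \<le> r2" "ball z r \<subseteq> D" using r1 r2 r3 by (auto simp: r_def)
  \<comment> \<open>the summand \<open>1\<close> keeps the denominator positive when \<open>u = v = 0\<close>\<close>
  define t where "t = r / (2 * (norm u + norm v + 1))"
  have np: "norm u + norm v + 1 > 0" by (simp add: add_nonneg_pos)
  have t: "t > 0" using rr np by (simp add: t_def)
  have "t * (norm u + norm v) \<le> t * (norm u + norm v + 1)" using t by simp
  also have "\<dots> = r / 2"
  proof -
    have "r / (2 * m) * m = r / 2" if "m > 0" for m :: real using that by (simp add: field_simps)
    from this[OF np] show ?thesis by (simp only: t_def)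
  qed
  also have "\<dots> < r" using rr by simp
  finally have tr: "t * (norm u + norm v) < r" "t * (norm v + norm u) < r" by (simp_all add: add.commute)
  have sm: "\<And>x. x \<in> ball z r \<Longrightarrow> f differentiable at x"
    "\<And>x w'. x \<in> ball z r \<Longrightarrow> (\<lambda>w. \<D> f w w') differentiable at x"
    using smooth_on_differentiable[OF assms(3)] smooth_on_differentiable[OF smooth_on_fderiv[OF assms(3)]]
      rr(4) by auto
  have "\<exists>p\<in>ball z r. f (z + t *\<^sub>R u + t *\<^sub>R v) - f (z + t *\<^sub>R u) - f (z + t *\<^sub>R v) + f z = t\<^sup>2 * ?A p"
    by (rule second_difference_mvt[OF t tr(1) sm(1) sm(2)])
  then obtain p where p: "p \<in> ball z r"
    "f (z + t *\<^sub>R u + t *\<^sub>R v) - f (z + t *\<^sub>R u) - f (z + t *\<^sub>R v) + f z = t\<^sup>2 * ?A p" by blast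
  have "\<exists>q\<in>ball z r. f (z + t *\<^sub>R v + t *\<^sub>R u) - f (z + t *\<^sub>R v) - f (z + t *\<^sub>R u) + f z = t\<^sup>2 * ?B q"
    by (rule second_difference_mvt[OF t tr(2) sm(1) sm(2)])
  then obtain q where q: "q \<in> ball z r"
    "f (z + t *\<^sub>R v + t *\<^sub>R u) - f (z + t *\<^sub>R v) - f (z + t *\<^sub>R u) + f z = t\<^sup>2 * ?B q" by blast
  have "t\<^sup>2 * ?A p = t\<^sup>2 * ?B q" using p(2) q(2) by (simp add: algebra_simps)
  then have "?A p = ?B q" using t by simp
  moreover have "dist (?A p) (?A z) < e" "dist (?B q) (?B z) < e"
    using r1(2)[of p] r2(2)[of q] p(1) q(1) rr by (simp_all add: dist_commute)
  ultimately show False unfolding e_def dist_real_def by (smt (verit) field_sum_of_halves)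
qed

lemma fderiv_inner_left:
  "f differentiable at z \<Longrightarrow> \<D> (\<lambda>w. f w \<bullet> b) z u = \<D> f z u \<bullet> b"
  by (rule fderiv_eqI) (intro has_derivative_inner_left fderiv_works)

lemma mixed_derivatives_commute:
  fixes f :: "'e::euclidean_space \<Rightarrow> 'f::euclidean_space"
  assumes "open D" "z \<in> D" "smooth_on D f"
  shows "\<D> (\<lambda>w. \<D> f w u) z v = \<D> (\<lambda>w. \<D> f w v) z u"
proof (rule euclidean_eqI)
  fix b :: 'f assume "b \<in> Basis"
  have sm: "smooth_on D (\<lambda>w. f w \<bullet> b)"
    using assms by (intro smooth_on_inner smooth_on_const)
  have 1: "\<D> (\<lambda>w. \<D> (\<lambda>w. f w \<bullet> b) w u) z v = \<D> (\<lambda>w. \<D> f w u) z v \<bullet> b" for u v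
  proof -
    have "\<D> (\<lambda>w. \<D> (\<lambda>w. f w \<bullet> b) w u) z v = \<D> (\<lambda>w. \<D> f w u \<bullet> b) z v"
      by (rule fderiv_cong[OF assms(1,2)])
        (rule fderiv_inner_left[OF smooth_on_differentiable[OF assms(3)]])
    also have "\<dots> = \<D> (\<lambda>w. \<D> f w u) z v \<bullet> b"
      by (rule fderiv_inner_left[OF smooth_on_differentiable[OF smooth_on_fderiv[OF assms(3)] assms(2)]])
    finally show ?thesis .
  qed
  show "\<D> (\<lambda>w. \<D> f w u) z v \<bullet> b = \<D> (\<lambda>w. \<D> f w v) z u \<bullet> b"
    using mixed_derivatives_commute_real[OF assms(1,2) sm, of u v] by (simp add: 1)
qed

section \<open>Functions homogeneous in the fibre\<close>

text \<open>Homogeneity of degree \<open>k\<close> in \<open>y\<close> in Euler's infinitesimal form. This form is local, so it makes sense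
on domains that are not cones and is stable under differentiation.\<close>

definition homogeneous_on :: "('e::euclidean_space \<times> 'e) set \<Rightarrow> real \<Rightarrow> ('e \<times> 'e \<Rightarrow> 'f::real_normed_vector) \<Rightarrow> bool" where
  "homogeneous_on D k f \<longleftrightarrow> (\<forall>z\<in>D. \<D> f z (0, snd z) = k *\<^sub>R f z)"

text \<open>Euler's identity says that \<open>f (x, t y) / t\<^sup>k\<close> has derivative zero on \<open>t > 0\<close>.\<close>

lemma homogeneous_imp_scaling:
  fixes f :: "'e::euclidean_space \<times> 'e \<Rightarrow> real"
  assumes hom: "homogeneous_on D (real k) f" and diff: "\<And>z. z \<in> D \<Longrightarrow> f differentiable at z"
    and cone: "\<And>r. r > 0 \<Longrightarrow> (x, r *\<^sub>R y) \<in> D" and r: "r > 0"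
  shows "f (x, r *\<^sub>R y) = r ^ k * f (x, y)"
proof -
  define g where "g t = f (x, t *\<^sub>R y) / t ^ k" for t
  have d: "(g has_real_derivative 0) (at t within {0<..})" if "t > 0" for t
  proof -
    have z: "(x, t *\<^sub>R y) \<in> D" using cone[OF that] .
    have sc: "t * \<D> f (x, t *\<^sub>R y) (0, y) = real k * f (x, t *\<^sub>R y)"
      using hom z linear_scale[OF linear_fderiv[OF diff[OF z]], of t "(0, y)"]
      by (auto simp: homogeneous_on_def)
    have "((\<lambda>s. f ((x, 0) + s *\<^sub>R (0, y))) has_real_derivative \<D> f ((x, 0) + t *\<^sub>R (0, y)) (0, y)) (at t)"
      by (rule has_real_derivative_along_line) (use diff[OF z] in simp)
    then have f: "((\<lambda>s. f (x, s *\<^sub>R y)) has_real_derivative \<D> f (x, t *\<^sub>R y) (0, y)) (at t)" by simp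
    have "(g has_real_derivative
        (\<D> f (x, t *\<^sub>R y) (0, y) * t ^ k - f (x, t *\<^sub>R y) * (real k * t ^ (k - 1))) / (t ^ k * t ^ k)) (at t)"
      unfolding g_def using that by (auto intro!: derivative_eq_intros f)
    moreover have "\<D> f (x, t *\<^sub>R y) (0, y) * t ^ k = f (x, t *\<^sub>R y) * (real k * t ^ (k - 1))"
    proof (cases k)
      case 0
      then show ?thesis using sc that by simp
    next
      case (Suc m)
      then have "\<D> f (x, t *\<^sub>R y) (0, y) * t ^ k = (t * \<D> f (x, t *\<^sub>R y) (0, y)) * t ^ (k - 1)" by simp
      then show ?thesis unfolding sc by simp
    qed
    ultimately show ?thesis using has_field_derivative_at_within by force
  qed
  then obtain c where "\<And>t. t > 0 \<Longrightarrow> g t = c"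
    using has_field_derivative_zero_constant[of "{0<..}" g] by force
  then have "g r = g 1" using r by simp
  then show ?thesis using r by (simp add: g_def field_simps)
qed

lemma scaling_imp_homogeneous:
  fixes f :: "'e::euclidean_space \<times> 'e \<Rightarrow> real"
  assumes sc: "\<And>r. r > 0 \<Longrightarrow> f (x, r *\<^sub>R y) = r ^ k * f (x, y)"
    and diff: "f differentiable at (x, y)"
  shows "\<D> f (x, y) (0, y) = real k * f (x, y)"
proof -
  have "((\<lambda>s. f ((x, 0) + s *\<^sub>R (0, y))) has_real_derivative \<D> f ((x, 0) + 1 *\<^sub>R (0, y)) (0, y)) (at 1)"
    by (rule has_real_derivative_along_line) (use diff in simp)
  then have 1: "((\<lambda>s. f (x, s *\<^sub>R y)) has_real_derivative \<D> f (x, y) (0, y)) (at 1)" by simp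
  have "((\<lambda>s. s ^ k * f (x, y)) has_real_derivative real k * f (x, y)) (at 1)"
    by (auto intro!: derivative_eq_intros)
  then have "((\<lambda>s. f (x, s *\<^sub>R y)) has_real_derivative real k * f (x, y)) (at 1)"
    by (rule has_field_derivative_transform_within_open[where S = "{0<..}"]) (auto simp: sc)
  with 1 show ?thesis by (rule DERIV_unique)
qed

lemma fderiv_of_field:
  assumes "open D" "z \<in> D" "smooth_on D f" "X differentiable at z"
  shows "\<D> (\<lambda>w. \<D> f w (X w)) z u = \<D> (\<lambda>w. \<D> f w (X z)) z u + \<D> f z (\<D> X z u)"
  by (rule fderiv_eqI[OF has_derivative_fderiv_field[OF assms]])

lemma fderiv_vertical_position:
  fixes z :: "'e::euclidean_space \<times> 'e"
  shows "((\<lambda>w::'e \<times> 'e. (0::'e, snd w)) has_derivative (\<lambda>u. (0, snd u))) (at z)"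
  by (auto intro!: derivative_eq_intros)

text \<open>Differentiating Euler's identity \<open>\<D> f w (0, snd w) = k f w\<close> in direction \<open>u\<close>: the field \<open>(0, snd w)\<close>
contributes the term in \<open>(0, snd u)\<close>. The second form exchanges the two derivatives.\<close>

lemma fderiv_along_liouville:
  fixes f :: "'e::euclidean_space \<times> 'e \<Rightarrow> 'f::euclidean_space"
  assumes "open D" "z \<in> D" "smooth_on D f" "homogeneous_on D k f"
  shows "\<D> (\<lambda>w. \<D> f w (0, snd z)) z u = k *\<^sub>R \<D> f z u - \<D> f z (0, snd u)"
    and "\<D> (\<lambda>w. \<D> f w u) z (0, snd z) = k *\<^sub>R \<D> f z u - \<D> f z (0, snd u)"
proof -
  have "\<D> (\<lambda>w. \<D> f w (0, snd w)) z u = \<D> (\<lambda>w. \<D> f w (0, snd z)) z u + \<D> f z (0, snd u)"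
    using fderiv_of_field[OF assms(1-3) differentiableI[OF fderiv_vertical_position]]
      fderiv_eqI[OF fderiv_vertical_position, of z u] by simp
  moreover have "\<D> (\<lambda>w. \<D> f w (0, snd w)) z u = \<D> (\<lambda>w. k *\<^sub>R f w) z u"
    by (rule fderiv_cong[OF assms(1,2)]) (use assms(4) in \<open>simp add: homogeneous_on_def\<close>)
  moreover have "\<D> (\<lambda>w. k *\<^sub>R f w) z u = k *\<^sub>R \<D> f z u"
    by (rule fderiv_eqI)
      (intro has_derivative_scaleR_right fderiv_works smooth_on_differentiable[OF assms(3,2)])
  ultimately show *: "\<D> (\<lambda>w. \<D> f w (0, snd z)) z u = k *\<^sub>R \<D> f z u - \<D> f z (0, snd u)"
    by (simp add: algebra_simps)
  show "\<D> (\<lambda>w. \<D> f w u) z (0, snd z) = k *\<^sub>R \<D> f z u - \<D> f z (0, snd u)"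
    using mixed_derivatives_commute[OF assms(1-3), of u "(0, snd z)"] * by simp
qed

text \<open>If \<open>[\<C>, X] = m X\<close>, then the derivative along \<open>X\<close> raises the degree by \<open>m\<close>; the condition on \<open>X\<close> spells
out this bracket in coordinates. The spray has \<open>m = 1\<close>, the constant fields \<open>(0, a)\<close> have \<open>m = - 1\<close>
and the constant fields \<open>(a, 0)\<close> have \<open>m = 0\<close>.\<close>

lemma homogeneous_on_fderiv_field:
  fixes f :: "'e::euclidean_space \<times> 'e \<Rightarrow> 'f::euclidean_space"
  assumes "open D" "smooth_on D f" "homogeneous_on D k f" "\<And>z. z \<in> D \<Longrightarrow> X differentiable at z"
    and X: "\<And>z. z \<in> D \<Longrightarrow> \<D> X z (0, snd z) = m *\<^sub>R X z + (0, snd (X z))"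
  shows "homogeneous_on D (k + m) (\<lambda>w. \<D> f w (X w))"
  unfolding homogeneous_on_def
proof
  fix z assume z: "z \<in> D"
  have l: "linear (\<D> f z)" using linear_fderiv smooth_on_differentiable[OF assms(2) z] by blast
  show "\<D> (\<lambda>w. \<D> f w (X w)) z (0, snd z) = (k + m) *\<^sub>R \<D> f z (X z)"
    unfolding fderiv_of_field[OF assms(1) z assms(2) assms(4)[OF z]] X[OF z]
      fderiv_along_liouville(2)[OF assms(1) z assms(2,3)]
    by (simp add: linear_add[OF l] linear_scale[OF l] algebra_simps)
qed

lemma homogeneous_on_vertical_deriv:
  fixes f :: "'e::euclidean_space \<times> 'e \<Rightarrow> 'f::euclidean_space"
  assumes "open D" "smooth_on D f" "homogeneous_on D k f"
  shows "homogeneous_on D (k - 1) (\<lambda>w. \<D> f w (0, a))"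
  using homogeneous_on_fderiv_field[OF assms, of "\<lambda>_. (0, a)" "- 1"]
  by (simp add: zero_prod_def)

lemma homogeneous_on_base_deriv:
  fixes f :: "'e::euclidean_space \<times> 'e \<Rightarrow> 'f::euclidean_space"
  assumes "open D" "smooth_on D f" "homogeneous_on D k f"
  shows "homogeneous_on D k (\<lambda>w. \<D> f w (a, 0))"
  using homogeneous_on_fderiv_field[OF assms, of "\<lambda>_. (a, 0)" 0]
  by (simp add: zero_prod_def)

lemma homogeneous_on_add:
  assumes "\<And>z. z \<in> D \<Longrightarrow> f differentiable at z" "\<And>z. z \<in> D \<Longrightarrow> g differentiable at z"
    and "homogeneous_on D k f" "homogeneous_on D k g"
  shows "homogeneous_on D k (\<lambda>w. f w + g w)"
  unfolding homogeneous_on_def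
proof
  fix z assume z: "z \<in> D"
  show "\<D> (\<lambda>w. f w + g w) z (0, snd z) = k *\<^sub>R (f z + g z)"
    using fderiv_eqI[OF has_derivative_add[OF fderiv_works[OF assms(1)[OF z]] fderiv_works[OF assms(2)[OF z]]]]
      assms(3,4) z by (simp add: homogeneous_on_def algebra_simps)
qed

lemma homogeneous_on_bounded_linear:
  assumes "bounded_linear L" "\<And>z. z \<in> D \<Longrightarrow> f differentiable at z" "homogeneous_on D k f"
  shows "homogeneous_on D k (\<lambda>w. L (f w))"
  unfolding homogeneous_on_def
proof
  fix z assume z: "z \<in> D"
  show "\<D> (\<lambda>w. L (f w)) z (0, snd z) = k *\<^sub>R L (f z)"
    using fderiv_eqI[OF bounded_linear.has_derivative[OF assms(1) fderiv_works[OF assms(2)[OF z]]]]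
      assms(3) z linear_scale[OF bounded_linear.linear[OF assms(1)]] by (simp add: homogeneous_on_def)
qed

section \<open>The curvature of a spray in a chart\<close>

text \<open>The components \<open>- 2 G\<^sup>i\<close> of the spray.\<close>

definition spray_coeff :: "('e::euclidean_space \<times> 'e \<Rightarrow> 'e \<times> 'e) \<Rightarrow> 'e \<times> 'e \<Rightarrow> 'e" where
  "spray_coeff S z = snd (S z)"

text \<open>The matrix \<open>- 2 \<partial>G\<^sup>i/\<partial>y\<^sup>j\<close>, twice the negative of the nonlinear connection of the spray.\<close>

definition spray_conn :: "('e::euclidean_space \<times> 'e \<Rightarrow> 'e \<times> 'e) \<Rightarrow> 'e \<times> 'e \<Rightarrow> 'e \<Rightarrow> 'e" where
  "spray_conn S z a = \<D> (spray_coeff S) z (0, a)"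

text \<open>The matrix \<open>R\<^sup>i\<^sub>j = 2 \<partial>G\<^sup>i/\<partial>x\<^sup>j - S(\<partial>G\<^sup>i/\<partial>y\<^sup>j) - \<partial>G\<^sup>i/\<partial>y\<^sup>r \<partial>G\<^sup>r/\<partial>y\<^sup>j\<close> applied to \<open>a\<close>, written in terms of
\<open>s = - 2 G\<close>.\<close>

definition curv_map :: "('e::euclidean_space \<times> 'e \<Rightarrow> 'e \<times> 'e) \<Rightarrow> 'e \<times> 'e \<Rightarrow> 'e \<Rightarrow> 'e" where
  "curv_map S z a = (1/2) *\<^sub>R \<D> (\<lambda>w. spray_conn S w a) z (S z) - \<D> (spray_coeff S) z (a, 0)
     - (1/4) *\<^sub>R spray_conn S z (spray_conn S z a)"

locale local_spray =
  fixes D :: "('e::euclidean_space \<times> 'e) set" and S :: "'e \<times> 'e \<Rightarrow> 'e \<times> 'e"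
  assumes open_domain: "open D"
    and smooth_spray: "smooth_on D S"
    and spray_J: "z \<in> D \<Longrightarrow> tangent_J z (S z) = liouville z"
    and spray_homogeneous: "z \<in> D \<Longrightarrow> lie_bracket liouville S z = S z"
begin

abbreviation "s \<equiv> spray_coeff S"
abbreviation "N \<equiv> spray_conn S"

lemma fst_spray: "z \<in> D \<Longrightarrow> fst (S z) = snd z"
  using spray_J[of z] by (simp add: tangent_J_def liouville_def)

lemma spray_eq: "z \<in> D \<Longrightarrow> S z = (snd z, s z)"
  using fst_spray[of z] by (simp add: prod_eq_iff spray_coeff_def)

lemma smooth_coeff: "smooth_on D s"
  unfolding spray_coeff_def[abs_def]
  by (rule smooth_on_bounded_linear[OF open_domain bounded_linear_snd smooth_spray])

lemma differentiable_spray: "z \<in> D \<Longrightarrow> S differentiable at z"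
  by (rule smooth_on_differentiable[OF smooth_spray])

lemma differentiable_coeff: "z \<in> D \<Longrightarrow> s differentiable at z"
  by (rule smooth_on_differentiable[OF smooth_coeff])

lemma linear_coeff: "z \<in> D \<Longrightarrow> linear (\<D> s z)"
  by (rule linear_fderiv[OF differentiable_coeff])

lemma linear_conn: "z \<in> D \<Longrightarrow> linear (N z)"
  using linear_compose[of "\<lambda>a. (0, a)", OF _ linear_coeff]
  by (auto simp: o_def spray_conn_def[abs_def] linear_iff)

lemma smooth_conn: "smooth_on D (\<lambda>w. N w a)"
  unfolding spray_conn_def by (rule smooth_on_fderiv[OF smooth_coeff])

lemma differentiable_conn: "z \<in> D \<Longrightarrow> (\<lambda>w. N w a) differentiable at z"
  by (rule smooth_on_differentiable[OF smooth_conn])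

lemma fderiv_spray:
  assumes "z \<in> D" shows "\<D> S z u = (snd u, \<D> s z u)"
proof -
  have "((\<lambda>w. (snd w, s w)) has_derivative (\<lambda>u. (snd u, \<D> s z u))) (at z)"
    by (auto intro!: derivative_eq_intros fderiv_works differentiable_coeff assms)
  moreover have "\<D> S z u = \<D> (\<lambda>w. (snd w, s w)) z u"
    by (rule fderiv_cong[OF open_domain assms spray_eq])
  ultimately show ?thesis using fderiv_eqI by metis
qed

lemma fderiv_coeff_split:
  "z \<in> D \<Longrightarrow> \<D> s z (a, b) = \<D> s z (a, 0) + N z b"
  using linear_add[OF linear_coeff, of z "(a, 0)" "(0, b)"] by (simp add: spray_conn_def)

lemma lie_deriv_J:
  assumes "z \<in> D" shows "lie_deriv S tangent_J z u = (- fst u, snd u - N z (fst u))"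
  by (simp add: lie_deriv_def lie_bracket_def tangent_J_def fderiv_spray[OF assms] spray_conn_def
      prod_eq_iff)

lemma h_proj_eq: "z \<in> D \<Longrightarrow> h_proj S z u = (fst u, (1/2) *\<^sub>R N z (fst u))"
  by (simp add: h_proj_def lie_deriv_J prod_eq_iff algebra_simps flip: scaleR_2)

lemma v_proj_eq: "z \<in> D \<Longrightarrow> v_proj S z u = (0, snd u - (1/2) *\<^sub>R N z (fst u))"
  by (simp add: v_proj_def lie_deriv_J prod_eq_iff algebra_simps flip: scaleR_2)

lemma has_derivative_h_proj:
  assumes "z \<in> D"
  shows "((\<lambda>w. h_proj S w u) has_derivative (\<lambda>x. (0, (1/2) *\<^sub>R \<D> (\<lambda>w. N w (fst u)) z x))) (at z)"
proof -
  have "((\<lambda>w. (fst u, (1/2) *\<^sub>R N w (fst u))) has_derivative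
      (\<lambda>x. (0, (1/2) *\<^sub>R \<D> (\<lambda>w. N w (fst u)) z x))) (at z)"
    by (intro has_derivative_Pair has_derivative_const has_derivative_scaleR_right fderiv_works
        differentiable_conn assms)
  then show ?thesis
    by (rule has_derivative_transform_within_open[OF _ open_domain assms]) (simp add: h_proj_eq)
qed

lemma jacobi_eq:
  assumes z: "z \<in> D" shows "jacobi S z u = (0, curv_map S z (fst u))"
proof -
  obtain a b where u: "u = (a, b)" by (cases u)
  note lin = linear_conn[OF z]
  have "lie_deriv S (h_proj S) z u =
      (0, (1/2) *\<^sub>R \<D> (\<lambda>w. N w a) z (S z)) - \<D> S z (a, (1/2) *\<^sub>R N z a) - h_proj S z (- \<D> S z u)"
    using fderiv_eqI[OF has_derivative_h_proj[OF z, of u]]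
    by (simp add: lie_deriv_def lie_bracket_def h_proj_eq[OF z] u)
  also have "\<dots> = (b - (1/2) *\<^sub>R N z a, (1/2) *\<^sub>R \<D> (\<lambda>w. N w a) z (S z) - \<D> s z (a, 0)
      - (1/2) *\<^sub>R N z (N z a) + (1/2) *\<^sub>R N z b)"
    by (simp add: fderiv_spray[OF z] h_proj_eq[OF z] u fderiv_coeff_split[OF z, of a "(1/2) *\<^sub>R N z a"]
        linear_neg[OF lin] linear_scale[OF lin] diff_diff_eq)
  finally have "jacobi S z u = (0, (1/2) *\<^sub>R \<D> (\<lambda>w. N w a) z (S z) - \<D> s z (a, 0)
      - (1/2) *\<^sub>R N z (N z a) + (1/2) *\<^sub>R N z b - (1/2) *\<^sub>R N z (b - (1/2) *\<^sub>R N z a))"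
    by (simp add: jacobi_def v_proj_eq[OF z])
  moreover have "(1/2) *\<^sub>R X - Y - (1/2) *\<^sub>R Q + (1/2) *\<^sub>R B - (1/2) *\<^sub>R (B - (1/2) *\<^sub>R Q)
      = (1/2) *\<^sub>R X - Y - (1/4) *\<^sub>R Q" for X Y Q B :: 'e
    by (rule euclidean_eqI) (simp add: inner_simps, simp add: field_simps)
  ultimately show ?thesis
    by (simp add: curv_map_def u linear_diff[OF lin] linear_scale[OF lin])
qed

text \<open>This is the vertical component of \<open>[\<C>, S] = S\<close>.\<close>

lemma homogeneous_coeff: "homogeneous_on D 2 s"
  unfolding homogeneous_on_def
proof
  fix z assume z: "z \<in> D"
  have "((\<lambda>w. liouville w) has_derivative (\<lambda>u. (0, snd u))) (at z)"
    unfolding liouville_def by (rule fderiv_vertical_position)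
  from fderiv_eqI[OF this] have "\<D> liouville z u = (0, snd u)" for u by simp
  then show "\<D> s z (0, snd z) = 2 *\<^sub>R s z"
    using arg_cong[OF spray_homogeneous[OF z], of snd]
    by (simp add: lie_bracket_def fderiv_spray[OF z] liouville_def[of z] diff_eq_eq scaleR_2
        spray_coeff_def[of S z])
qed

lemma conn_position: "z \<in> D \<Longrightarrow> N z (snd z) = 2 *\<^sub>R s z"
  using homogeneous_coeff by (simp add: homogeneous_on_def spray_conn_def)

lemma h_proj_spray: "z \<in> D \<Longrightarrow> h_proj S z (S z) = S z"
  by (simp add: h_proj_eq spray_eq conn_position)

text \<open>In invariant terms \<open>\<Phi>(S) = v [S, h S] = v [S, S] = 0\<close>, since \<open>h S = S\<close>; in coordinates the three terms
of \<open>curv_map\<close> cancel by Euler's identity for \<open>s\<close> and its derivative.\<close>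

lemma curv_map_position:
  assumes z: "z \<in> D" shows "curv_map S z (snd z) = 0"
proof -
  have 1: "\<D> (\<lambda>w. N w (snd z)) z (S z) = 2 *\<^sub>R \<D> s z (S z) - N z (s z)"
    unfolding spray_conn_def
    using fderiv_along_liouville(1)[OF open_domain z smooth_coeff homogeneous_coeff, of "S z"]
    by (simp add: spray_eq[OF z])
  have 2: "\<D> s z (S z) = \<D> s z (snd z, 0) + N z (s z)"
    using fderiv_coeff_split[OF z, of "snd z" "s z"] by (simp add: spray_eq[OF z])
  have "(1/2) *\<^sub>R (2 *\<^sub>R (X + Q) - Q) - X - (1/4) *\<^sub>R (2 *\<^sub>R Q) = 0" for X Q :: 'e
    by (rule euclidean_eqI) (simp add: inner_simps, simp add: field_simps)
  then show ?thesis
    unfolding curv_map_def 1 2 conn_position[OF z] linear_scale[OF linear_conn[OF z]] .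
qed

lemma linear_curv_map:
  assumes z: "z \<in> D" shows "linear (curv_map S z)"
proof -
  have "\<D> (\<lambda>w. N w a) z (S z) = \<D> (\<lambda>w. \<D> s w (S z)) z (0, a)" for a
    unfolding spray_conn_def by (rule mixed_derivatives_commute[OF open_domain z smooth_coeff])
  moreover have l: "linear (\<D> (\<lambda>w. \<D> s w (S z)) z)"
    by (intro linear_fderiv smooth_on_differentiable[OF smooth_on_fderiv[OF smooth_coeff] z])
  ultimately show ?thesis
    unfolding curv_map_def
    using linear_add[OF l, of "(0, _)" "(0, _)"] linear_scale[OF l, of _ "(0, _)"]
      linear_add[OF linear_coeff[OF z], of "(_, 0)" "(_, 0)"] linear_scale[OF linear_coeff[OF z], of _ "(_, 0)"]
      linear_add[OF linear_conn[OF z]] linear_scale[OF linear_conn[OF z]]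
    by (simp add: linear_iff algebra_simps)
qed

lemma smooth_conn_conn: "smooth_on D (\<lambda>w. N w (N w a))"
  unfolding spray_conn_def[of S _ "N _ _"]
  by (intro smooth_on_fderiv_field smooth_on_Pair open_domain smooth_coeff smooth_on_const smooth_conn)

lemma smooth_curv_map: "smooth_on D (\<lambda>w. curv_map S w a)"
  unfolding curv_map_def
  by (intro smooth_on_diff smooth_on_bounded_linear[OF _ bounded_linear_scaleR_right] open_domain
      smooth_on_fderiv_field[OF _ smooth_conn smooth_spray] smooth_on_fderiv[OF smooth_coeff] smooth_conn_conn)

lemma homogeneous_curv_map: "homogeneous_on D 2 (\<lambda>w. curv_map S w a)"
proof -
  have N: "homogeneous_on D 1 (\<lambda>w. N w b)" for b
    using homogeneous_on_vertical_deriv[OF open_domain smooth_coeff homogeneous_coeff]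
    by (simp add: spray_conn_def)
  have 1: "homogeneous_on D 2 (\<lambda>w. \<D> (\<lambda>w. N w a) w (S w))"
  proof -
    have "\<D> S z (0, snd z) = 1 *\<^sub>R S z + (0, snd (S z))" if "z \<in> D" for z
      using that homogeneous_coeff
      by (simp add: fderiv_spray spray_eq homogeneous_on_def scaleR_2)
    from homogeneous_on_fderiv_field[OF open_domain smooth_conn N differentiable_spray this] show ?thesis
      by simp
  qed
  have 2: "homogeneous_on D 2 (\<lambda>w. \<D> s w (a, 0))"
    by (rule homogeneous_on_base_deriv[OF open_domain smooth_coeff homogeneous_coeff])
  have 3: "homogeneous_on D 2 (\<lambda>w. N w (N w a))"
  proof -
    have d: "((\<lambda>w. (0::'e, N w a)) has_derivative (\<lambda>u. (0, \<D> (\<lambda>w. N w a) z u))) (at z)" if "z \<in> D" for z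
      by (intro has_derivative_Pair has_derivative_const fderiv_works differentiable_conn that)
    have "\<D> (\<lambda>w. (0::'e, N w a)) z (0, snd z) = 0 *\<^sub>R (0, N z a) + (0, snd (0::'e, N z a))"
      if "z \<in> D" for z
      using fderiv_eqI[OF d[OF that]] N[of a] that by (simp add: homogeneous_on_def)
    from homogeneous_on_fderiv_field[OF open_domain smooth_coeff homogeneous_coeff differentiableI[OF d] this]
    show ?thesis by (simp add: spray_conn_def)
  qed
  have d: "(\<lambda>w. \<D> (\<lambda>w. N w a) w (S w)) differentiable at z" "(\<lambda>w. \<D> s w (a, 0)) differentiable at z"
    "(\<lambda>w. N w (N w a)) differentiable at z" if "z \<in> D" for z
    using that by (auto intro!: smooth_on_differentiable[OF _ that] smooth_conn_conn
        smooth_on_fderiv_field[OF open_domain smooth_conn smooth_spray] smooth_on_fderiv[OF smooth_coeff])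
  have "homogeneous_on D 2 (\<lambda>w. (1/2) *\<^sub>R \<D> (\<lambda>w. N w a) w (S w) + ((-1) *\<^sub>R \<D> s w (a, 0)
      + (-1/4) *\<^sub>R N w (N w a)))"
    by (intro homogeneous_on_add homogeneous_on_bounded_linear[OF bounded_linear_scaleR_right] d 1 2 3
        differentiable_add differentiable_scaleR differentiable_const)
  then show ?thesis by (simp add: curv_map_def algebra_simps)
qed

text \<open>Since \<open>h S = S\<close>, the hypothesis contains \<open>S E = 0\<close>. Its derivative in direction \<open>(0, a)\<close> involves
\<open>\<D> E (a, N a)\<close>, which horizontality \<open>\<D> E (2 a, N a) = 0\<close> turns into \<open>- \<D> E (a, 0)\<close>; this is the
Euler-Lagrange equation. The remaining terms of \<open>i\<^sub>S dd\<^sub>J E\<close> follow from homogeneity.\<close>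

lemma horizontal_imp_euler_lagrange:
  fixes E :: "'e \<times> 'e \<Rightarrow> real"
  assumes z: "z \<in> D" and E: "smooth_on D E" "homogeneous_on D 2 E"
    and horizontal: "\<And>z u. z \<in> D \<Longrightarrow> \<D> E z (h_proj S z u) = 0"
  shows "ext_d1 (fn_d0 tangent_J E) z (S z) u = - ext_d0 E z u"
proof -
  obtain a b where u: "u = (a, b)" by (cases u)
  have l: "linear (\<D> E z)" by (intro linear_fderiv smooth_on_differentiable[OF E(1) z])
  have "\<D> (\<lambda>w. \<D> E w (S w)) z (0, a) = \<D> (\<lambda>_. 0) z (0, a)"
    by (rule fderiv_cong[OF open_domain z]) (metis horizontal h_proj_spray)
  then have "\<D> (\<lambda>w. \<D> E w (S z)) z (0, a) + \<D> E z (a, N z a) = 0"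
    using fderiv_of_field[OF open_domain z E(1) differentiable_spray[OF z], of "(0, a)"]
    by (simp add: fderiv_spray[OF z] spray_conn_def)
  moreover have "\<D> (\<lambda>w. \<D> E w (S z)) z (0, a) = \<D> (\<lambda>w. \<D> E w (0, a)) z (S z)"
    by (rule mixed_derivatives_commute[OF open_domain z E(1)])
  moreover have "\<D> E z (a, N z a) = - \<D> E z (a, 0)"
  proof -
    have "\<D> E z (a, N z a) + \<D> E z (a, 0) = \<D> E z (2 *\<^sub>R h_proj S z (a, b))"
      by (simp add: h_proj_eq[OF z] flip: linear_add[OF l]) (simp add: scaleR_2)
    then show ?thesis using horizontal[OF z] by (simp add: linear_scale[OF l])
  qed
  ultimately have S: "\<D> (\<lambda>w. \<D> E w (0, a)) z (S z) = \<D> E z (a, 0)" by simp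
  have "\<D> (\<lambda>w. \<D> E w (0, snd z)) z u = 2 * \<D> E z (a, 0) + \<D> E z (0, b)"
    using fderiv_along_liouville(1)[OF open_domain z E, of u] linear_add[OF l, of "(a, 0)" "(0, b)"]
    by (simp add: u)
  moreover have "\<D> E z (a, b) = \<D> E z (a, 0) + \<D> E z (0, b)"
    using linear_add[OF l, of "(a, 0)" "(0, b)"] by simp
  ultimately show ?thesis
    using S by (simp add: ext_d1_def fn_d0_def contract1_def ext_d0_def tangent_J_def fst_spray[OF z] u)
qed

text \<open>The same computation in the other direction: evaluating \<open>i\<^sub>S dd\<^sub>J E\<close> on \<open>S\<close> itself gives \<open>S E = 0\<close> by
skew-symmetry.\<close>

lemma euler_lagrange_imp_horizontal:
  fixes E :: "'e \<times> 'e \<Rightarrow> real"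
  assumes z: "z \<in> D" and E: "smooth_on D E" "homogeneous_on D 2 E"
    and el: "\<And>z u. z \<in> D \<Longrightarrow> ext_d1 (fn_d0 tangent_J E) z (S z) u = - ext_d0 E z u"
  shows "\<D> E z (h_proj S z u) = 0"
proof -
  obtain a b where u: "u = (a, b)" by (cases u)
  have l: "linear (\<D> E z)" by (intro linear_fderiv smooth_on_differentiable[OF E(1) z])
  have "\<D> E w (S w) = 0" if "w \<in> D" for w
    using el[OF that, of "S w"] by (simp add: ext_d1_def ext_d0_def)
  then have "\<D> (\<lambda>w. \<D> E w (S w)) z (0, a) = \<D> (\<lambda>_. 0) z (0, a)"
    by (rule fderiv_cong[OF open_domain z])
  then have "\<D> (\<lambda>w. \<D> E w (S z)) z (0, a) + \<D> E z (a, N z a) = 0"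
    using fderiv_of_field[OF open_domain z E(1) differentiable_spray[OF z], of "(0, a)"]
    by (simp add: fderiv_spray[OF z] spray_conn_def)
  moreover have "\<D> (\<lambda>w. \<D> E w (S z)) z (0, a) = \<D> (\<lambda>w. \<D> E w (0, a)) z (S z)"
    by (rule mixed_derivatives_commute[OF open_domain z E(1)])
  moreover have "\<D> (\<lambda>w. \<D> E w (0, a)) z (S z) = \<D> E z (a, 0)"
    using el[OF z, of "(a, 0)"] fderiv_along_liouville(1)[OF open_domain z E, of "(a, 0)"]
      linear_0[OF l]
    by (simp add: ext_d1_def fn_d0_def contract1_def ext_d0_def tangent_J_def fst_spray[OF z] zero_prod_def)
  ultimately have "\<D> E z (a, N z a) + \<D> E z (a, 0) = 0" by simp
  moreover have "\<D> E z (a, N z a) + \<D> E z (a, 0) = \<D> E z (2 *\<^sub>R h_proj S z (a, b))"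
    by (simp add: h_proj_eq[OF z] flip: linear_add[OF l]) (simp add: scaleR_2)
  ultimately show ?thesis by (simp add: linear_scale[OF l] u)
qed

end

section \<open>Naturality of the Lie derivative and of the Jacobi endomorphism\<close>

lemma fderiv_compose:
  assumes "\<tau> differentiable at z" "f differentiable at (\<tau> z)"
  shows "\<D> (\<lambda>w. f (\<tau> w)) z v = \<D> f (\<tau> z) (\<D> \<tau> z v)"
  by (rule fderiv_eqI[OF has_derivative_compose[OF fderiv_works[OF assms(1)] fderiv_works[OF assms(2)]]])

lemma differentiable_compose_at:
  fixes \<tau> :: "'x::euclidean_space \<Rightarrow> 'y::euclidean_space" and f :: "'y \<Rightarrow> 'f::real_normed_vector"
  assumes "\<tau> differentiable at z" "f differentiable at (\<tau> z)"
  shows "(\<lambda>w. f (\<tau> w)) differentiable at z"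
  by (rule differentiableI[OF has_derivative_compose[OF fderiv_works[OF assms(1)] fderiv_works[OF assms(2)]]])

text \<open>Here \<open>K\<close> and \<open>S\<close> are carried to \<open>K'\<close> and \<open>S'\<close> by \<open>\<tau>\<close>. Differentiating the two transformation laws
produces second derivatives \<open>T\<close> of \<open>\<tau>\<close>; in the Lie derivative they cancel in pairs because \<open>T\<close> is
symmetric. Only the forward map occurs, so that no inverse of \<open>\<tau>\<close> has to be differentiated.\<close>

lemma lie_deriv_natural:
  fixes \<tau> :: "'z::euclidean_space \<Rightarrow> 'z"
  assumes W: "open W" "z \<in> W" and \<tau>: "smooth_on W \<tau>"
    and S: "S differentiable at z" "S' differentiable at (\<tau> z)"
    and K: "\<And>v. (\<lambda>w. K w v) differentiable at z" "\<And>v. (\<lambda>w. K' w v) differentiable at (\<tau> z)"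
    and lin: "\<And>w. w \<in> W \<Longrightarrow> linear (K' (\<tau> w))"
    and S': "\<And>w. w \<in> W \<Longrightarrow> S' (\<tau> w) = \<D> \<tau> w (S w)"
    and K': "\<And>w v. w \<in> W \<Longrightarrow> K' (\<tau> w) (\<D> \<tau> w v) = \<D> \<tau> w (K w v)"
  shows "lie_deriv S' K' (\<tau> z) (\<D> \<tau> z u) = \<D> \<tau> z (lie_deriv S K z u)"
proof -
  define T where "T a b = \<D> (\<lambda>w. \<D> \<tau> w a) z b" for a b
  have sym: "T a b = T b a" for a b
    unfolding T_def by (rule mixed_derivatives_commute[OF W \<tau>])
  have d\<tau>: "\<tau> differentiable at z" by (rule smooth_on_differentiable[OF \<tau> W(2)])
  note l\<tau> = linear_fderiv[OF d\<tau>] and lK' = lin[OF W(2)]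
  have A: "\<D> S' (\<tau> z) (\<D> \<tau> z v) = T (S z) v + \<D> \<tau> z (\<D> S z v)" for v
  proof -
    have "\<D> S' (\<tau> z) (\<D> \<tau> z v) = \<D> (\<lambda>w. S' (\<tau> w)) z v"
      by (rule fderiv_compose[OF d\<tau> S(2), symmetric])
    also have "\<dots> = \<D> (\<lambda>w. \<D> \<tau> w (S w)) z v" by (rule fderiv_cong[OF W S'])
    also have "\<dots> = T (S z) v + \<D> \<tau> z (\<D> S z v)"
      unfolding T_def by (rule fderiv_of_field[OF W \<tau> S(1)])
    finally show ?thesis .
  qed
  have B: "\<D> (\<lambda>w. K' w (\<D> \<tau> z u)) (\<tau> z) (\<D> \<tau> z v) + K' (\<tau> z) (T u v)
      = T (K z u) v + \<D> \<tau> z (\<D> (\<lambda>w. K w u) z v)" for v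
  proof -
    have "\<D> (\<lambda>w. K' (\<tau> w) (\<D> \<tau> w u)) z v
        = \<D> (\<lambda>w. K' (\<tau> w) (\<D> \<tau> z u)) z v + K' (\<tau> z) (T u v)"
      unfolding T_def
      by (rule fderiv_eqI[OF has_derivative_linear_family[OF W lin]])
        (rule differentiable_compose_at[OF d\<tau> K(2)]
          smooth_on_differentiable[OF smooth_on_fderiv[OF \<tau>] W(2)] | assumption)+
    moreover have "\<D> (\<lambda>w. K' (\<tau> w) (\<D> \<tau> z u)) z v = \<D> (\<lambda>w. K' w (\<D> \<tau> z u)) (\<tau> z) (\<D> \<tau> z v)"
      by (rule fderiv_compose[OF d\<tau> K(2)])
    moreover have "\<D> (\<lambda>w. K' (\<tau> w) (\<D> \<tau> w u)) z v = \<D> (\<lambda>w. \<D> \<tau> w (K w u)) z v"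
      by (rule fderiv_cong[OF W K'])
    moreover have "\<D> (\<lambda>w. \<D> \<tau> w (K w u)) z v = T (K z u) v + \<D> \<tau> z (\<D> (\<lambda>w. K w u) z v)"
      unfolding T_def by (rule fderiv_of_field[OF W \<tau> K(1)])
    ultimately show ?thesis by metis
  qed
  have "lie_deriv S' K' (\<tau> z) (\<D> \<tau> z u) = \<D> (\<lambda>w. K' w (\<D> \<tau> z u)) (\<tau> z) (\<D> \<tau> z (S z))
      - \<D> S' (\<tau> z) (\<D> \<tau> z (K z u)) + K' (\<tau> z) (\<D> S' (\<tau> z) (\<D> \<tau> z u))"
    by (simp add: lie_deriv_def lie_bracket_def S'[OF W(2)] K'[OF W(2)] linear_neg[OF lK'])
  also have "\<D> (\<lambda>w. K' w (\<D> \<tau> z u)) (\<tau> z) (\<D> \<tau> z (S z))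
      = T (K z u) (S z) + \<D> \<tau> z (\<D> (\<lambda>w. K w u) z (S z)) - K' (\<tau> z) (T u (S z))"
    using B[of "S z"] by (simp add: eq_diff_eq)
  also have "\<D> S' (\<tau> z) (\<D> \<tau> z (K z u)) = T (K z u) (S z) + \<D> \<tau> z (\<D> S z (K z u))"
    by (simp add: A sym[of "S z"])
  also have "K' (\<tau> z) (\<D> S' (\<tau> z) (\<D> \<tau> z u)) = K' (\<tau> z) (T u (S z)) + \<D> \<tau> z (K z (\<D> S z u))"
    by (simp add: A sym[of "S z"] linear_add[OF lK'] K'[OF W(2)])
  finally have 1: "lie_deriv S' K' (\<tau> z) (\<D> \<tau> z u)
      = \<D> \<tau> z (\<D> (\<lambda>w. K w u) z (S z)) - \<D> \<tau> z (\<D> S z (K z u)) + \<D> \<tau> z (K z (\<D> S z u))"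
    by simp
  have "\<D> \<tau> z (K z (- \<D> S z u)) = - \<D> \<tau> z (K z (\<D> S z u))"
    using K'[OF W(2), of "- \<D> S z u"] K'[OF W(2), of "\<D> S z u"]
    by (simp add: linear_neg[OF l\<tau>] linear_neg[OF lK'])
  then show ?thesis
    unfolding 1 by (simp add: lie_deriv_def lie_bracket_def linear_diff[OF l\<tau>])
qed

text \<open>A coordinate change between two local expressions of one spray, on the overlap \<open>W\<close> of the charts.
Compatibility with the tangent structure is kept as an assumption, so that the argument does not
depend on the form of the coordinate change.\<close>

locale spray_transition = src: local_spray D S + tgt: local_spray D' S'
  for D :: "('e::euclidean_space \<times> 'e) set" and S and D' :: "('e \<times> 'e) set" and S' +
  fixes W and \<tau> :: "'e \<times> 'e \<Rightarrow> 'e \<times> 'e"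
  assumes open_overlap: "open W" and overlap_subset: "W \<subseteq> D"
    and transition_in: "w \<in> W \<Longrightarrow> \<tau> w \<in> D'"
    and smooth_transition: "smooth_on W \<tau>"
    and transition_J: "w \<in> W \<Longrightarrow> tangent_J (\<tau> w) (\<D> \<tau> w u) = \<D> \<tau> w (tangent_J w u)"
    and transition_spray: "w \<in> W \<Longrightarrow> S' (\<tau> w) = \<D> \<tau> w (S w)"
begin

lemma linear_transition: "w \<in> W \<Longrightarrow> linear (\<D> \<tau> w)"
  by (rule linear_fderiv[OF smooth_on_differentiable[OF smooth_transition]])

lemma lie_deriv_J_natural:
  assumes "w \<in> W"
  shows "lie_deriv S' tangent_J (\<tau> w) (\<D> \<tau> w u) = \<D> \<tau> w (lie_deriv S tangent_J w u)"
proof (rule lie_deriv_natural[OF open_overlap assms smooth_transition])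
  show "S differentiable at w" "S' differentiable at (\<tau> w)"
    using assms overlap_subset transition_in src.differentiable_spray tgt.differentiable_spray by blast+
  show "linear (tangent_J (\<tau> v))" for v
    by (simp add: linear_iff tangent_J_def)
qed (simp_all add: tangent_J_def[abs_def] transition_spray transition_J[unfolded tangent_J_def])

lemma h_proj_natural:
  assumes "w \<in> W" shows "h_proj S' (\<tau> w) (\<D> \<tau> w u) = \<D> \<tau> w (h_proj S w u)"
  by (simp add: h_proj_def lie_deriv_J_natural[OF assms] linear_scale[OF linear_transition[OF assms]]
      linear_diff[OF linear_transition[OF assms]])

lemma v_proj_natural:
  assumes "w \<in> W" shows "v_proj S' (\<tau> w) (\<D> \<tau> w u) = \<D> \<tau> w (v_proj S w u)"
  by (simp add: v_proj_def lie_deriv_J_natural[OF assms] linear_scale[OF linear_transition[OF assms]]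
      linear_add[OF linear_transition[OF assms]])

lemma jacobi_natural:
  assumes w: "w \<in> W" shows "jacobi S' (\<tau> w) (\<D> \<tau> w u) = \<D> \<tau> w (jacobi S w u)"
proof -
  have "lie_deriv S' (h_proj S') (\<tau> w) (\<D> \<tau> w u) = \<D> \<tau> w (lie_deriv S (h_proj S) w u)"
  proof (rule lie_deriv_natural[OF open_overlap w smooth_transition])
    show "S differentiable at w" "S' differentiable at (\<tau> w)"
      using w overlap_subset transition_in src.differentiable_spray tgt.differentiable_spray by blast+
    show "(\<lambda>w. h_proj S w v) differentiable at w" for v
      using w overlap_subset by (intro differentiableI[OF src.has_derivative_h_proj]) blast
    show "(\<lambda>w. h_proj S' w v) differentiable at (\<tau> w)" for v
      by (intro differentiableI[OF tgt.has_derivative_h_proj] transition_in w)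
    show "linear (h_proj S' (\<tau> v))" if "v \<in> W" for v
      using tgt.linear_conn[OF transition_in[OF that]]
      by (simp add: linear_iff tgt.h_proj_eq[OF transition_in[OF that]] algebra_simps)
  qed (simp_all add: transition_spray h_proj_natural)
  then show ?thesis by (simp add: jacobi_def v_proj_natural[OF w])
qed

end

section \<open>Isotropy in dimension two\<close>

text \<open>The form \<open>\<alpha>\<close> of the isotropy equation \<open>R J u - \<Phi> u = \<alpha>(u) \<C>\<close>, obtained by pairing that equation with
\<open>y\<close>. In contrast to the quotients \<open>R\<^sup>2\<^sub>2 / y\<^sup>1\<close> and \<open>- R\<^sup>2\<^sub>1 / y\<^sup>2\<close>, its denominator vanishes nowhere on
the slit bundle, so smoothness is immediate.\<close>

definition iso_form :: "((real^2) \<times> (real^2) \<Rightarrow> (real^2) \<times> (real^2)) \<Rightarrow>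
    (real^2) \<times> (real^2) \<Rightarrow> (real^2) \<times> (real^2) \<Rightarrow> real" where
  "iso_form S z u = ((ricci_scalar S z *\<^sub>R fst u - snd (jacobi S z u)) \<bullet> snd z) / (snd z \<bullet> snd z)"

lemma ricci_scalar_planar: "ricci_scalar (S :: (real^2) \<times> (real^2) \<Rightarrow> (real^2) \<times> (real^2)) = ricci S"
  by (simp add: ricci_scalar_def fun_eq_iff)

lemma vec2_expand: "(a::real^2) = a $ 1 *\<^sub>R axis 1 1 + a $ 2 *\<^sub>R axis 2 1"
  by (simp add: vec_eq_iff forall_2 axis_def)

lemma parallel_vec2:
  fixes t y :: "real^2"
  assumes "y \<noteq> 0" "t $ 1 * y $ 2 = t $ 2 * y $ 1"
  shows "t = ((t \<bullet> y) / (y \<bullet> y)) *\<^sub>R y"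
proof -
  have "(y \<bullet> y) *\<^sub>R t = (t \<bullet> y) *\<^sub>R y"
    using assms(2) by (simp add: vec_eq_iff forall_2 inner_vec_def sum_2) (simp add: algebra_simps)
  then have "(1 / (y \<bullet> y)) *\<^sub>R ((y \<bullet> y) *\<^sub>R t) = (1 / (y \<bullet> y)) *\<^sub>R ((t \<bullet> y) *\<^sub>R y)" by simp
  then show ?thesis using assms(1) by simp
qed

text \<open>A nonzero multiple of the identity has rank \<open>2\<close> and cannot have its image in one line. The equation is
tested on the vector orthogonal to \<open>y\<close>. This is how isotropy determines both \<open>R\<close> and \<open>\<alpha>\<close>.\<close>

lemma multiples_of_one_vector:
  fixes y :: "real^2"
  assumes "y \<noteq> 0" "\<And>a. r *\<^sub>R a = c a *\<^sub>R y"
  shows "r = 0"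
proof -
  let ?a = "vector [- y $ 2, y $ 1] :: real^2"
  have "r * (?a \<bullet> ?a) = c ?a * (y \<bullet> ?a)"
    using arg_cong[OF assms(2)[of ?a], of "\<lambda>x. x \<bullet> ?a"] by simp
  moreover have "y \<bullet> ?a = 0" by (simp add: inner_vec_def sum_2)
  moreover have "?a \<noteq> 0" using assms(1) by (auto simp: vec_eq_iff forall_2)
  ultimately show ?thesis by simp
qed

locale planar_spray = local_spray D S for D :: "((real^2) \<times> (real^2)) set" and S +
  assumes slit: "z \<in> D \<Longrightarrow> snd z \<noteq> (0::real^2)"
begin

abbreviation "\<rho> \<equiv> ricci_scalar S"
abbreviation "\<alpha> \<equiv> iso_form S"

lemma jacobi_comp_eq: "z \<in> D \<Longrightarrow> jacobi_comp S i j z = curv_map S z (axis j 1) $ i"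
  by (simp add: jacobi_comp_def jacobi_eq)

lemma ricci_scalar_eq: "z \<in> D \<Longrightarrow> \<rho> z = curv_map S z (axis 1 1) $ 1 + curv_map S z (axis 2 1) $ 2"
  by (simp add: ricci_scalar_planar ricci_def sum_2 jacobi_comp_eq)

lemma iso_form_eq:
  "z \<in> D \<Longrightarrow> \<alpha> z u = ((\<rho> z *\<^sub>R fst u - curv_map S z (fst u)) \<bullet> snd z) / (snd z \<bullet> snd z)"
  by (simp add: iso_form_def jacobi_eq)

lemma curv_map_expand:
  assumes "z \<in> D"
  shows "curv_map S z a = a $ 1 *\<^sub>R curv_map S z (axis 1 1) + a $ 2 *\<^sub>R curv_map S z (axis 2 1)"
  using linear_add[OF linear_curv_map[OF assms]] linear_scale[OF linear_curv_map[OF assms]] vec2_expand[of a]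
  by metis

lemma curv_map_position_components:
  assumes "z \<in> D"
  shows "snd z $ 1 * curv_map S z (axis 1 1) $ i + snd z $ 2 * curv_map S z (axis 2 1) $ i = 0"
  using curv_map_position[OF assms] curv_map_expand[OF assms, of "snd z"] by (simp add: vec_eq_iff)

text \<open>The rows of the matrix are orthogonal to \<open>y\<close>, and \<open>R Id - P\<close> is its adjugate, whose columns are
therefore parallel to \<open>y\<close>.\<close>

lemma curv_map_isotropic:
  assumes z: "z \<in> D" shows "\<rho> z *\<^sub>R fst u - curv_map S z (fst u) = \<alpha> z u *\<^sub>R snd z"
proof -
  let ?P = "\<lambda>i j. curv_map S z (axis j 1) $ i"
  have c: "snd z $ 2 * ?P i 2 = - snd z $ 1 * ?P i 1" for i
    using curv_map_position_components[OF z, of i] by simp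
  let ?t = "\<rho> z *\<^sub>R fst u - curv_map S z (fst u)"
  have t: "?t $ 1 = ?P 2 2 * fst u $ 1 - ?P 1 2 * fst u $ 2" "?t $ 2 = ?P 1 1 * fst u $ 2 - ?P 2 1 * fst u $ 1"
    unfolding curv_map_expand[OF z, of "fst u"] by (simp_all add: ricci_scalar_eq[OF z] algebra_simps)
  have "?t $ 1 * snd z $ 2 = fst u $ 1 * (snd z $ 2 * ?P 2 2) - fst u $ 2 * (snd z $ 2 * ?P 1 2)"
    unfolding t by (simp add: algebra_simps)
  also have "\<dots> = ?t $ 2 * snd z $ 1"
    unfolding c t by (simp add: algebra_simps)
  finally show ?thesis
    unfolding iso_form_eq[OF z] by (rule parallel_vec2[OF slit[OF z]])
qed

lemma isotropic:
  assumes z: "z \<in> D" shows "jacobi S z u = \<rho> z *\<^sub>R tangent_J z u - \<alpha> z u *\<^sub>R liouville z"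
  using curv_map_isotropic[OF z, of u]
  by (simp add: jacobi_eq[OF z] tangent_J_def liouville_def algebra_simps)

lemma iso_form_components:
  assumes z: "z \<in> D"
  shows "\<alpha> z (axis 1 1, 0) * snd z $ 1 = jacobi_comp S 2 2 z"
    and "\<alpha> z (axis 2 1, 0) * snd z $ 1 = - jacobi_comp S 1 2 z"
    and "\<alpha> z (axis 1 1, 0) * snd z $ 2 = - jacobi_comp S 2 1 z"
    and "\<alpha> z (axis 2 1, 0) * snd z $ 2 = jacobi_comp S 1 1 z"
  using arg_cong[OF curv_map_isotropic[OF z, of "(axis 1 1, 0)"], of "\<lambda>x. x $ 1"]
    arg_cong[OF curv_map_isotropic[OF z, of "(axis 1 1, 0)"], of "\<lambda>x. x $ 2"]
    arg_cong[OF curv_map_isotropic[OF z, of "(axis 2 1, 0)"], of "\<lambda>x. x $ 1"]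
    arg_cong[OF curv_map_isotropic[OF z, of "(axis 2 1, 0)"], of "\<lambda>x. x $ 2"]
  by (simp_all add: jacobi_comp_eq[OF z] ricci_scalar_eq[OF z] axis_def)

lemma iso_form_vertical: "z \<in> D \<Longrightarrow> \<alpha> z (0, b) = 0"
  by (simp add: iso_form_eq linear_0[OF linear_curv_map])

lemma iso_form_horizontal: "z \<in> D \<Longrightarrow> \<alpha> z (a, b) = \<alpha> z (a, 0)"
  by (simp add: iso_form_eq)

lemma linear_iso_form: "z \<in> D \<Longrightarrow> linear (\<alpha> z)"
  using linear_add[OF linear_curv_map] linear_scale[OF linear_curv_map]
  by (simp add: linear_iff iso_form_eq inner_simps add_divide_distrib diff_divide_distrib algebra_simps)

text \<open>In invariant terms, \<open>\<alpha>(S) = R\<close>.\<close>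

lemma iso_form_position: "z \<in> D \<Longrightarrow> \<alpha> z (snd z, 0) = \<rho> z"
  using slit[of z] by (simp add: iso_form_eq curv_map_position)

lemma smooth_ricci_scalar: "smooth_on D \<rho>"
proof -
  have "smooth_on D (\<lambda>w. curv_map S w (axis 1 1) $ 1 + curv_map S w (axis 2 1) $ 2)"
    by (intro smooth_on_add open_domain smooth_on_bounded_linear[OF open_domain bounded_linear_vec_nth]
        smooth_curv_map)
  then show ?thesis
    by (rule iffD2[OF smooth_on_cong[OF open_domain ricci_scalar_eq], rotated])
qed

lemma smooth_iso_form: "smooth_on D (\<lambda>w. \<alpha> w u)"
proof -
  have "smooth_on D (\<lambda>w. ((\<rho> w *\<^sub>R fst u - curv_map S w (fst u)) \<bullet> snd w) * (snd w \<bullet> snd w) powr (- 1))"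
    using slit
    by (intro smooth_on_mult smooth_on_inner smooth_on_diff smooth_on_scaleR smooth_on_powr open_domain
        smooth_ricci_scalar smooth_on_const smooth_curv_map
        smooth_on_bounded_linear[OF open_domain bounded_linear_snd smooth_on_id]) simp
  then show ?thesis
  proof (rule iffD2[OF smooth_on_cong[OF open_domain], rotated])
    fix w assume w: "w \<in> D"
    show "\<alpha> w u = ((\<rho> w *\<^sub>R fst u - curv_map S w (fst u)) \<bullet> snd w) * (snd w \<bullet> snd w) powr (- 1)"
      using slit[OF w] by (simp add: iso_form_eq[OF w] powr_minus_divide)
  qed
qed

lemma homogeneous_ricci_scalar: "homogeneous_on D 2 \<rho>"
proof -
  have d: "(\<lambda>w. curv_map S w a $ i) differentiable at z" if "z \<in> D" for z a i
    by (rule smooth_on_differentiable[OF smooth_on_bounded_linear[OF open_domain bounded_linear_vec_nth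
            smooth_curv_map] that])
  have "homogeneous_on D 2 (\<lambda>w. curv_map S w (axis 1 1) $ 1 + curv_map S w (axis 2 1) $ 2)"
    by (intro homogeneous_on_add d homogeneous_on_bounded_linear[OF bounded_linear_vec_nth]
        homogeneous_curv_map smooth_on_differentiable[OF smooth_curv_map])
  moreover have "\<D> \<rho> z u = \<D> (\<lambda>w. curv_map S w (axis 1 1) $ 1 + curv_map S w (axis 2 1) $ 2) z u"
    if "z \<in> D" for z u
    by (rule fderiv_cong[OF open_domain that ricci_scalar_eq])
  ultimately show ?thesis
    by (simp add: homogeneous_on_def ricci_scalar_eq)
qed

text \<open>Both \<open>R\<close> and \<open>P\<close> have degree \<open>2\<close>, and in \<open>R a - P a = \<alpha>(a) y\<close> one degree is carried by the factor
\<open>y\<close>.\<close>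

lemma homogeneous_iso_form: "homogeneous_on D 1 (\<lambda>w. \<alpha> w u)"
  unfolding homogeneous_on_def
proof
  fix z assume z: "z \<in> D"
  let ?X = "\<lambda>w. \<rho> w *\<^sub>R fst u - curv_map S w (fst u)"
  have d: "\<rho> differentiable at z" "(\<lambda>w. curv_map S w (fst u)) differentiable at z" "(\<lambda>w. \<alpha> w u) differentiable at z"
    using z smooth_ricci_scalar smooth_curv_map smooth_iso_form smooth_on_differentiable by metis+
  have "(?X has_derivative (\<lambda>v. \<D> \<rho> z v *\<^sub>R fst u - \<D> (\<lambda>w. curv_map S w (fst u)) z v)) (at z)"
    by (intro has_derivative_diff has_derivative_scaleR_left fderiv_works d)
  from fderiv_eqI[OF this, of "(0, snd z)"]
  have "\<D> ?X z (0, snd z) = 2 *\<^sub>R ?X z"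
    using homogeneous_ricci_scalar homogeneous_curv_map[of "fst u"] z
    by (simp add: homogeneous_on_def algebra_simps)
  moreover have "\<D> ?X z (0, snd z) = \<D> (\<lambda>w. \<alpha> w u *\<^sub>R snd w) z (0, snd z)"
    by (rule fderiv_cong[OF open_domain z curv_map_isotropic])
  moreover have "((\<lambda>w. \<alpha> w u *\<^sub>R snd w) has_derivative (\<lambda>v. \<alpha> z u *\<^sub>R snd v + \<D> (\<lambda>w. \<alpha> w u) z v *\<^sub>R snd z)) (at z)"
    by (intro has_derivative_scaleR has_derivative_snd has_derivative_ident fderiv_works d)
  note fderiv_eqI[OF this, of "(0, snd z)"]
  ultimately have "\<alpha> z u *\<^sub>R snd z + \<D> (\<lambda>w. \<alpha> w u) z (0, snd z) *\<^sub>R snd z = 2 *\<^sub>R (\<alpha> z u *\<^sub>R snd z)"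
    by (simp add: curv_map_isotropic[OF z])
  then have "(\<alpha> z u + \<D> (\<lambda>w. \<alpha> w u) z (0, snd z)) *\<^sub>R snd z = (2 * \<alpha> z u) *\<^sub>R snd z"
    by (simp add: scaleR_add_left)
  then show "\<D> (\<lambda>w. \<alpha> w u) z (0, snd z) = 1 *\<^sub>R \<alpha> z u"
    using slit[OF z] by (simp only: scaleR_cancel_right) simp
qed

text \<open>For a semi-basic form \<open>i\<^sub>J \<alpha> = 0\<close>, so only the fibre derivatives of the components of \<open>\<alpha>\<close> survive in
\<open>d\<^sub>J \<alpha>\<close>.\<close>

lemma fn_d1_iso_form:
  assumes z: "z \<in> D"
  shows "fn_d1 tangent_J \<alpha> z u v = \<D> (\<lambda>w. \<alpha> w v) z (0, fst u) - \<D> (\<lambda>w. \<alpha> w u) z (0, fst v)"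
proof -
  have "\<D> (\<lambda>w. \<alpha> w (0, a)) z x = \<D> (\<lambda>_. 0) z x" for a x
    by (rule fderiv_cong[OF open_domain z iso_form_vertical])
  then show ?thesis
    by (simp add: fn_d1_def contract2_def contract1_def ext_d1_def tangent_J_def)
qed

text \<open>The fibre derivative of \<open>\<alpha>(y) = R\<close> has two terms: one is \<open>\<alpha>\<close> itself, the other is equal to the
derivative of \<open>\<alpha>\<close> along \<open>\<C>\<close> by closedness, hence again \<open>\<alpha>\<close> by homogeneity.\<close>

lemma closed_imp_ricci_potential:
  assumes z: "z \<in> D" and closed: "\<And>u v. fn_d1 tangent_J \<alpha> z u v = 0"
  shows "\<D> \<rho> z (0, a) = 2 * \<alpha> z (a, b)"
proof -
  have sym: "\<D> (\<lambda>w. \<alpha> w (snd z, 0)) z (0, a) = \<D> (\<lambda>w. \<alpha> w (a, 0)) z (0, snd z)"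
    using closed[of "(a, 0)" "(snd z, 0)"] by (simp add: fn_d1_iso_form[OF z])
  have d: "((\<lambda>w::(real^2) \<times> (real^2). (snd w, 0::real^2)) has_derivative (\<lambda>v. (snd v, 0))) (at z)"
    by (auto intro!: derivative_eq_intros)
  have "\<D> \<rho> z (0, a) = \<D> (\<lambda>w. \<alpha> w (snd w, 0)) z (0, a)"
    by (rule fderiv_cong[OF open_domain z iso_form_position[symmetric]])
  also have "\<dots> = \<D> (\<lambda>w. \<alpha> w (snd z, 0)) z (0, a) + \<alpha> z (a, 0)"
    using fderiv_eqI[OF has_derivative_linear_family[OF open_domain z linear_iso_form
          smooth_on_differentiable[OF smooth_iso_form z] differentiableI[OF d]], of "(0, a)"]
    by (simp add: fderiv_eqI[OF d])
  also have "\<dots> = 2 * \<alpha> z (a, 0)"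
    unfolding sym using homogeneous_iso_form[of "(a, 0)"] z by (simp add: homogeneous_on_def)
  finally show ?thesis by (simp add: iso_form_horizontal[OF z, of a b])
qed

text \<open>If \<open>\<alpha> = 1/2 d\<^sub>J R\<close>, then \<open>d\<^sub>J \<alpha> = 0\<close> by the symmetry of the fibre Hessian of \<open>R\<close>.\<close>

lemma ricci_potential_imp_closed:
  assumes z: "z \<in> D" and pot: "\<And>w a. w \<in> D \<Longrightarrow> \<D> \<rho> w (0, a) = 2 * \<alpha> w (a, 0)"
  shows "fn_d1 tangent_J \<alpha> z u v = 0"
proof -
  have 1: "\<D> (\<lambda>w. \<alpha> w v) z x = \<D> (\<lambda>w. \<D> \<rho> w (0, fst v)) z x / 2" for v x
  proof -
    have "\<D> (\<lambda>w. \<alpha> w v) z x = \<D> (\<lambda>w. (1/2) *\<^sub>R \<D> \<rho> w (0, fst v)) z x"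
    proof (rule fderiv_cong[OF open_domain z])
      fix w assume w: "w \<in> D"
      show "\<alpha> w v = (1/2) *\<^sub>R \<D> \<rho> w (0, fst v)"
        using pot[OF w, of "fst v"] iso_form_horizontal[OF w, of "fst v" "snd v"] by simp
    qed
    also have "\<dots> = (1/2) *\<^sub>R \<D> (\<lambda>w. \<D> \<rho> w (0, fst v)) z x"
      by (rule fderiv_eqI) (intro has_derivative_scaleR_right fderiv_works
          smooth_on_differentiable[OF smooth_on_fderiv[OF smooth_ricci_scalar] z])
    finally show ?thesis by simp
  qed
  show ?thesis
    unfolding fn_d1_iso_form[OF z] 1
    using mixed_derivatives_commute[OF open_domain z smooth_ricci_scalar] by simp
qed

lemma fderiv_square:
  fixes f :: "(real^2) \<times> (real^2) \<Rightarrow> real"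
  assumes "smooth_on D f" "z \<in> D"
  shows "\<D> (\<lambda>w. (f w)\<^sup>2) z u = 2 * f z * \<D> f z u"
proof -
  have "((\<lambda>w. f w * f w) has_derivative (\<lambda>u. f z * \<D> f z u + \<D> f z u * f z)) (at z)"
    by (intro has_derivative_mult fderiv_works smooth_on_differentiable[OF assms])
  from fderiv_eqI[OF this] show ?thesis by (simp add: power2_eq_square)
qed

lemma smooth_square:
  "smooth_on D f \<Longrightarrow> smooth_on D (\<lambda>w. (f w :: real)\<^sup>2)"
  unfolding power2_eq_square by (rule smooth_on_mult[OF open_domain])

lemma homogeneous_square:
  fixes f :: "(real^2) \<times> (real^2) \<Rightarrow> real"
  assumes "smooth_on D f" "homogeneous_on D 1 f"
  shows "homogeneous_on D 2 (\<lambda>w. (f w)\<^sup>2)"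
  unfolding homogeneous_on_def
proof
  fix z assume z: "z \<in> D"
  have "\<D> f z (0, snd z) = f z" using assms(2) z by (simp add: homogeneous_on_def)
  then show "\<D> (\<lambda>w. (f w)\<^sup>2) z (0, snd z) = 2 *\<^sub>R (f z)\<^sup>2"
    unfolding fderiv_square[OF assms(1) z] by (simp add: power2_eq_square)
qed

text \<open>Subtracting the curvature formula from the isotropy equation leaves multiples of the identity whose
values are multiples of \<open>y\<close>. Both coefficients vanish, so \<open>R = \<kappa> f\<^sup>2\<close> and \<open>\<alpha> = \<kappa> f d\<^sub>J f\<close>, and the two
conditions become statements about \<open>f\<^sup>2\<close>.\<close>

lemma constant_curvature_necessary:
  fixes f :: "(real^2) \<times> (real^2) \<Rightarrow> real"
  assumes f: "smooth_on D f" "homogeneous_on D 1 f"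
    and el: "\<And>z u. z \<in> D \<Longrightarrow> ext_d1 (fn_d0 tangent_J (\<lambda>w. (f w)\<^sup>2)) z (S z) u = - ext_d0 (\<lambda>w. (f w)\<^sup>2) z u"
    and curv: "\<And>z u. z \<in> D \<Longrightarrow> jacobi S z u =
      \<kappa> *\<^sub>R ((f z)\<^sup>2 *\<^sub>R tangent_J z u - (f z * fn_d0 tangent_J f z u) *\<^sub>R liouville z)"
    and z: "z \<in> D"
  shows "fn_d1 tangent_J \<alpha> z u v = 0" and "fn_d0 (h_proj S) \<rho> z u = 0"
proof -
  have \<rho>\<alpha>: "\<rho> w = \<kappa> * (f w)\<^sup>2 \<and> \<alpha> w (a, 0) = \<kappa> * f w * \<D> f w (0, a)" if w: "w \<in> D" for w a
  proof -
    have eq: "(\<rho> w - \<kappa> * (f w)\<^sup>2) *\<^sub>R a = (\<alpha> w (a, 0) - \<kappa> * f w * \<D> f w (0, a)) *\<^sub>R snd w" for a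
    proof -
      have "\<rho> w *\<^sub>R a - \<alpha> w (a, 0) *\<^sub>R snd w = \<kappa> *\<^sub>R ((f w)\<^sup>2 *\<^sub>R a - (f w * \<D> f w (0, a)) *\<^sub>R snd w)"
        using trans[OF isotropic[OF w, symmetric] curv[OF w], of "(a, 0)"]
        by (simp add: tangent_J_def liouville_def fn_d0_def contract1_def ext_d0_def)
      then show ?thesis by (simp add: algebra_simps)
    qed
    have "\<rho> w - \<kappa> * (f w)\<^sup>2 = 0" by (rule multiples_of_one_vector[OF slit[OF w] eq])
    then show ?thesis using eq[of a] slit[OF w] by simp
  qed
  have d\<rho>: "\<D> \<rho> w x = \<kappa> * \<D> (\<lambda>w. (f w)\<^sup>2) w x" if w: "w \<in> D" for w x
  proof -
    have "\<D> \<rho> w x = \<D> (\<lambda>w. \<kappa> *\<^sub>R (f w)\<^sup>2) w x"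
      by (rule fderiv_cong[OF open_domain w]) (simp add: \<rho>\<alpha>)
    also have "\<dots> = \<kappa> *\<^sub>R \<D> (\<lambda>w. (f w)\<^sup>2) w x"
      by (rule fderiv_eqI) (intro has_derivative_scaleR_right fderiv_works
          smooth_on_differentiable[OF smooth_square[OF f(1)] w])
    finally show ?thesis by simp
  qed
  show "fn_d1 tangent_J \<alpha> z u v = 0"
    by (rule ricci_potential_imp_closed[OF z]) (simp add: \<rho>\<alpha> d\<rho> fderiv_square[OF f(1)])
  have "\<D> (\<lambda>w. (f w)\<^sup>2) z (h_proj S z u) = 0"
    by (rule euler_lagrange_imp_horizontal[OF z smooth_square[OF f(1)] homogeneous_square[OF f] el])
  then show "fn_d0 (h_proj S) \<rho> z u = 0"
    by (simp add: fn_d0_def contract1_def ext_d0_def d\<rho>[OF z])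
qed

text \<open>With \<open>\<kappa> = \<plusminus>1\<close> the function \<open>f\<^sup>2 = \<kappa> R\<close> is horizontal because \<open>R\<close> is, and \<open>d\<^sub>J R = 2 \<alpha>\<close> turns the isotropy
equation into the curvature formula.\<close>

lemma constant_curvature_sufficient:
  fixes f :: "(real^2) \<times> (real^2) \<Rightarrow> real"
  assumes f: "smooth_on D f" "\<And>z. z \<in> D \<Longrightarrow> (f z)\<^sup>2 = \<kappa> * \<rho> z" and \<kappa>: "\<kappa> * \<kappa> = 1"
    and closed: "\<And>z u v. z \<in> D \<Longrightarrow> fn_d1 tangent_J \<alpha> z u v = 0"
    and horizontal: "\<And>z u. z \<in> D \<Longrightarrow> fn_d0 (h_proj S) \<rho> z u = 0"
    and z: "z \<in> D"
  shows "ext_d1 (fn_d0 tangent_J (\<lambda>w. (f w)\<^sup>2)) z (S z) u = - ext_d0 (\<lambda>w. (f w)\<^sup>2) z u"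
    and "jacobi S z u =
      \<kappa> *\<^sub>R ((f z)\<^sup>2 *\<^sub>R tangent_J z u - (f z * fn_d0 tangent_J f z u) *\<^sub>R liouville z)"
proof -
  have dE: "\<D> (\<lambda>w. (f w)\<^sup>2) w x = \<kappa> * \<D> \<rho> w x" if w: "w \<in> D" for w x
  proof -
    have "\<D> (\<lambda>w. (f w)\<^sup>2) w x = \<D> (\<lambda>w. \<kappa> *\<^sub>R \<rho> w) w x"
      by (rule fderiv_cong[OF open_domain w]) (simp add: f(2))
    also have "\<dots> = \<kappa> *\<^sub>R \<D> \<rho> w x"
      by (rule fderiv_eqI) (intro has_derivative_scaleR_right fderiv_works
          smooth_on_differentiable[OF smooth_ricci_scalar w])
    finally show ?thesis by simp
  qed
  have E: "homogeneous_on D 2 (\<lambda>w. (f w)\<^sup>2)"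
    using homogeneous_ricci_scalar by (simp add: homogeneous_on_def dE f(2))
  show "ext_d1 (fn_d0 tangent_J (\<lambda>w. (f w)\<^sup>2)) z (S z) u = - ext_d0 (\<lambda>w. (f w)\<^sup>2) z u"
  proof (rule horizontal_imp_euler_lagrange[OF z smooth_square[OF f(1)] E])
    fix w v assume w: "w \<in> D"
    show "\<D> (\<lambda>w. (f w)\<^sup>2) w (h_proj S w v) = 0"
      using horizontal[OF w, of v] by (simp add: dE[OF w] fn_d0_def contract1_def ext_d0_def)
  qed
  have "2 * f z * \<D> f z (0, fst u) = \<kappa> * (2 * \<alpha> z u)"
    using closed_imp_ricci_potential[OF z closed[OF z], of "fst u" "snd u"]
    by (simp add: fderiv_square[OF f(1) z, symmetric] dE[OF z])
  then have "\<kappa> * (f z * \<D> f z (0, fst u)) = (\<kappa> * \<kappa>) * \<alpha> z u" by simp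
  moreover have "\<kappa> * (f z)\<^sup>2 = (\<kappa> * \<kappa>) * \<rho> z" using f(2)[OF z] by simp
  ultimately show "jacobi S z u =
      \<kappa> *\<^sub>R ((f z)\<^sup>2 *\<^sub>R tangent_J z u - (f z * fn_d0 tangent_J f z u) *\<^sub>R liouville z)"
    unfolding isotropic[OF z] \<kappa>
    by (simp add: scaleR_diff_right fn_d0_def contract1_def ext_d0_def tangent_J_def[of z u])
qed

end

section \<open>Nondegeneracy of the Hessian in the fibre\<close>

text \<open>If \<open>g b = 0\<close>, then the vertical vector \<open>(0, b)\<close> annihilates \<open>dd\<^sub>J R\<close>: on horizontal arguments by the
choice of \<open>b\<close>, on vertical ones because \<open>dd\<^sub>J R\<close> vanishes on pairs of vertical vectors. Full rank of
\<open>dd\<^sub>J R\<close> excludes this unless \<open>b = 0\<close>.\<close>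

lemma nondegenerate_metric:
  fixes E R F :: "(real^2) \<times> (real^2) \<Rightarrow> real"
  assumes D: "open D" "z \<in> D" and R: "smooth_on D R"
    and F: "\<And>w. w \<in> D \<Longrightarrow> (F w)\<^sup>2 = k * R w" "k \<noteq> 0"
    and rank: "form_rank (ext_d1 (fn_d0 tangent_J R) z) = 4"
  shows "rank (metric_matrix F z) = 2"
proof -
  let ?H = "\<lambda>u v. \<D> (\<lambda>w. \<D> R w v) z u"
  have sym: "?H u v = ?H v u" for u v by (rule mixed_derivatives_commute[OF D R])
  have dR: "R differentiable at w" if "w \<in> D" for w by (rule smooth_on_differentiable[OF R that])
  have dR': "(\<lambda>w. \<D> R w v) differentiable at z" for v
    by (rule smooth_on_differentiable[OF smooth_on_fderiv[OF R] D(2)])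
  have linH: "linear (\<lambda>u. ?H u v)" for v by (rule linear_fderiv[OF dR'])
  have B: "ext_d1 (fn_d0 tangent_J R) z u v = ?H u (0, fst v) - ?H v (0, fst u)" for u v
    by (simp add: ext_d1_def fn_d0_def contract1_def ext_d0_def tangent_J_def)
  define L where "L u = (\<Sum>b\<in>Basis. ext_d1 (fn_d0 tangent_J R) z u b *\<^sub>R b)" for u
  have linL: "linear L"
  proof (rule linearI)
    fix p q :: "(real^2) \<times> (real^2)" and r :: real
    let ?B = "\<lambda>u v. ext_d1 (fn_d0 tangent_J R) z u v"
    have "?B (p + q) v = ?B p v + ?B q v" for v
      using linear_add[OF linH, of v p q] linear_add[OF linH, of "(0, fst v)" p q]
        linear_add[OF linH[of v], of "(0, fst p)" "(0, fst q)"]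
      by (simp add: B sym[of v])
    then show "L (p + q) = L p + L q"
      by (simp add: L_def scaleR_add_left sum.distrib)
    have "?B (r *\<^sub>R p) v = r * ?B p v" for v
      using linear_scale[OF linH, of v r p] linear_scale[OF linH, of "(0, fst v)" r p]
        linear_scale[OF linH[of v], of r "(0, fst p)"]
      by (simp add: B sym[of v] right_diff_distrib)
    then show "L (r *\<^sub>R p) = r *\<^sub>R L p"
      by (simp add: L_def scaleR_sum_right)
  qed
  have "dim (range L) = DIM((real^2) \<times> (real^2))"
    using rank by (simp add: form_rank_def L_def)
  then have "span (range L) = UNIV" using dim_eq_full by blast
  then have "surj L" using linL by (simp add: span_eq_iff[THEN iffD2] linear_subspace_image)
  then have injL: "inj L" using linL by (simp add: linear_surj_imp_inj linear_surjective_imp_injective)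
  have entry: "metric_matrix F z $ i $ j = k / 2 * ?H (0, axis i 1) (0, axis j 1)" for i j
  proof -
    have "\<D> (\<lambda>w. (F w)\<^sup>2) w v = k *\<^sub>R \<D> R w v" if w: "w \<in> D" for w v
    proof -
      have "\<D> (\<lambda>w. (F w)\<^sup>2) w v = \<D> (\<lambda>w. k *\<^sub>R R w) w v"
        by (rule fderiv_cong[OF D(1) w]) (simp add: F(1))
      also have "\<dots> = k *\<^sub>R \<D> R w v"
        by (rule fderiv_eqI) (intro has_derivative_scaleR_right fderiv_works dR w)
      finally show ?thesis .
    qed
    then have "\<D> (\<lambda>w. \<D> (\<lambda>w. (F w)\<^sup>2) w v) z u = \<D> (\<lambda>w. k *\<^sub>R \<D> R w v) z u" for u v
      by (rule fderiv_cong[OF D])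
    also have "\<D> (\<lambda>w. k *\<^sub>R \<D> R w v) z u = k *\<^sub>R ?H u v" for u v
      by (rule fderiv_eqI) (intro has_derivative_scaleR_right fderiv_works dR')
    finally show ?thesis by (simp add: metric_matrix_def)
  qed
  have "inj ((*v) (metric_matrix F z))"
  proof (rule linear_injective_0[THEN iffD2, OF matrix_vector_mul_linear, rule_format])
    fix b assume b: "metric_matrix F z *v b = 0"
    have split: "?H x (0, b) = b $ 1 * ?H x (0, axis 1 1) + b $ 2 * ?H x (0, axis 2 1)" for x b
    proof -
      have "(0::real^2, b) = b $ 1 *\<^sub>R (0, axis 1 1) + b $ 2 *\<^sub>R (0, axis 2 1)"
        using vec2_expand[of b] by (simp add: prod_eq_iff)
      then have "?H (0, b) x = ?H (b $ 1 *\<^sub>R (0, axis 1 1)) x + ?H (b $ 2 *\<^sub>R (0, axis 2 1)) x"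
        using linear_add[OF linH[of x]] by metis
      then show ?thesis
        unfolding linear_scale[OF linH[of x]] by (simp add: sym[of _ x])
    qed
    have "?H (0, axis i 1) (0, b) = 0" for i
    proof -
      have "(metric_matrix F z *v b) $ i = k / 2 * ?H (0, axis i 1) (0, b)"
        unfolding split[of b] by (simp add: matrix_vector_mult_def sum_2 entry algebra_simps)
      then show ?thesis using b F(2) by simp
    qed
    then have H0: "?H (0, b) (0, c) = 0" for c
      unfolding split[of c] by (simp add: sym[of "(0, b)"])
    have Hz: "?H v (0, 0) = 0" for v
      using linear_0[OF linH[of v]] sym[of v "(0, 0)"] by (simp add: zero_prod_def)
    have "L (0, b) = 0" unfolding L_def B by (simp add: H0 Hz)
    then have "(0, b) = (0::(real^2) \<times> (real^2))"
      using injL linear_injective_0[OF linL] by blast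
    then show "b = 0" by (simp add: zero_prod_def)
  qed
  then show ?thesis using full_rank_injective[of "metric_matrix F z"] by simp
qed

section \<open>Invariance of the Ricci scalar and of the curvature form\<close>

text \<open>Naturality of \<open>\<Phi>\<close> carries one isotropy equation to the other. As the coefficients in that equation
are unique in the plane, they must be equal.\<close>

lemma planar_invariance:
  assumes "planar_spray D S" "planar_spray D' S'" "spray_transition D S D' S' W \<tau>"
    and w: "w \<in> W" and inj: "inj (\<D> \<tau> w)" and C: "liouville (\<tau> w) = \<D> \<tau> w (liouville w)"
  shows "ricci_scalar S' (\<tau> w) = ricci_scalar S w"
    and "iso_form S' (\<tau> w) (\<D> \<tau> w u) = iso_form S w u"
proof -
  interpret src: planar_spray D S by fact
  interpret tgt: planar_spray D' S' by fact
  interpret spray_transition D S D' S' W \<tau> by fact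
  have wD: "w \<in> D" "\<tau> w \<in> D'" using w overlap_subset transition_in by auto
  note l = linear_transition[OF w]
  define r where "r = ricci_scalar S' (\<tau> w) - ricci_scalar S w"
  define c where "c u = iso_form S' (\<tau> w) (\<D> \<tau> w u) - iso_form S w u" for u
  have eq: "r *\<^sub>R fst u = c u *\<^sub>R snd w" for u
  proof -
    have "\<D> \<tau> w (r *\<^sub>R tangent_J w u - c u *\<^sub>R liouville w) =
        jacobi S' (\<tau> w) (\<D> \<tau> w u) - \<D> \<tau> w (jacobi S w u)"
      unfolding src.isotropic[OF wD(1)] tgt.isotropic[OF wD(2)] C transition_J[OF w] r_def c_def
      by (simp add: linear_diff[OF l] linear_add[OF l] linear_scale[OF l] algebra_simps)
    then have "\<D> \<tau> w (r *\<^sub>R tangent_J w u - c u *\<^sub>R liouville w) = 0"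
      by (simp add: jacobi_natural[OF w])
    then have "r *\<^sub>R tangent_J w u - c u *\<^sub>R liouville w = 0"
      using inj linear_injective_0[OF l] by blast
    then show ?thesis by (simp add: tangent_J_def liouville_def zero_prod_def)
  qed
  note 0 = multiples_of_one_vector[OF src.slit[OF wD(1)]]
  have "r *\<^sub>R a = c (a, 0) *\<^sub>R snd w" for a using eq[of "(a, 0)"] by simp
  then have r: "r = 0" by (rule 0)
  then show "ricci_scalar S' (\<tau> w) = ricci_scalar S w" by (simp add: r_def)
  show "iso_form S' (\<tau> w) (\<D> \<tau> w u) = iso_form S w u"
    using eq[of u] r src.slit[OF wD(1)] by (simp add: c_def)
qed

section \<open>Charts of the tangent bundle\<close>

lemma chart_inv_in: "z \<in> chart_image c \<Longrightarrow> chart_inv c z \<in> fst c"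
  by (auto simp: chart_image_def chart_inv_def inv_into_into)

lemma chart_chart_inv: "z \<in> chart_image c \<Longrightarrow> snd c (chart_inv c z) = z"
  by (auto simp: chart_image_def chart_inv_def f_inv_into_f)

lemma chart_inv_chart: "inj_on (snd c) (fst c) \<Longrightarrow> p \<in> fst c \<Longrightarrow> chart_inv c (snd c p) = p"
  by (simp add: chart_inv_def inv_into_f_f)

lemma chart_in_image: "p \<in> fst c \<Longrightarrow> snd c p \<in> chart_image c"
  by (simp add: chart_image_def)

locale atlas =
  fixes A :: "('a, 'e::euclidean_space) chart set"
  assumes smooth_atlas: "smooth_atlas A"
begin

abbreviation overlap where "overlap c c' \<equiv> snd c ` (fst c \<inter> fst c')"
abbreviation jac where "jac c c' p \<equiv> \<D> (transition c c') (snd c p)"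
abbreviation TC where "TC \<equiv> tangent_chart A"
abbreviation SC where "SC \<equiv> slit_chart A"

lemma inj_chart: "c \<in> A \<Longrightarrow> inj_on (snd c) (fst c)"
  and open_chart_image: "c \<in> A \<Longrightarrow> open (chart_image c)"
  and open_chart_overlap: "c \<in> A \<Longrightarrow> c' \<in> A \<Longrightarrow> open (overlap c c')"
  and smooth_chart_transition: "c \<in> A \<Longrightarrow> c' \<in> A \<Longrightarrow> smooth_on (overlap c c') (transition c c')"
  using smooth_atlas by (auto simp: smooth_atlas_def)

lemma transition_chart: "c \<in> A \<Longrightarrow> p \<in> fst c \<Longrightarrow> transition c c' (snd c p) = snd c' p"
  by (simp add: transition_def chart_inv_chart inj_chart)

lemma differentiable_transition:
  assumes "c \<in> A" "c' \<in> A" "p \<in> fst c \<inter> fst c'"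
  shows "transition c c' differentiable at (snd c p)"
  by (rule smooth_on_differentiable[OF smooth_chart_transition[OF assms(1,2)]]) (use assms(3) in blast)

lemma linear_jac: "c \<in> A \<Longrightarrow> c' \<in> A \<Longrightarrow> p \<in> fst c \<inter> fst c' \<Longrightarrow> linear (jac c c' p)"
  by (rule linear_fderiv[OF differentiable_transition])

lemma jac_compose:
  assumes c: "c \<in> A" "c' \<in> A" "c'' \<in> A" and p: "p \<in> fst c" "p \<in> fst c'" "p \<in> fst c''"
  shows "jac c c'' p v = jac c' c'' p (jac c c' p v)"
proof -
  have o: "open (overlap c c' \<inter> overlap c c'')" using c by (intro open_Int open_chart_overlap)
  have x: "snd c p \<in> overlap c c' \<inter> overlap c c''" using p by blast
  have "jac c c'' p v = \<D> (\<lambda>x. transition c' c'' (transition c c' x)) (snd c p) v"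
  proof (rule fderiv_cong[OF o x])
    fix x assume "x \<in> overlap c c' \<inter> overlap c c''"
    then obtain q q' where q: "q \<in> fst c \<inter> fst c'" "x = snd c q" "q' \<in> fst c \<inter> fst c''" "x = snd c q'" by blast
    then have "q' = q" using inj_chart[OF c(1)] by (metis IntD1 inj_onD)
    then show "transition c c'' x = transition c' c'' (transition c c' x)"
      using q c by (simp add: transition_chart)
  qed
  also have "\<dots> = \<D> (transition c' c'') (transition c c' (snd c p)) (jac c c' p v)"
  proof (rule fderiv_compose)
    show "transition c c' differentiable at (snd c p)"
      using differentiable_transition[OF c(1,2)] p by blast
    show "transition c' c'' differentiable at (transition c c' (snd c p))"
      using differentiable_transition[OF c(2,3)] p by (simp add: transition_chart c)
  qed
  finally show ?thesis using transition_chart[OF c(1) p(1)] by simp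
qed

lemma jac_self:
  assumes "c \<in> A" "p \<in> fst c" shows "jac c c p v = v"
proof -
  have "jac c c p v = \<D> (\<lambda>x. x) (snd c p) v"
    by (rule fderiv_cong[OF open_chart_image[OF assms(1)] chart_in_image[OF assms(2)]])
      (simp add: transition_def chart_chart_inv)
  then show ?thesis by simp
qed

lemma jac_inverse:
  "c \<in> A \<Longrightarrow> c' \<in> A \<Longrightarrow> p \<in> fst c \<Longrightarrow> p \<in> fst c' \<Longrightarrow> jac c' c p (jac c c' p v) = v"
  using jac_compose[of c c' c p v] jac_self by simp

text \<open>The tangent vector at \<open>p\<close> whose component in the chart \<open>c\<close> is \<open>y\<close>; the value \<open>0\<close> in the remaining charts is
the normalization in \<open>tangent_vector\<close>.\<close>

definition vec_of :: "('a, 'e) chart \<Rightarrow> 'a \<Rightarrow> 'e \<Rightarrow> ('a, 'e) tvec" where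
  "vec_of c p y c' = (if c' \<in> A \<and> p \<in> fst c' then jac c c' p y else 0)"

lemma vec_of_same: "c \<in> A \<Longrightarrow> p \<in> fst c \<Longrightarrow> vec_of c p y c = y"
  by (simp add: vec_of_def jac_self)

text \<open>Compatibility between two further charts is the cocycle condition \<open>jac_compose\<close> for the Jacobians.\<close>

lemma tangent_vec_of:
  assumes "c \<in> A" "p \<in> fst c" shows "tangent_vector A p (vec_of c p y)"
  unfolding tangent_vector_def
proof (intro conjI allI impI ballI)
  show "p \<in> carrier_of A" using assms by (auto simp: carrier_of_def)
  show "vec_of c p y c' = 0" if "c' \<notin> A \<or> p \<notin> fst c'" for c'
    using that by (auto simp: vec_of_def)
  fix c' c'' assume "c' \<in> A" "c'' \<in> A" "p \<in> fst c' \<inter> fst c''"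
  then show "vec_of c p y c'' = jac c' c'' p (vec_of c p y c')"
    using jac_compose[OF assms(1), of c' c'' p y] assms(2) by (simp add: vec_of_def)
qed

lemma tangent_vector_eq_vec_of:
  assumes "c \<in> A" "p \<in> fst c" "tangent_vector A p v" shows "v = vec_of c p (v c)"
proof
  fix c'
  have "v c' = jac c c' p (v c)" if "c' \<in> A" "p \<in> fst c'"
    using assms(3) that assms(1,2) unfolding tangent_vector_def by blast
  moreover have "v c' = 0" if "c' \<notin> A \<or> p \<notin> fst c'"
    using assms(3) that unfolding tangent_vector_def by blast
  ultimately show "v c' = vec_of c p (v c) c'" by (simp add: vec_of_def)
qed

lemma tangent_vector_zero_iff:
  assumes "c \<in> A" "p \<in> fst c" "tangent_vector A p v" shows "v = (\<lambda>_. 0) \<longleftrightarrow> v c = 0"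
proof
  assume "v c = 0"
  then have "v c' = vec_of c p 0 c'" for c' using tangent_vector_eq_vec_of[OF assms] by simp
  moreover have "vec_of c p 0 c' = 0" for c'
    using linear_0[OF linear_jac[of c c' p]] assms(1,2) by (simp add: vec_of_def)
  ultimately have "v c' = 0" for c' by simp
  then show "v = (\<lambda>_. 0)" by blast
qed auto

lemma tangent_vector_scale:
  assumes "tangent_vector A p v" shows "tangent_vector A p (\<lambda>c. r *\<^sub>R v c)"
  unfolding tangent_vector_def
proof (intro conjI allI impI ballI)
  show "p \<in> carrier_of A" "\<And>c. c \<notin> A \<or> p \<notin> fst c \<Longrightarrow> r *\<^sub>R v c = 0"
    using assms by (auto simp: tangent_vector_def)
  fix c c' assume c: "c \<in> A" "c' \<in> A" "p \<in> fst c \<inter> fst c'"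
  then have "v c' = jac c c' p (v c)" using assms unfolding tangent_vector_def by blast
  then show "r *\<^sub>R v c' = jac c c' p (r *\<^sub>R v c)"
    by (simp only: linear_scale[OF linear_jac[OF c]])
qed

lemma in_tangent_chart: "(p, v) \<in> fst (TC c) \<longleftrightarrow> p \<in> fst c \<and> tangent_vector A p v"
  and tangent_chart_apply: "snd (TC c) (p, v) = (snd c p, v c)"
  and in_slit_chart: "(p, v) \<in> fst (SC c) \<longleftrightarrow> p \<in> fst c \<and> tangent_vector A p v \<and> v \<noteq> (\<lambda>_. 0)"
  and slit_chart_apply: "snd (SC c) (p, v) = (snd c p, v c)"
  by (auto simp: tangent_chart_def slit_chart_def)

lemma inj_tangent_chart: assumes "c \<in> A" shows "inj_on (snd (TC c)) (fst (TC c))"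
proof (rule inj_onI, clarify)
  fix p v p' v' assume "(p, v) \<in> fst (TC c)" "(p', v') \<in> fst (TC c)"
    and "snd (TC c) (p, v) = snd (TC c) (p', v')"
  then have pv: "p \<in> fst c" "tangent_vector A p v" "p' \<in> fst c" "tangent_vector A p' v'"
    "snd c p = snd c p'" "v c = v' c" by (auto simp: in_tangent_chart tangent_chart_apply)
  then have "p = p'" using inj_chart[OF assms] by (metis inj_onD)
  then show "p = p' \<and> v = v'"
    using pv tangent_vector_eq_vec_of[OF assms, of p v] tangent_vector_eq_vec_of[OF assms, of p v'] by simp
qed

lemma slit_subset_tangent: "fst (SC c) \<subseteq> fst (TC c)" and snd_slit_chart: "snd (SC c) = snd (TC c)"
  by (auto simp: tangent_chart_def slit_chart_def)

lemma inj_slit_chart: "c \<in> A \<Longrightarrow> inj_on (snd (SC c)) (fst (SC c))"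
  unfolding snd_slit_chart by (rule inj_on_subset[OF inj_tangent_chart slit_subset_tangent])

lemma tangent_chart_image: assumes "c \<in> A" shows "chart_image (TC c) = chart_image c \<times> UNIV"
proof -
  have "(snd c p, y) \<in> chart_image (TC c)" if "p \<in> fst c" for p y
    using chart_in_image[of "(p, vec_of c p y)" "TC c"] that tangent_vec_of[OF assms that]
    by (simp add: in_tangent_chart tangent_chart_apply vec_of_same[OF assms that])
  then show ?thesis by (auto simp: chart_image_def tangent_chart_apply in_tangent_chart)
qed

lemma overlap_tangent:
  assumes "c \<in> A" "c' \<in> A"
  shows "snd (TC c) ` (fst (TC c) \<inter> fst (TC c')) = overlap c c' \<times> UNIV"
proof -
  have "(snd c p, y) \<in> snd (TC c) ` (fst (TC c) \<inter> fst (TC c'))" if "p \<in> fst c \<inter> fst c'" for p y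
    using image_eqI[of "(snd c p, y)" "snd (TC c)" "(p, vec_of c p y)"] that tangent_vec_of[OF assms(1)]
    by (simp add: in_tangent_chart tangent_chart_apply vec_of_same[OF assms(1)])
  then show ?thesis by (auto simp: tangent_chart_apply in_tangent_chart)
qed

lemma slit_chart_image: assumes "c \<in> A" shows "chart_image (SC c) = chart_image c \<times> (- {0})"
proof -
  have "(snd c p, y) \<in> chart_image (SC c)" if "p \<in> fst c" "y \<noteq> 0" for p y
    using chart_in_image[of "(p, vec_of c p y)" "SC c"] that tangent_vec_of[OF assms that(1)]
      tangent_vector_zero_iff[OF assms that(1) tangent_vec_of[OF assms that(1)], of y]
    by (simp add: in_slit_chart slit_chart_apply vec_of_same[OF assms that(1)])
  then show ?thesis
    by (auto simp: chart_image_def slit_chart_apply in_slit_chart tangent_vector_zero_iff[OF assms])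
qed

lemma overlap_slit:
  assumes "c \<in> A" "c' \<in> A"
  shows "snd (SC c) ` (fst (SC c) \<inter> fst (SC c')) = overlap c c' \<times> (- {0})"
proof -
  have "(snd c p, y) \<in> snd (SC c) ` (fst (SC c) \<inter> fst (SC c'))" if p: "p \<in> fst c \<inter> fst c'" and y: "y \<noteq> 0" for p y
  proof -
    have pc: "p \<in> fst c" using p by blast
    show ?thesis
      using image_eqI[of "(snd c p, y)" "snd (SC c)" "(p, vec_of c p y)"] p y tangent_vec_of[OF assms(1) pc]
        tangent_vector_zero_iff[OF assms(1) pc tangent_vec_of[OF assms(1) pc], of y]
      by (simp add: in_slit_chart slit_chart_apply vec_of_same[OF assms(1)])
  qed
  then show ?thesis
    by (auto simp: slit_chart_apply in_slit_chart tangent_vector_zero_iff[OF assms(1)])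
qed

lemma transition_tangent:
  assumes c: "c \<in> A" "c' \<in> A" and z: "z \<in> overlap c c' \<times> UNIV"
  shows "transition (TC c) (TC c') z = (transition c c' (fst z), \<D> (transition c c') (fst z) (snd z))"
proof -
  obtain p where p: "p \<in> fst c \<inter> fst c'" "fst z = snd c p" using z by auto
  define v where "v = vec_of c p (snd z)"
  have tv: "tangent_vector A p v" unfolding v_def by (rule tangent_vec_of) (use c p in auto)
  have vz: "snd (TC c) (p, v) = z" using c p by (simp add: tangent_chart_apply v_def vec_of_same prod_eq_iff)
  have "chart_inv (TC c) z = (p, v)"
    using chart_inv_chart[OF inj_tangent_chart[OF c(1)], of "(p, v)"] vz tv p by (simp add: in_tangent_chart)
  then show ?thesis
    using c p by (simp add: transition_def[of "TC c"] tangent_chart_apply v_def vec_of_def transition_chart)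
qed

lemma transition_slit:
  assumes c: "c \<in> A" "c' \<in> A" and z: "z \<in> overlap c c' \<times> (- {0})"
  shows "transition (SC c) (SC c') z = (transition c c' (fst z), \<D> (transition c c') (fst z) (snd z))"
proof -
  obtain q where q: "q \<in> fst (SC c)" "z = snd (SC c) q"
    using z overlap_slit[OF c] by blast
  have "chart_inv (SC c) z = chart_inv (TC c) z"
    using chart_inv_chart[OF inj_slit_chart[OF c(1)] q(1)] chart_inv_chart[OF inj_tangent_chart[OF c(1)], of q]
      q subsetD[OF slit_subset_tangent q(1)] by (simp add: snd_slit_chart)
  then have "transition (SC c) (SC c') z = transition (TC c) (TC c') z"
    by (simp add: transition_def snd_slit_chart)
  then show ?thesis using transition_tangent[OF c] z by auto
qed

lemma smooth_tangent_map:
  assumes c: "c \<in> A" "c' \<in> A"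
  shows "smooth_on (overlap c c' \<times> UNIV) (\<lambda>z::'e \<times> 'e. (transition c c' (fst z), \<D> (transition c c') (fst z) (snd z)))"
proof -
  let ?V = "overlap c c'" and ?\<phi> = "transition c c'"
  have eq: "?V \<times> UNIV = fst -` ?V" by auto
  have o: "open (?V \<times> (UNIV :: 'e set))" by (intro open_Times open_chart_overlap c open_UNIV)
  have pre: "smooth_on (?V \<times> UNIV) (\<lambda>z::'e \<times> 'e. f (fst z))" if "smooth_on ?V f" for f :: "'e \<Rightarrow> 'e"
    unfolding eq by (rule smooth_on_linear_precompose[OF bounded_linear_fst open_chart_overlap[OF c] that])
  have "smooth_on (?V \<times> UNIV) (\<lambda>z::'e \<times> 'e. (?\<phi> (fst z), \<Sum>b\<in>Basis. (snd z \<bullet> b) *\<^sub>R \<D> ?\<phi> (fst z) b))"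
    by (intro smooth_on_Pair o pre smooth_chart_transition c smooth_on_sum smooth_on_scaleR smooth_on_inner
        smooth_on_const smooth_on_fderiv smooth_on_bounded_linear[OF o bounded_linear_snd smooth_on_id])
  moreover have "(?\<phi> (fst z), \<Sum>b\<in>Basis. (snd z \<bullet> b) *\<^sub>R \<D> ?\<phi> (fst z) b) = (?\<phi> (fst z), \<D> ?\<phi> (fst z) (snd z))"
    if "z \<in> ?V \<times> UNIV" for z
    using fderiv_basis[OF smooth_on_differentiable[OF smooth_chart_transition[OF c]], of "fst z" "snd z"] that by auto
  ultimately show ?thesis by (rule iffD1[OF smooth_on_cong[OF o], rotated])
qed

lemma smooth_atlas_tangent: "smooth_atlas (tangent_atlas A)"
proof -
  have o: "open (overlap c c' \<times> (UNIV :: 'e set))" if "c \<in> A" "c' \<in> A" for c c'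
    using that by (intro open_Times open_chart_overlap open_UNIV)
  have "open (chart_image (TC c))" if "c \<in> A" for c
    unfolding tangent_chart_image[OF that] using that by (intro open_Times open_chart_image open_UNIV)
  moreover have "open (snd (TC c) ` (fst (TC c) \<inter> fst (TC c')))" if "c \<in> A" "c' \<in> A" for c c'
    using o[OF that] by (simp only: overlap_tangent[OF that])
  moreover have "smooth_on (snd (TC c) ` (fst (TC c) \<inter> fst (TC c'))) (transition (TC c) (TC c'))"
    if "c \<in> A" "c' \<in> A" for c c'
    unfolding overlap_tangent[OF that]
    by (rule iffD2[OF smooth_on_cong[OF o[OF that] transition_tangent[OF that]] smooth_tangent_map[OF that]])
  ultimately show ?thesis
    by (auto simp: smooth_atlas_def tangent_atlas_def inj_tangent_chart)
qed

text \<open>The derivative is block triangular, and both diagonal blocks are the Jacobian of the base transition. This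
gives compatibility with \<open>J\<close> and \<open>\<C>\<close>, and injectivity.\<close>

lemma fderiv_transition_slit:
  assumes c: "c \<in> A" "c' \<in> A" and z: "z \<in> overlap c c' \<times> (- {0})"
  shows "\<D> (transition (SC c) (SC c')) z (a, b) = (\<D> (transition c c') (fst z) a,
     \<D> (\<lambda>x. \<D> (transition c c') x (snd z)) (fst z) a + \<D> (transition c c') (fst z) b)"
proof -
  let ?V = "overlap c c'" and ?\<phi> = "transition c c'"
  have V: "open ?V" "fst z \<in> ?V" using open_chart_overlap[OF c] z by auto
  have o: "open (?V \<times> (- {0} :: 'e set))" by (intro open_Times V(1)) auto
  have o': "open (?V \<times> (UNIV :: 'e set))" by (intro open_Times V(1)) auto
  note sm = smooth_chart_transition[OF c]
  have pre: "(f has_derivative f') (at (fst z)) \<Longrightarrow> ((\<lambda>w. f (fst w)) has_derivative (\<lambda>u. f' (fst u))) (at z)"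
    for f f' :: "'e \<Rightarrow> 'e"
    by (rule has_derivative_compose[OF has_derivative_fst[OF has_derivative_ident]])
  have d1: "((\<lambda>w. ?\<phi> (fst w)) has_derivative (\<lambda>u. \<D> ?\<phi> (fst z) (fst u))) (at z)"
    by (rule pre[OF fderiv_works[OF smooth_on_differentiable[OF sm V(2)]]])
  have d2: "((\<lambda>w. \<D> ?\<phi> (fst w) y) has_derivative (\<lambda>u. \<D> (\<lambda>x. \<D> ?\<phi> x y) (fst z) (fst u))) (at z)" for y
    by (rule pre[OF fderiv_works[OF smooth_on_differentiable[OF smooth_on_fderiv[OF sm] V(2)]]])
  have d3: "(snd has_derivative snd) (at z)"
    by (rule bounded_linear_imp_has_derivative[OF bounded_linear_snd])
  have "((\<lambda>w. \<D> ?\<phi> (fst w) (snd w)) has_derivative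
      (\<lambda>u. \<D> (\<lambda>w. \<D> ?\<phi> (fst w) (snd z)) z u + \<D> ?\<phi> (fst z) (\<D> snd z u))) (at z)"
  proof (rule has_derivative_linear_family[OF o'])
    show "z \<in> ?V \<times> UNIV" using z by auto
    show "linear (\<D> ?\<phi> (fst w))" if "w \<in> ?V \<times> UNIV" for w
      by (rule linear_fderiv[OF smooth_on_differentiable[OF sm]]) (use that in auto)
  qed (rule differentiableI[OF d2] differentiableI[OF d3])+
  then have "((\<lambda>w. \<D> ?\<phi> (fst w) (snd w)) has_derivative
      (\<lambda>u. \<D> (\<lambda>x. \<D> ?\<phi> x (snd z)) (fst z) (fst u) + \<D> ?\<phi> (fst z) (snd u))) (at z)"
    unfolding fderiv_eqI[OF d2] fderiv_eqI[OF d3] .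
  from fderiv_eqI[OF has_derivative_Pair[OF d1 this], of "(a, b)"]
  have "\<D> (\<lambda>w. (?\<phi> (fst w), \<D> ?\<phi> (fst w) (snd w))) z (a, b) = (\<D> ?\<phi> (fst z) a,
     \<D> (\<lambda>x. \<D> ?\<phi> x (snd z)) (fst z) a + \<D> ?\<phi> (fst z) b)" by simp
  moreover have "\<D> (transition (SC c) (SC c')) z (a, b) =
      \<D> (\<lambda>w. (?\<phi> (fst w), \<D> ?\<phi> (fst w) (snd w))) z (a, b)"
    by (rule fderiv_cong[OF o z transition_slit[OF c]])
  ultimately show ?thesis by simp
qed

end

section \<open>The curvature form on the slit tangent bundle\<close>

locale planar_spray_manifold = atlas A
  for A :: "('a, real^2) chart set" +
  fixes S :: "('a, real^2) tpoint \<Rightarrow> (('a, real^2) tpoint, (real^2) \<times> (real^2)) tvec"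
  assumes spray: "spray A S"
begin

abbreviation "Sc c \<equiv> vf_coords c S"

lemma slit_atlasE: assumes "c \<in> slit_atlas A" obtains c0 where "c0 \<in> A" "c = SC c0"
  using assms by (auto simp: slit_atlas_def)

lemma inj_slit: "c \<in> slit_atlas A \<Longrightarrow> inj_on (snd c) (fst c)"
  by (auto elim: slit_atlasE inj_slit_chart)

lemma local_planar_spray:
  assumes "c \<in> slit_atlas A" shows "planar_spray (chart_image c) (Sc c)"
proof -
  obtain c0 where c0: "c0 \<in> A" "c = SC c0" by (rule slit_atlasE[OF assms])
  show ?thesis
  proof
    show "open (chart_image c)"
      unfolding c0(2) slit_chart_image[OF c0(1)] by (intro open_Times open_chart_image c0) auto
    show "snd z \<noteq> 0" if "z \<in> chart_image c" for z
      using that unfolding c0(2) slit_chart_image[OF c0(1)] by auto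
    have "smooth_on (chart_image c) (\<lambda>z. S (chart_inv c z) c)"
      using spray assms by (simp add: spray_def smooth_vector_field_def)
    then show "smooth_on (chart_image c) (Sc c)" by (simp add: vf_coords_def[abs_def])
  qed (use spray assms in \<open>simp_all add: spray_def\<close>)
qed

lemma local_transition:
  assumes c: "c \<in> slit_atlas A" "c' \<in> slit_atlas A"
  shows "spray_transition (chart_image c) (Sc c) (chart_image c') (Sc c')
    (snd c ` (fst c \<inter> fst c')) (transition c c')"
proof -
  obtain d where d: "d \<in> A" "c = SC d" by (rule slit_atlasE[OF c(1)])
  obtain d' where d': "d' \<in> A" "c' = SC d'" by (rule slit_atlasE[OF c(2)])
  interpret src: planar_spray "chart_image c" "Sc c" by (rule local_planar_spray[OF c(1)])
  interpret tgt: planar_spray "chart_image c'" "Sc c'" by (rule local_planar_spray[OF c(2)])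
  have ov: "snd c ` (fst c \<inter> fst c') = overlap d d' \<times> (- {0})"
    unfolding d(2) d'(2) by (rule overlap_slit[OF d(1) d'(1)])
  have o: "open (overlap d d' \<times> (- {0} :: (real^2) set))"
    by (intro open_Times open_chart_overlap d(1) d'(1)) auto
  show ?thesis
  proof
    show "open (snd c ` (fst c \<inter> fst c'))" unfolding ov by (rule o)
    show "snd c ` (fst c \<inter> fst c') \<subseteq> chart_image c" by (auto simp: chart_image_def)
    show "smooth_on (snd c ` (fst c \<inter> fst c')) (transition c c')"
      unfolding ov arg_cong2[OF d(2) d'(2), of transition]
      by (rule iffD2[OF smooth_on_cong[OF o transition_slit[OF d(1) d'(1)]]
            smooth_on_subset[OF smooth_tangent_map[OF d(1) d'(1)]]]) auto
    fix w assume w: "w \<in> snd c ` (fst c \<inter> fst c')"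
    then obtain q where q: "q \<in> fst c" "q \<in> fst c'" "w = snd c q" by auto
    have inv: "chart_inv c w = q" using q chart_inv_chart[OF inj_slit[OF c(1)]] by simp
    then have \<tau>: "transition c c' w = snd c' q" by (simp add: transition_def)
    then show "transition c c' w \<in> chart_image c'" using q chart_in_image by metis
    have w': "w \<in> overlap d d' \<times> (- {0})" using w ov by simp
    have l: "linear (\<D> (transition d d') (fst w))"
      by (rule linear_fderiv[OF smooth_on_differentiable[OF smooth_chart_transition[OF d(1) d'(1)]]]) (use w' in auto)
    show "tangent_J (transition c c' w) (\<D> (transition c c') w u) = \<D> (transition c c') w (tangent_J w u)" for u
      using fderiv_transition_slit[OF d(1) d'(1) w', of "fst u" "snd u"]
        fderiv_transition_slit[OF d(1) d'(1) w', of 0 "fst u"] linear_0[OF l]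
        linear_0[OF linear_fderiv[OF smooth_on_differentiable[OF smooth_on_fderiv[OF
              smooth_chart_transition[OF d(1) d'(1)]]]], of "fst w" "snd w"] w'
      by (auto simp: tangent_J_def d(2) d'(2))
    have "tangent_vector (slit_atlas A) q (S q)"
      using spray q c by (auto simp: spray_def smooth_vector_field_def carrier_of_def)
    then have "S q c' = \<D> (transition c c') (snd c q) (S q c)"
      using q c unfolding tangent_vector_def by blast
    then show "Sc c' (transition c c' w) = \<D> (transition c c') w (Sc c w)"
      using chart_inv_chart[OF inj_slit[OF c(2)] q(2)] by (simp add: vf_coords_def \<tau> inv q(3)[symmetric])
  qed
qed

lemma coordinate_invariance:
  assumes c: "c \<in> slit_atlas A" "c' \<in> slit_atlas A" and q: "q \<in> fst c" "q \<in> fst c'"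
  shows "ricci_scalar (Sc c') (snd c' q) = ricci_scalar (Sc c) (snd c q)"
    and "iso_form (Sc c) (snd c q) u = iso_form (Sc c') (snd c' q) (\<D> (transition c c') (snd c q) u)"
proof -
  obtain d where d: "d \<in> A" "c = SC d" by (rule slit_atlasE[OF c(1)])
  obtain d' where d': "d' \<in> A" "c' = SC d'" by (rule slit_atlasE[OF c(2)])
  let ?w = "snd c q"
  have w: "?w \<in> snd c ` (fst c \<inter> fst c')" using q by blast
  then have w': "?w \<in> overlap d d' \<times> (- {0})"
    unfolding d(2) d'(2) overlap_slit[OF d(1) d'(1)] .
  then have "fst ?w \<in> overlap d d'" by auto
  then obtain p where p: "p \<in> fst d" "p \<in> fst d'" "fst ?w = snd d p" by blast
  interpret spray_transition "chart_image c" "Sc c" "chart_image c'" "Sc c'"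
    "snd c ` (fst c \<inter> fst c')" "transition c c'" by (rule local_transition[OF c])
  have l: "linear (jac d d' p)" using linear_jac d d' p by blast
  have l2: "linear (\<D> (\<lambda>x. \<D> (transition d d') x (snd ?w)) (fst ?w))"
    by (rule linear_fderiv[OF smooth_on_differentiable[OF smooth_on_fderiv[OF
              smooth_chart_transition[OF d(1) d'(1)]]]]) (use w' in auto)
  note D = fderiv_transition_slit[OF d(1) d'(1) w', folded d(2) d'(2), unfolded p(3)]
  have injp: "a = 0" if "jac d d' p a = 0" for a
    using jac_inverse[OF d(1) d'(1) p(1,2), of a] that linear_0[OF linear_jac[OF d'(1) d(1)]] p by auto
  have inj: "inj (\<D> (transition c c') ?w)"
  proof (rule linear_injective_0[THEN iffD2, OF linear_transition[OF w], rule_format])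
    fix u assume u: "\<D> (transition c c') ?w u = 0"
    obtain a b where ab: "u = (a, b)" by (cases u)
    have "a = 0" using u injp unfolding ab D by (simp add: zero_prod_def)
    then have "b = 0" using u injp linear_0[OF l2] unfolding ab D by (simp add: zero_prod_def p(3))
    then show "u = 0" using \<open>a = 0\<close> by (simp add: ab zero_prod_def)
  qed
  have \<tau>: "transition c c' ?w = snd c' q"
    using chart_inv_chart[OF inj_slit[OF c(1)] q(1)] by (simp add: transition_def)
  have C: "liouville (transition c c' ?w) = \<D> (transition c c') ?w (liouville ?w)"
    using D[of 0 "snd ?w"] linear_0[OF l] linear_0[OF l2] transition_slit[OF d(1) d'(1) w', folded d(2) d'(2)]
    by (simp add: liouville_def p(3))
  note inv = planar_invariance[OF local_planar_spray[OF c(1)] local_planar_spray[OF c(2)] local_transition[OF c] w inj C]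
  show "ricci_scalar (Sc c') (snd c' q) = ricci_scalar (Sc c) (snd c q)" using inv(1) by (simp add: \<tau>)
  show "iso_form (Sc c) (snd c q) u = iso_form (Sc c') (snd c' q) (\<D> (transition c c') (snd c q) u)"
    using inv(2) by (simp add: \<tau>)
qed

definition curvature_one_form :: "('a, real^2) tpoint \<Rightarrow> (('a, real^2) tpoint, (real^2) \<times> (real^2)) chart \<Rightarrow>
    (real^2) \<times> (real^2) \<Rightarrow> real" where
  "curvature_one_form q c u = iso_form (Sc c) (snd c q) u"

lemma form_coords_curvature:
  "z \<in> chart_image c \<Longrightarrow> form_coords c curvature_one_form z = iso_form (Sc c) z"
  by (simp add: form_coords_def curvature_one_form_def chart_chart_inv fun_eq_iff)

lemma semi_basic_curvature: "semi_basic A curvature_one_form"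
  unfolding semi_basic_def smooth_one_form_def
proof (intro conjI ballI allI)
  fix c assume c: "c \<in> slit_atlas A"
  interpret planar_spray "chart_image c" "Sc c" by (rule local_planar_spray[OF c])
  show "linear (curvature_one_form p c)" if "p \<in> fst c" for p
    using linear_iso_form[OF chart_in_image[OF that]] by (simp add: curvature_one_form_def[abs_def])
  show "curvature_one_form p c u = curvature_one_form p c' (\<D> (transition c c') (snd c p) u)"
    if "c' \<in> slit_atlas A" "p \<in> fst c \<inter> fst c'" for c' p u
    unfolding curvature_one_form_def using that by (intro coordinate_invariance(2) c) auto
  show "smooth_on (chart_image c) (\<lambda>z. curvature_one_form (chart_inv c z) c u)" for u
    by (rule iffD2[OF smooth_on_cong[OF open_domain] smooth_iso_form[of u]])
      (simp add: curvature_one_form_def chart_chart_inv)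
  show "form_coords c curvature_one_form z (0, b) = 0" if "z \<in> chart_image c" for z b
    using that by (simp add: form_coords_curvature iso_form_vertical)
qed

lemma isotropic_with_curvature: "isotropic_with A S curvature_one_form"
  unfolding isotropic_with_def
proof (intro ballI allI)
  fix c z u assume c: "c \<in> slit_atlas A" and z: "z \<in> chart_image c"
  interpret planar_spray "chart_image c" "Sc c" by (rule local_planar_spray[OF c])
  show "jacobi (Sc c) z u = ricci_scalar (Sc c) z *\<^sub>R tangent_J z u
      - form_coords c curvature_one_form z u *\<^sub>R liouville z"
    unfolding form_coords_curvature[OF z] by (rule isotropic[OF z])
qed

lemma fn_d1_curvature:
  assumes c: "c \<in> slit_atlas A" and z: "z \<in> chart_image c"
  shows "fn_d1 tangent_J (form_coords c curvature_one_form) z u w = fn_d1 tangent_J (iso_form (Sc c)) z u w"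
proof -
  interpret planar_spray "chart_image c" "Sc c" by (rule local_planar_spray[OF c])
  have "\<D> (\<lambda>w. form_coords c curvature_one_form w v) z x = \<D> (\<lambda>w. iso_form (Sc c) w v) z x" for v x
    by (rule fderiv_cong[OF open_domain z]) (simp add: form_coords_curvature)
  then show ?thesis
    by (simp add: fn_d1_def contract2_def contract1_def ext_d1_def tangent_J_def)
qed

section \<open>The sign of the Ricci curvature\<close>

text \<open>The Ricci scalar as a function on the slit bundle. It is read off in an arbitrary chart;
\<open>coordinate_invariance\<close> makes the choice irrelevant.\<close>

definition ricci_fun :: "('a, real^2) tpoint \<Rightarrow> real" where
  "ricci_fun q = (let c = (SOME c. c \<in> slit_atlas A \<and> q \<in> fst c) in ricci_scalar (Sc c) (snd c q))"

lemma ricci_fun_eq: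
  assumes "c \<in> slit_atlas A" "q \<in> fst c" shows "ricci_fun q = ricci_scalar (Sc c) (snd c q)"
proof -
  have "\<exists>c. c \<in> slit_atlas A \<and> q \<in> fst c" using assms by blast
  from someI_ex[OF this] show ?thesis
    unfolding ricci_fun_def Let_def using coordinate_invariance(1)[OF assms(1) _ assms(2)] by blast
qed

lemma ricci_fun_chart_inv:
  "c \<in> slit_atlas A \<Longrightarrow> z \<in> chart_image c \<Longrightarrow> ricci_fun (chart_inv c z) = ricci_scalar (Sc c) z"
  using ricci_fun_eq[of c "chart_inv c z"] chart_inv_in[of z c] by (simp add: chart_chart_inv)

lemma ricci_scalar_fibre_scaling:
  assumes c: "c \<in> A" and x: "x \<in> chart_image c" "y \<noteq> 0" "r > 0"
  shows "ricci_scalar (Sc (SC c)) (x, r *\<^sub>R y) = r\<^sup>2 * ricci_scalar (Sc (SC c)) (x, y)"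
proof -
  interpret planar_spray "chart_image (SC c)" "Sc (SC c)"
    by (rule local_planar_spray) (use c in \<open>simp add: slit_atlas_def\<close>)
  show ?thesis
  proof (rule homogeneous_imp_scaling)
    show "homogeneous_on (chart_image (SC c)) (real 2) \<rho>" using homogeneous_ricci_scalar by simp
    show "(x, t *\<^sub>R y) \<in> chart_image (SC c)" if "t > 0" for t
      using x that by (simp add: slit_chart_image[OF c])
  qed (use x smooth_on_differentiable[OF smooth_ricci_scalar] in auto)
qed

text \<open>The base points over which \<open>\<kappa> R\<close> is positive somewhere in the fibre form an open set, for \<open>\<kappa> = 1\<close> and for
\<open>\<kappa> = - 1\<close>, since projections are open. The two sets cover \<open>M\<close>, and they are disjoint because the
punctured plane is connected and \<open>R\<close> has no zero. As \<open>M\<close> is connected, one of them is empty.\<close>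

lemma constant_sign:
  assumes conn: "connected_space (manifold_topology A)"
    and nz: "\<And>c z. c \<in> slit_atlas A \<Longrightarrow> z \<in> chart_image c \<Longrightarrow> ricci_scalar (Sc c) z \<noteq> 0"
  shows "\<exists>\<kappa>. \<kappa> * \<kappa> = 1 \<and> (\<forall>q\<in>carrier_of (slit_atlas A). \<kappa> * ricci_fun q > 0)"
proof -
  let ?R = "\<lambda>c. ricci_scalar (Sc (SC c))"
  define P where "P \<kappa> = {p \<in> carrier_of A. \<exists>v. (p, v) \<in> carrier_of (slit_atlas A) \<and> \<kappa> * ricci_fun (p, v) > 0}" for \<kappa>
  have P_iff: "p \<in> P \<kappa> \<longleftrightarrow> (\<exists>y. y \<noteq> 0 \<and> \<kappa> * ?R c (snd c p, y) > 0)" if c: "c \<in> A" and p: "p \<in> fst c" for c p \<kappa>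
  proof
    have C: "SC c \<in> slit_atlas A" using c by (simp add: slit_atlas_def)
    {
      assume "p \<in> P \<kappa>"
      then obtain v where v: "(p, v) \<in> carrier_of (slit_atlas A)" "\<kappa> * ricci_fun (p, v) > 0" by (auto simp: P_def)
      then have "tangent_vector A p v" "v \<noteq> (\<lambda>_. 0)"
        by (auto simp: carrier_of_def slit_atlas_def in_slit_chart)
      then have "(p, v) \<in> fst (SC c)" "v c \<noteq> 0"
        using p by (auto simp: in_slit_chart tangent_vector_zero_iff[OF c p])
      then show "\<exists>y. y \<noteq> 0 \<and> \<kappa> * ?R c (snd c p, y) > 0"
        using v(2) ricci_fun_eq[OF C] by (auto simp: slit_chart_apply)
    }
    {
      assume "\<exists>y. y \<noteq> 0 \<and> \<kappa> * ?R c (snd c p, y) > 0"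
      then obtain y where y: "y \<noteq> 0" "\<kappa> * ?R c (snd c p, y) > 0" by blast
      have "(p, vec_of c p y) \<in> fst (SC c)"
        using tangent_vec_of[OF c p] tangent_vector_zero_iff[OF c p tangent_vec_of[OF c p], of y] y(1) p
        by (simp add: in_slit_chart vec_of_same[OF c p])
      then show "p \<in> P \<kappa>"
        using y(2) ricci_fun_eq[OF C] p c C
        by (auto simp: P_def carrier_of_def slit_chart_apply vec_of_same[OF c p])
    }
  qed
  have openP: "openin (manifold_topology A) (P \<kappa>)" for \<kappa>
    unfolding openin_manifold_topology[OF smooth_atlas]
  proof (intro conjI ballI)
    show "P \<kappa> \<subseteq> carrier_of A" by (auto simp: P_def)
    fix c assume c: "c \<in> A"
    interpret planar_spray "chart_image (SC c)" "Sc (SC c)"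
      by (rule local_planar_spray) (use c in \<open>simp add: slit_atlas_def\<close>)
    have "snd c ` (P \<kappa> \<inter> fst c) = fst ` {z \<in> chart_image (SC c). \<kappa> * \<rho> z \<in> {0<..}}"
    proof (intro equalityI subsetI)
      fix x assume "x \<in> snd c ` (P \<kappa> \<inter> fst c)"
      then obtain p where p: "p \<in> P \<kappa>" "p \<in> fst c" "x = snd c p" by blast
      then obtain y where "y \<noteq> 0" "\<kappa> * \<rho> (x, y) > 0" using P_iff[OF c p(2)] by blast
      then have "(x, y) \<in> {z \<in> chart_image (SC c). \<kappa> * \<rho> z \<in> {0<..}}"
        using chart_in_image[OF p(2)] p by (simp add: slit_chart_image[OF c])
      then show "x \<in> fst ` {z \<in> chart_image (SC c). \<kappa> * \<rho> z \<in> {0<..}}" by force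
    next
      fix x assume "x \<in> fst ` {z \<in> chart_image (SC c). \<kappa> * \<rho> z \<in> {0<..}}"
      then obtain y where y: "(x, y) \<in> chart_image (SC c)" "\<kappa> * \<rho> (x, y) > 0" by auto
      then have "x \<in> chart_image c" "y \<noteq> 0" by (simp_all add: slit_chart_image[OF c])
      then obtain p where p: "p \<in> fst c" "x = snd c p" "y \<noteq> 0" by (auto simp: chart_image_def)
      then show "x \<in> snd c ` (P \<kappa> \<inter> fst c)" using P_iff[OF c p(1)] y by blast
    qed
    moreover have "open {z \<in> chart_image (SC c). \<kappa> * \<rho> z \<in> {0<..}}"
      using continuous_open_preimage[OF _ open_domain, of "\<lambda>z. \<kappa> * \<rho> z" "{0<..}"]
        continuous_on_mult[OF continuous_on_const smooth_on_continuous[OF smooth_ricci_scalar], of \<kappa>]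
      by (simp add: vimage_def Int_def conj_commute)
    ultimately show "open (snd c ` (P \<kappa> \<inter> fst c))" by (simp only: open_image_fst)
  qed
  have disj: "P 1 \<inter> P (- 1) = {}"
  proof (rule ccontr)
    assume "P 1 \<inter> P (- 1) \<noteq> {}"
    then obtain p where p: "p \<in> P 1" "p \<in> P (- 1)" by blast
    then obtain c where c: "c \<in> A" "p \<in> fst c" by (auto simp: P_def carrier_of_def)
    have C: "SC c \<in> slit_atlas A" using c by (simp add: slit_atlas_def)
    interpret planar_spray "chart_image (SC c)" "Sc (SC c)" by (rule local_planar_spray[OF C])
    obtain y y' where y: "y \<noteq> 0" "\<rho> (snd c p, y) > 0" "y' \<noteq> 0" "\<rho> (snd c p, y') < 0"
      using P_iff[OF c, of 1] P_iff[OF c, of "- 1"] p by auto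
    have im: "(snd c p, x) \<in> chart_image (SC c)" if "x \<noteq> 0" for x
      using that chart_in_image[OF c(2)] by (simp add: slit_chart_image[OF c(1)])
    have "continuous_on (- {0}) (\<lambda>x. \<rho> (snd c p, x))"
      by (rule continuous_on_compose2[OF smooth_on_continuous[OF smooth_ricci_scalar]])
        (auto intro!: continuous_intros im)
    then have "connected ((\<lambda>x. \<rho> (snd c p, x)) ` (- {0}))"
      by (intro connected_continuous_image connected_punctured_universe) (simp_all add: DIM_cart)
    moreover have "\<rho> (snd c p, y') \<in> (\<lambda>x. \<rho> (snd c p, x)) ` (- {0})" "\<rho> (snd c p, y) \<in> (\<lambda>x. \<rho> (snd c p, x)) ` (- {0})"
      using y by auto
    ultimately have "{\<rho> (snd c p, y')..\<rho> (snd c p, y)} \<subseteq> (\<lambda>x. \<rho> (snd c p, x)) ` (- {0})"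
      by (rule connected_contains_Icc)
    then have "0 \<in> (\<lambda>x. \<rho> (snd c p, x)) ` (- {0})" using y(2,4) by auto
    then show False using nz[OF C im] by fastforce
  qed
  have cover: "topspace (manifold_topology A) \<subseteq> P 1 \<union> P (- 1)"
  proof
    fix p assume "p \<in> topspace (manifold_topology A)"
    then have "p \<in> carrier_of A"
      using openin_topspace[of "manifold_topology A"] openin_manifold_topology[OF smooth_atlas] by blast
    then obtain c where c: "c \<in> A" "p \<in> fst c" by (auto simp: carrier_of_def)
    have C: "SC c \<in> slit_atlas A" using c by (simp add: slit_atlas_def)
    have "axis 1 1 \<noteq> (0::real^2)" by (simp add: axis_eq_0_iff)
    moreover have "?R c (snd c p, axis 1 1) \<noteq> 0"
      using nz[OF C, of "(snd c p, axis 1 1)"] chart_in_image[OF c(2)] \<open>axis 1 1 \<noteq> 0\<close>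
      by (simp add: slit_chart_image[OF c(1)])
    ultimately show "p \<in> P 1 \<union> P (- 1)"
      using P_iff[OF c, of 1] P_iff[OF c, of "- 1"]
      by (cases "?R c (snd c p, axis 1 1) > 0") (auto intro!: exI[of _ "axis 1 1"])
  qed
  have "P 1 = {} \<or> P (- 1) = {}"
    using conn openP disj cover unfolding connected_space_def by blast
  then have "\<exists>\<kappa>. \<kappa> * \<kappa> = 1 \<and> P (- \<kappa>) = {}"
  proof
    assume "P 1 = {}"
    then show ?thesis by (intro exI[of _ "- 1"]) simp
  next
    assume "P (- 1) = {}"
    then show ?thesis by (intro exI[of _ 1]) simp
  qed
  then obtain \<kappa> where \<kappa>: "\<kappa> * \<kappa> = 1" "P (- \<kappa>) = {}" by blast
  have "\<kappa> * ricci_fun q > 0" if q: "q \<in> carrier_of (slit_atlas A)" for q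
  proof -
    obtain C where C: "C \<in> slit_atlas A" "q \<in> fst C" using q by (auto simp: carrier_of_def)
    obtain d where "d \<in> A" "C = SC d" by (rule slit_atlasE[OF C(1)])
    then have "fst q \<in> carrier_of A"
      using C(2) by (cases q) (auto simp: carrier_of_def in_slit_chart)
    then have "\<not> - \<kappa> * ricci_fun q > 0"
      using \<kappa>(2) q by (cases q) (auto simp: P_def)
    moreover have "ricci_fun q \<noteq> 0" using nz[OF C(1) chart_in_image[OF C(2)]] ricci_fun_eq[OF C] by simp
    moreover have "\<kappa> \<noteq> 0" using \<kappa>(1) by auto
    ultimately have "\<kappa> * ricci_fun q \<noteq> 0" "\<not> \<kappa> * ricci_fun q < 0" by simp_all
    then show ?thesis by linarith
  qed
  then show ?thesis using \<kappa>(1) by blast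
qed

end

section \<open>The Finsler function of a spray with closed curvature form\<close>

text \<open>Near a point of the zero section, \<open>g (x, y) = |y| g (x, y/|y|)\<close> is bounded by a multiple of \<open>|y|\<close>, as \<open>g\<close> is bounded
on the product of a small closed ball and the unit sphere.\<close>

lemma continuous_homogeneous_extension:
  fixes g :: "'e::euclidean_space \<times> 'e \<Rightarrow> real"
  assumes U: "open U" and g: "continuous_on (U \<times> (- {0})) g"
    and hom: "\<And>x y r. x \<in> U \<Longrightarrow> y \<noteq> 0 \<Longrightarrow> r > 0 \<Longrightarrow> g (x, r *\<^sub>R y) = r * g (x, y)"
  shows "continuous_on (U \<times> UNIV) (\<lambda>z. if snd z = 0 then 0 else g z)"
proof -
  let ?h = "\<lambda>z. if snd z = 0 then 0 else g z"
  have o: "open (U \<times> (- {0} :: 'e set))" "open (U \<times> (UNIV :: 'e set))"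
    using U by (auto intro!: open_Times)
  have "isCont ?h z" if z: "z \<in> U \<times> UNIV" for z
  proof (cases "snd z = 0")
    case False
    then have z': "z \<in> U \<times> (- {0})" using z by auto
    have "continuous_on (U \<times> (- {0})) ?h"
      by (rule iffD2[OF continuous_on_cong[OF refl] g]) auto
    then show ?thesis using z' o(1) continuous_on_eq_continuous_at by blast
  next
    case True
    obtain r where r: "r > 0" "cball (fst z) r \<subseteq> U" using U z open_contains_cball by (metis mem_Times_iff)
    let ?K = "cball (fst z) r \<times> sphere (0::'e) 1"
    have "compact ?K" by (intro compact_Times compact_cball compact_sphere)
    moreover have "continuous_on ?K g" by (rule continuous_on_subset[OF g]) (use r(2) in auto)
    ultimately have "bounded (g ` ?K)" by (intro compact_imp_bounded compact_continuous_image)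
    then obtain B where B: "\<And>w. w \<in> ?K \<Longrightarrow> norm (g w) \<le> B" unfolding bounded_iff by auto
    have bound: "norm (?h w) \<le> B * norm (snd w)" if w: "fst w \<in> ball (fst z) r" for w
    proof (cases "snd w = 0")
      case False
      \<comment> \<open>the projection to the unit sphere, where \<open>B\<close> bounds \<open>g\<close>\<close>
      let ?u = "(1 / norm (snd w)) *\<^sub>R snd w"
      have u: "(fst w, ?u) \<in> ?K" using w False by auto
      have "g (fst w, norm (snd w) *\<^sub>R ?u) = norm (snd w) * g (fst w, ?u)"
        by (rule hom) (use w r(2) False in auto)
      then have "g w = norm (snd w) * g (fst w, ?u)" using False by simp
      then have "norm (g w) = norm (snd w) * norm (g (fst w, ?u))" by (simp add: abs_mult)
      also have "\<dots> \<le> norm (snd w) * B" using B[OF u] by (intro mult_left_mono) auto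
      finally show ?thesis using False by (simp add: mult.commute)
    qed simp
    have "\<forall>\<^sub>F w in at z. w \<in> ball (fst z) r \<times> UNIV"
      using r(1) by (intro eventually_at_in_open') (auto intro!: open_Times simp: mem_Times_iff)
    then have ev: "\<forall>\<^sub>F w in at z. norm (?h w) \<le> B * norm (snd w)"
      by (rule eventually_mono) (use bound in \<open>simp add: mem_Times_iff\<close>)
    have "((\<lambda>w. B * norm (snd w)) \<longlongrightarrow> B * norm (snd z)) (at z)"
      by (intro tendsto_intros)
    then have "((\<lambda>w. B * norm (snd w)) \<longlongrightarrow> 0) (at z)" by (simp only: True norm_zero mult_zero_right)
    from Lim_null_comparison[OF ev this] show ?thesis by (simp add: isCont_def True)
  qed
  then show ?thesis using continuous_on_eq_continuous_at[OF o(2)] by blast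
qed

context planar_spray_manifold
begin

lemma chart_inv_scale:
  assumes c: "c \<in> A" and z: "x \<in> chart_image c" "y \<noteq> 0" "r > 0"
  obtains p v where "chart_inv (SC c) (x, y) = (p, v)" "chart_inv (SC c) (x, r *\<^sub>R y) = (p, \<lambda>c. r *\<^sub>R v c)"
    "(p, v) \<in> carrier_of (tangent_atlas A)"
proof -
  obtain p v where pv: "chart_inv (SC c) (x, y) = (p, v)" by (cases "chart_inv (SC c) (x, y)")
  have im: "(x, y) \<in> chart_image (SC c)" using z by (simp add: slit_chart_image[OF c])
  have p: "p \<in> fst c" "tangent_vector A p v" "v \<noteq> (\<lambda>_. 0)" "snd c p = x" "v c = y"
    using chart_inv_in[OF im] chart_chart_inv[OF im] unfolding pv by (simp_all add: in_slit_chart slit_chart_apply)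
  have rv: "(p, \<lambda>c. r *\<^sub>R v c) \<in> fst (SC c)"
    using p z(2,3) tangent_vector_scale[OF p(2), of r]
      tangent_vector_zero_iff[OF c p(1) tangent_vector_scale[OF p(2), of r]]
    by (simp add: in_slit_chart)
  have "chart_inv (SC c) (x, r *\<^sub>R y) = (p, \<lambda>c. r *\<^sub>R v c)"
    using chart_inv_chart[OF inj_slit_chart[OF c] rv] p by (simp add: slit_chart_apply)
  moreover have "(p, v) \<in> carrier_of (tangent_atlas A)"
    using p c by (auto simp: carrier_of_def tangent_atlas_def in_tangent_chart)
  ultimately show ?thesis using that pv by blast
qed

text \<open>The scaling law of a Finsler function on tangent vectors becomes Euler's identity in each chart.\<close>

lemma finsler_fun_coords:
  assumes F: "finsler_function A F" and c: "c \<in> slit_atlas A"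
  shows "smooth_on (chart_image c) (fun_coords c F)"
    and "homogeneous_on (chart_image c) 1 (fun_coords c F)"
proof -
  show sm: "smooth_on (chart_image c) (fun_coords c F)"
    using F c by (simp add: finsler_function_def smooth_fun_def o_def fun_coords_def[abs_def])
  obtain d where d: "d \<in> A" "c = SC d" by (rule slit_atlasE[OF c])
  show "homogeneous_on (chart_image c) 1 (fun_coords c F)"
    unfolding homogeneous_on_def
  proof
    fix z assume z: "z \<in> chart_image c"
    obtain x y where xy: "z = (x, y)" by (cases z)
    have x: "x \<in> chart_image d" "y \<noteq> 0" using z by (simp_all add: xy d(2) slit_chart_image[OF d(1)])
    have "fun_coords c F (x, r *\<^sub>R y) = r ^ 1 * fun_coords c F (x, y)" if r: "r > 0" for r
    proof -
      obtain p v where pv: "chart_inv (SC d) (x, y) = (p, v)"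
        "chart_inv (SC d) (x, r *\<^sub>R y) = (p, \<lambda>c. r *\<^sub>R v c)" "(p, v) \<in> carrier_of (tangent_atlas A)"
        by (rule chart_inv_scale[OF d(1) x r])
      have "F (p, \<lambda>c. r *\<^sub>R v c) = r * F (p, v)"
        using F pv(3) r unfolding finsler_function_def by fastforce
      then show ?thesis using pv by (simp add: fun_coords_def d(2))
    qed
    from scaling_imp_homogeneous[of "fun_coords c F", OF this] show "\<D> (fun_coords c F) z (0, snd z) = 1 *\<^sub>R fun_coords c F z"
      using smooth_on_differentiable[OF sm z] by (simp add: xy)
  qed
qed

lemma metrizable_imp_conditions:
  assumes F: "finsler_function A F" "metrizable_by A S F" "constant_flag_curvature A S F \<kappa>"
    and c: "c \<in> slit_atlas A" and z: "z \<in> chart_image c"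
  shows "fn_d1 tangent_J (form_coords c curvature_one_form) z u w = 0"
    and "fn_d0 (h_proj (Sc c)) (ricci_scalar (Sc c)) z u = 0"
proof -
  interpret planar_spray "chart_image c" "Sc c" by (rule local_planar_spray[OF c])
  let ?f = "fun_coords c F"
  have el: "ext_d1 (fn_d0 tangent_J (\<lambda>w. (?f w)\<^sup>2)) z (Sc c z) u = - ext_d0 (\<lambda>w. (?f w)\<^sup>2) z u"
    if "z \<in> chart_image c" for z u
    using F(2) c that unfolding metrizable_by_def by blast
  have curv: "jacobi (Sc c) z u =
      \<kappa> *\<^sub>R ((?f z)\<^sup>2 *\<^sub>R tangent_J z u - (?f z * fn_d0 tangent_J ?f z u) *\<^sub>R liouville z)"
    if "z \<in> chart_image c" for z u
    using F(3) c that unfolding constant_flag_curvature_def by blast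
  note nec = constant_curvature_necessary[OF finsler_fun_coords[OF F(1) c] el curv z]
  show "fn_d1 tangent_J (form_coords c curvature_one_form) z u w = 0"
    unfolding fn_d1_curvature[OF c z] by (rule nec(1))
  show "fn_d0 (h_proj (Sc c)) (ricci_scalar (Sc c)) z u = 0" by (rule nec(2))
qed

text \<open>The Finsler function with \<open>F\<^sup>2 = \<kappa> R\<close>, extended by \<open>0\<close> to the zero section, where \<open>ricci_fun\<close> has no meaning.\<close>

definition ricci_finsler :: "real \<Rightarrow> ('a, real^2) tpoint \<Rightarrow> real" where
  "ricci_finsler \<kappa> q = (if snd q = (\<lambda>_. 0) then 0 else sqrt (\<kappa> * ricci_fun q))"

lemma ricci_finsler_slit:
  assumes c: "c \<in> slit_atlas A" and z: "z \<in> chart_image c"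
  shows "fun_coords c (ricci_finsler \<kappa>) z = sqrt (\<kappa> * ricci_scalar (Sc c) z)"
proof -
  have "snd (chart_inv c z) \<noteq> (\<lambda>_. 0)"
    using chart_inv_in[OF z] c by (auto simp: slit_atlas_def slit_chart_def)
  then show ?thesis by (simp add: fun_coords_def ricci_finsler_def ricci_fun_chart_inv[OF c z])
qed

lemma continuous_ricci_finsler:
  "continuous_map (manifold_topology (tangent_atlas A)) euclideanreal (ricci_finsler \<kappa>)"
proof -
  let ?X = "manifold_topology (tangent_atlas A)" and ?F = "ricci_finsler \<kappa>"
  have op: "openin ?X {q \<in> carrier_of (tangent_atlas A). ?F q \<in> V}" if V: "open V" for V
    unfolding openin_manifold_topology[OF smooth_atlas_tangent]
  proof (intro conjI ballI)
    fix C assume "C \<in> tangent_atlas A"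
    then obtain c where c: "c \<in> A" "C = TC c" by (auto simp: tangent_atlas_def)
    let ?g = "\<lambda>z. sqrt (\<kappa> * ricci_scalar (Sc (SC c)) z)"
    let ?h = "\<lambda>z. if snd z = 0 then 0 else ?g z"
    have C: "SC c \<in> slit_atlas A" using c by (simp add: slit_atlas_def)
    interpret planar_spray "chart_image (SC c)" "Sc (SC c)" by (rule local_planar_spray[OF C])
    have "continuous_on (chart_image c \<times> UNIV) ?h"
    proof (rule continuous_homogeneous_extension[OF open_chart_image[OF c(1)]])
      show "continuous_on (chart_image c \<times> (- {0})) ?g"
        using smooth_on_continuous[OF smooth_ricci_scalar]
        by (intro continuous_intros) (simp add: slit_chart_image[OF c(1)])
      show "?g (x, r *\<^sub>R y) = r * ?g (x, y)" if "x \<in> chart_image c" "y \<noteq> 0" "r > 0" for x y r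
      proof -
        have "?g (x, r *\<^sub>R y) = sqrt (r\<^sup>2 * (\<kappa> * \<rho> (x, y)))"
          using ricci_scalar_fibre_scaling[OF c(1) that] by (simp add: mult.left_commute)
        then show ?thesis using that(3) by (simp add: real_sqrt_mult)
      qed
    qed
    then have "open (?h -` V \<inter> (chart_image c \<times> UNIV))"
      using V by (intro open_chart_image c open_Times open_UNIV
          continuous_on_open_vimage[THEN iffD1, rule_format]) auto
    moreover have Fh: "?F (p, v) = ?h (snd c p, v c)" if "p \<in> fst c" "tangent_vector A p v" for p v
    proof (cases "v = (\<lambda>_. 0)")
      case False
      then have "(p, v) \<in> fst (SC c)" using that by (simp add: in_slit_chart)
      from ricci_fun_eq[OF C this] show ?thesis
        using False tangent_vector_zero_iff[OF c(1) that] by (simp add: ricci_finsler_def slit_chart_apply)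
    qed (simp add: ricci_finsler_def)
    have "snd C ` ({q \<in> carrier_of (tangent_atlas A). ?F q \<in> V} \<inter> fst C) = ?h -` V \<inter> (chart_image c \<times> UNIV)"
    proof (intro equalityI subsetI)
      fix z assume "z \<in> snd C ` ({q \<in> carrier_of (tangent_atlas A). ?F q \<in> V} \<inter> fst C)"
      then obtain p v where pv: "(p, v) \<in> fst (TC c)" "?F (p, v) \<in> V" "z = snd (TC c) (p, v)"
        by (auto simp: c(2))
      then have "p \<in> fst c" "tangent_vector A p v" by (simp_all add: in_tangent_chart)
      then show "z \<in> ?h -` V \<inter> (chart_image c \<times> UNIV)"
        using pv Fh chart_in_image by (simp add: tangent_chart_apply)
    next
      fix z assume z: "z \<in> ?h -` V \<inter> (chart_image c \<times> UNIV)"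
      then have "z \<in> chart_image (TC c)" by (simp add: tangent_chart_image[OF c(1)])
      then obtain p v where pv: "(p, v) \<in> fst (TC c)" "z = snd (TC c) (p, v)"
        by (auto simp: chart_image_def)
      then have pv': "p \<in> fst c" "tangent_vector A p v" by (simp_all add: in_tangent_chart)
      have "?F (p, v) \<in> V" using z pv(2) Fh[OF pv'] by (simp add: tangent_chart_apply)
      moreover have "(p, v) \<in> carrier_of (tangent_atlas A)"
        using pv(1) c(1) by (auto simp: carrier_of_def tangent_atlas_def)
      ultimately show "z \<in> snd C ` ({q \<in> carrier_of (tangent_atlas A). ?F q \<in> V} \<inter> fst C)"
        using pv c(2) by blast
    qed
    ultimately show "open (snd C ` ({q \<in> carrier_of (tangent_atlas A). ?F q \<in> V} \<inter> fst C))" by simp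
  qed auto
  have ts: "topspace ?X = carrier_of (tangent_atlas A)"
  proof
    show "topspace ?X \<subseteq> carrier_of (tangent_atlas A)"
      using openin_topspace[of ?X] openin_manifold_topology[OF smooth_atlas_tangent] by blast
    show "carrier_of (tangent_atlas A) \<subseteq> topspace ?X"
      using openin_subset[OF op[OF open_UNIV]] by simp
  qed
  show ?thesis
    unfolding continuous_map_def ts using op by (simp add: open_openin[symmetric])
qed

text \<open>The sign hypothesis gives smoothness and positivity of the square root, the degree \<open>2\<close> of \<open>R\<close> gives the
scaling law, and the rank hypothesis gives regularity.\<close>

lemma ricci_finsler_is_finsler:
  assumes sign: "\<kappa> * \<kappa> = 1" "\<And>q. q \<in> carrier_of (slit_atlas A) \<Longrightarrow> \<kappa> * ricci_fun q > 0"
    and rank: "\<And>c z. c \<in> slit_atlas A \<Longrightarrow> z \<in> chart_image c \<Longrightarrow>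
      form_rank (ext_d1 (fn_d0 tangent_J (ricci_scalar (Sc c))) z) = 4"
  shows "finsler_function A (ricci_finsler \<kappa>)"
    and "\<And>c z. c \<in> slit_atlas A \<Longrightarrow> z \<in> chart_image c \<Longrightarrow>
      (fun_coords c (ricci_finsler \<kappa>) z)\<^sup>2 = \<kappa> * ricci_scalar (Sc c) z"
proof -
  let ?F = "ricci_finsler \<kappa>"
  have pos: "\<kappa> * ricci_scalar (Sc c) z > 0" if "c \<in> slit_atlas A" "z \<in> chart_image c" for c z
    using sign(2)[of "chart_inv c z"] that chart_inv_in[OF that(2)]
    by (auto simp: ricci_fun_chart_inv carrier_of_def)
  show sq: "(fun_coords c ?F z)\<^sup>2 = \<kappa> * ricci_scalar (Sc c) z"
    if "c \<in> slit_atlas A" "z \<in> chart_image c" for c z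
    using pos[OF that] by (simp add: ricci_finsler_slit[OF that])
  show "finsler_function A ?F"
    unfolding finsler_function_def
  proof (intro conjI)
    show "smooth_fun (slit_atlas A) ?F"
      unfolding smooth_fun_def
    proof
      fix c assume c: "c \<in> slit_atlas A"
      interpret planar_spray "chart_image c" "Sc c" by (rule local_planar_spray[OF c])
      have "smooth_on (chart_image c) (\<lambda>z. (\<kappa> * \<rho> z) powr (1/2))"
        by (intro smooth_on_powr smooth_on_mult open_domain smooth_on_const smooth_ricci_scalar pos[OF c])
      moreover have "(\<kappa> * \<rho> z) powr (1/2) = (?F \<circ> chart_inv c) z" if z: "z \<in> chart_image c" for z
        using ricci_finsler_slit[OF c z, of \<kappa>] pos[OF c z] by (simp add: fun_coords_def powr_half_sqrt)
      ultimately show "smooth_on (chart_image c) (?F \<circ> chart_inv c)"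
        by (rule iffD1[OF smooth_on_cong[OF open_domain], rotated])
    qed
    show "\<forall>q\<in>carrier_of (slit_atlas A). ?F q > 0"
    proof
      fix q assume q: "q \<in> carrier_of (slit_atlas A)"
      then have "snd q \<noteq> (\<lambda>_. 0)" by (auto simp: carrier_of_def slit_atlas_def slit_chart_def)
      then show "?F q > 0" using sign(2)[OF q] by (simp add: ricci_finsler_def)
    qed
    show "\<forall>(p, v)\<in>carrier_of (tangent_atlas A). \<forall>r\<ge>0. ?F (p, \<lambda>c. r *\<^sub>R v c) = r * ?F (p, v)"
    proof (intro ballI, clarify)
      fix p v r assume pv: "(p, v) \<in> carrier_of (tangent_atlas A)" and r: "0 \<le> (r::real)"
      obtain c where c: "c \<in> A" "p \<in> fst c" "tangent_vector A p v"
        using pv by (auto simp: carrier_of_def tangent_atlas_def in_tangent_chart)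
      show "?F (p, \<lambda>c. r *\<^sub>R v c) = r * ?F (p, v)"
      proof (cases "r = 0 \<or> v = (\<lambda>_. 0)")
        case True
        then show ?thesis by (auto simp: ricci_finsler_def)
      next
        case False
        then have r: "r > 0" and v: "v \<noteq> (\<lambda>_. 0)" using r by auto
        have vc: "v c \<noteq> 0" using tangent_vector_zero_iff[OF c] v by simp
        have rv: "(\<lambda>c. r *\<^sub>R v c) \<noteq> (\<lambda>_. 0)"
          using tangent_vector_zero_iff[OF c(1,2) tangent_vector_scale[OF c(3), of r]] vc r by simp
        have C: "SC c \<in> slit_atlas A" using c by (simp add: slit_atlas_def)
        have "ricci_fun (p, \<lambda>c. r *\<^sub>R v c) = ricci_scalar (Sc (SC c)) (snd c p, r *\<^sub>R v c)"
          using ricci_fun_eq[OF C, of "(p, \<lambda>c. r *\<^sub>R v c)"] c(2) tangent_vector_scale[OF c(3), of r] rv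
          by (simp add: in_slit_chart slit_chart_apply)
        also have "\<dots> = r\<^sup>2 * ricci_scalar (Sc (SC c)) (snd c p, v c)"
          by (rule ricci_scalar_fibre_scaling[OF c(1) chart_in_image[OF c(2)] vc r])
        also have "ricci_scalar (Sc (SC c)) (snd c p, v c) = ricci_fun (p, v)"
          using ricci_fun_eq[OF C, of "(p, v)"] c(2,3) v by (simp add: in_slit_chart slit_chart_apply)
        finally have "\<kappa> * ricci_fun (p, \<lambda>c. r *\<^sub>R v c) = r\<^sup>2 * (\<kappa> * ricci_fun (p, v))" by simp
        then have "sqrt (\<kappa> * ricci_fun (p, \<lambda>c. r *\<^sub>R v c)) = r * sqrt (\<kappa> * ricci_fun (p, v))"
          using r by (simp only: real_sqrt_mult real_sqrt_abs abs_of_pos)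
        then show ?thesis using v rv by (simp add: ricci_finsler_def)
      qed
    qed
    show "\<forall>c\<in>slit_atlas A. \<forall>z\<in>chart_image c. rank (metric_matrix (fun_coords c ?F) z) = CARD(2)"
    proof (intro ballI)
      fix c z assume c: "c \<in> slit_atlas A" and z: "z \<in> chart_image c"
      interpret planar_spray "chart_image c" "Sc c" by (rule local_planar_spray[OF c])
      have "\<kappa> \<noteq> 0" using sign(1) by auto
      with nondegenerate_metric[OF open_domain z smooth_ricci_scalar sq[OF c] _ rank[OF c z]]
      show "rank (metric_matrix (fun_coords c ?F) z) = CARD(2)" by simp
    qed
  qed (rule continuous_ricci_finsler)
qed

lemma conditions_imp_metrizable:
  assumes sign: "\<kappa> * \<kappa> = 1"
    and F: "finsler_function A F" "\<And>c z. c \<in> slit_atlas A \<Longrightarrow> z \<in> chart_image c \<Longrightarrow>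
      (fun_coords c F z)\<^sup>2 = \<kappa> * ricci_scalar (Sc c) z"
    and closed: "\<And>c z u w. c \<in> slit_atlas A \<Longrightarrow> z \<in> chart_image c \<Longrightarrow>
      fn_d1 tangent_J (form_coords c curvature_one_form) z u w = 0"
    and horizontal: "\<And>c z u. c \<in> slit_atlas A \<Longrightarrow> z \<in> chart_image c \<Longrightarrow>
      fn_d0 (h_proj (Sc c)) (ricci_scalar (Sc c)) z u = 0"
  shows "metrizable_by A S F" and "constant_flag_curvature A S F \<kappa>"
proof -
  have "ext_d1 (fn_d0 tangent_J (\<lambda>w. (fun_coords c F w)\<^sup>2)) z (Sc c z) u = - ext_d0 (\<lambda>w. (fun_coords c F w)\<^sup>2) z u"
    and "jacobi (Sc c) z u = \<kappa> *\<^sub>R ((fun_coords c F z)\<^sup>2 *\<^sub>R tangent_J z u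
       - (fun_coords c F z * fn_d0 tangent_J (fun_coords c F) z u) *\<^sub>R liouville z)"
    if c: "c \<in> slit_atlas A" and z: "z \<in> chart_image c" for c z u
  proof -
    interpret planar_spray "chart_image c" "Sc c" by (rule local_planar_spray[OF c])
    have cl: "fn_d1 tangent_J \<alpha> w x y = 0" if "w \<in> chart_image c" for w x y
      using closed[OF c that] fn_d1_curvature[OF c that] by simp
    note suff = constant_curvature_sufficient[OF finsler_fun_coords(1)[OF F(1) c] F(2)[OF c] sign cl
        horizontal[OF c] z]
    show "ext_d1 (fn_d0 tangent_J (\<lambda>w. (fun_coords c F w)\<^sup>2)) z (Sc c z) u = - ext_d0 (\<lambda>w. (fun_coords c F w)\<^sup>2) z u"
      by (rule suff(1))
    show "jacobi (Sc c) z u = \<kappa> *\<^sub>R ((fun_coords c F z)\<^sup>2 *\<^sub>R tangent_J z u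
       - (fun_coords c F z * fn_d0 tangent_J (fun_coords c F) z u) *\<^sub>R liouville z)"
      by (rule suff(2))
  qed
  then show "metrizable_by A S F" "constant_flag_curvature A S F \<kappa>"
    by (simp_all add: metrizable_by_def constant_flag_curvature_def)
qed

lemma curvature_components:
  assumes c: "c \<in> slit_atlas A" and z: "z \<in> chart_image c"
  shows "snd z $ 1 \<noteq> 0 \<Longrightarrow> form_coords c curvature_one_form z (axis 1 1, 0) = jacobi_comp (Sc c) 2 2 z / snd z $ 1 \<and>
      form_coords c curvature_one_form z (axis 2 1, 0) = - jacobi_comp (Sc c) 1 2 z / snd z $ 1"
    and "snd z $ 2 \<noteq> 0 \<Longrightarrow> form_coords c curvature_one_form z (axis 1 1, 0) = - jacobi_comp (Sc c) 2 1 z / snd z $ 2 \<and>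
      form_coords c curvature_one_form z (axis 2 1, 0) = jacobi_comp (Sc c) 1 1 z / snd z $ 2"
proof -
  interpret planar_spray "chart_image c" "Sc c" by (rule local_planar_spray[OF c])
  note comp = iso_form_components[OF z]
  show "snd z $ 1 \<noteq> 0 \<Longrightarrow> form_coords c curvature_one_form z (axis 1 1, 0) = jacobi_comp (Sc c) 2 2 z / snd z $ 1 \<and>
      form_coords c curvature_one_form z (axis 2 1, 0) = - jacobi_comp (Sc c) 1 2 z / snd z $ 1"
    using comp(1,2) by (simp add: form_coords_curvature[OF z] field_simps)
  show "snd z $ 2 \<noteq> 0 \<Longrightarrow> form_coords c curvature_one_form z (axis 1 1, 0) = - jacobi_comp (Sc c) 2 1 z / snd z $ 2 \<and>
      form_coords c curvature_one_form z (axis 2 1, 0) = jacobi_comp (Sc c) 1 1 z / snd z $ 2"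
    using comp(3,4) by (simp add: form_coords_curvature[OF z] field_simps)
qed

end

theorem theorem4p3:
  fixes A :: "('a, real^2) chart set"
    and S :: "('a, real^2) tpoint \<Rightarrow> (('a, real^2) tpoint, (real^2) \<times> (real^2)) tvec"
  assumes "smooth_manifold A"
    and "connected_space (manifold_topology A)"
    and "spray A S"
    and "\<forall>c\<in>slit_atlas A. \<forall>z\<in>chart_image c. ricci (vf_coords c S) z \<noteq> 0"
    and "\<forall>c\<in>slit_atlas A. \<forall>z\<in>chart_image c.
           form_rank (ext_d1 (fn_d0 tangent_J (ricci (vf_coords c S))) z) = 4"
  shows "\<exists>\<alpha>.
     semi_basic A \<alpha> \<and>
     isotropic_with A S \<alpha> \<and>
     (\<forall>c\<in>slit_atlas A. \<forall>z\<in>chart_image c.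
        let R = (\<lambda>i j. jacobi_comp (vf_coords c S) i j z);
            \<alpha>\<^sub>1 = form_coords c \<alpha> z (axis 1 1, 0);
            \<alpha>\<^sub>2 = form_coords c \<alpha> z (axis 2 1, 0);
            y = snd z
        in (y $ 1 \<noteq> 0 \<longrightarrow> \<alpha>\<^sub>1 = R 2 2 / y $ 1 \<and> \<alpha>\<^sub>2 = - R 1 2 / y $ 1) \<and>
           (y $ 2 \<noteq> 0 \<longrightarrow> \<alpha>\<^sub>1 = - R 2 1 / y $ 2 \<and> \<alpha>\<^sub>2 = R 1 1 / y $ 2)) \<and>
     ((\<exists>F \<kappa>. finsler_function A F \<and> metrizable_by A S F \<and> \<kappa> \<noteq> 0 \<and> constant_flag_curvature A S F \<kappa>) \<longleftrightarrow>
      (\<forall>c\<in>slit_atlas A. \<forall>z\<in>chart_image c. \<forall>u w. fn_d1 tangent_J (form_coords c \<alpha>) z u w = 0) \<and>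
      (\<forall>c\<in>slit_atlas A. \<forall>z\<in>chart_image c. \<forall>u.
         fn_d0 (h_proj (vf_coords c S)) (ricci_scalar (vf_coords c S)) z u = 0))"
proof -
  interpret planar_spray_manifold A S
    using assms(1,3) by unfold_locales (simp_all add: smooth_manifold_def)
  show ?thesis
  proof (intro exI[of _ curvature_one_form] conjI ballI)
    show "semi_basic A curvature_one_form" by (rule semi_basic_curvature)
    show "isotropic_with A S curvature_one_form" by (rule isotropic_with_curvature)
  next
    fix c z assume "c \<in> slit_atlas A" "z \<in> chart_image c"
    from curvature_components[OF this] show "let R = (\<lambda>i j. jacobi_comp (vf_coords c S) i j z);
            \<alpha>\<^sub>1 = form_coords c curvature_one_form z (axis 1 1, 0);
            \<alpha>\<^sub>2 = form_coords c curvature_one_form z (axis 2 1, 0);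
            y = snd z
        in (y $ 1 \<noteq> 0 \<longrightarrow> \<alpha>\<^sub>1 = R 2 2 / y $ 1 \<and> \<alpha>\<^sub>2 = - R 1 2 / y $ 1) \<and>
           (y $ 2 \<noteq> 0 \<longrightarrow> \<alpha>\<^sub>1 = - R 2 1 / y $ 2 \<and> \<alpha>\<^sub>2 = R 1 1 / y $ 2)"
      by (simp add: Let_def)
  next
    let ?closed = "\<forall>c\<in>slit_atlas A. \<forall>z\<in>chart_image c. \<forall>u w.
        fn_d1 tangent_J (form_coords c curvature_one_form) z u w = 0"
      and ?horizontal = "\<forall>c\<in>slit_atlas A. \<forall>z\<in>chart_image c. \<forall>u.
        fn_d0 (h_proj (vf_coords c S)) (ricci_scalar (vf_coords c S)) z u = 0"
    show "(\<exists>F \<kappa>. finsler_function A F \<and> metrizable_by A S F \<and> \<kappa> \<noteq> 0 \<and> constant_flag_curvature A S F \<kappa>) \<longleftrightarrow>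
      ?closed \<and> ?horizontal"
    proof
      assume "\<exists>F \<kappa>. finsler_function A F \<and> metrizable_by A S F \<and> \<kappa> \<noteq> 0 \<and> constant_flag_curvature A S F \<kappa>"
      then obtain F \<kappa> where "finsler_function A F" "metrizable_by A S F" "constant_flag_curvature A S F \<kappa>" by blast
      from metrizable_imp_conditions[OF this] show "?closed \<and> ?horizontal" by simp
    next
      assume cond: "?closed \<and> ?horizontal"
      obtain \<kappa> where \<kappa>: "\<kappa> * \<kappa> = 1" "\<forall>q\<in>carrier_of (slit_atlas A). \<kappa> * ricci_fun q > 0"
        using constant_sign[OF assms(2)] assms(4) by (auto simp: ricci_scalar_planar)
      have fin: "finsler_function A (ricci_finsler \<kappa>)"
        by (rule ricci_finsler_is_finsler(1)[OF \<kappa>(1)]) (use \<kappa>(2) assms(5) in \<open>auto simp: ricci_scalar_planar\<close>)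
      have sq: "(fun_coords c (ricci_finsler \<kappa>) z)\<^sup>2 = \<kappa> * ricci_scalar (vf_coords c S) z"
        if "c \<in> slit_atlas A" "z \<in> chart_image c" for c z
        by (rule ricci_finsler_is_finsler(2)[OF \<kappa>(1) _ _ that]) (use \<kappa>(2) assms(5) in \<open>auto simp: ricci_scalar_planar\<close>)
      have "metrizable_by A S (ricci_finsler \<kappa>)" "constant_flag_curvature A S (ricci_finsler \<kappa>) \<kappa>"
        using conditions_imp_metrizable[OF \<kappa>(1) fin sq] cond by auto
      moreover have "\<kappa> \<noteq> 0" using \<kappa>(1) by auto
      ultimately show "\<exists>F \<kappa>. finsler_function A F \<and> metrizable_by A S F \<and> \<kappa> \<noteq> 0 \<and> constant_flag_curvature A S F \<kappa>"
        using fin by blast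
    qed
  qed
qed

end
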